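(* There is a constant $C$ (independent of $V$, $m$ and $k$) such that the following holds for every $m\ge0$ and every potential of the form $V(x)=iW(x)^2$, where $W:\mathbb{R}^2\to\mathbb{C}^{2\times2}$ is a matrix-valued function with $W(x)=W(x)^*$, as in the context. Let $k\in\mathbb{C}\setminus\sigma(D_m)$ be an eigenvalue of the operator $D=D_m+V$, and let $\mu$ be the number in the upper half-plane defined by $\mu^2=k^2-m^2$. Then $$ \left(C\left(\left|\frac{k+m}{\mu}-1\right|+\left|\frac{k-m}{\mu}-1\right|\right)+1\right)\frac14\int_{\mathbb{R}^2}\operatorname{tr}|V|\,dx\ge 1 . $$
   Context: For $m\ge 0$, $D_m$ is the operator in $L^2(\mathbb{R}^2;\mathbb{C}^2)$ with domain the Sobolev space $\mathcal{H}^2(\mathbb{R}^2;\mathbb{C}^2)$ given by $$ D_m=\begin{pmatrix} m & 4\partial_{\bar z}^2\\ 4\partial_z^2 & -m\end{pmatrix},\qquad \partial_{\bar z}=\tfrac12\Bigl(\tfrac{\partial}{\partial x_1}+\tfrac1i\tfrac{\partial}{\partial x_2}\Bigr),\qquad \partial_z=\tfrac12\Bigl(\tfrac{\partial}{\partial x_1}-\tfrac1i\tfrac{\partial}{\partial x_2}\Bigr). $$ One has $D_m^2=\Delta^2+m^2$ and $\sigma(D_m)=(-\infty,-m]\cup[m,\infty)$. (For $k\notin\sigma(D_m)$, $k^2-m^2\notin[0,\infty)$, so exactly one square root $\mu$ has $\operatorname{Im}\mu>0$.) $W$ is a measurable function with values in the Hermitian $2\times 2$ complex matrices. In $\operatorname{tr}|V|$,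 $|V|$ denotes the matrix absolute value $(V^*V)^{1/2}$, so here $\operatorname{tr}|V(x)|=\operatorname{tr}W(x)^2$. The operator $D=D_m+V$ acts in $L^2(\mathbb{R}^2;\mathbb{C}^2)$ with domain $\mathcal{H}^2(\mathbb{R}^2;\mathbb{C}^2)$ (so $V$ is such that $Vu\in L^2$ for all $u\in\mathcal{H}^2$). A number $k\in\mathbb{C}$ is an eigenvalue of $D$ if $Du=ku$ for some nonzero $u\in\mathcal{H}^2(\mathbb{R}^2;\mathbb{C}^2)$. The integral is allowed to be $+\infty$, in which case the inequality is trivial. *)

theory Defs
  imports "HOL-Analysis.Analysis"
begin

text \<open>Elements of \<open>L\<^sup>2\<close> are represented by functions, not by equivalence classes; every identity
between elements of \<open>L\<^sup>2\<close> is therefore stated almost everywhere.\<close>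

definition L2 :: "(real ^ 'n::finite \<Rightarrow> 'b::euclidean_space) set" where
  "L2 = {u \<in> borel_measurable lebesgue. integrable lebesgue (\<lambda>x. (norm (u x))\<^sup>2)}"

definition L2_norm :: "(real ^ 'n::finite \<Rightarrow> 'b::euclidean_space) \<Rightarrow> real" where
  "L2_norm u = sqrt (\<integral>x. (norm (u x))\<^sup>2 \<partial>lebesgue)"

definition partial :: "'n::finite \<Rightarrow> (real ^ 'n \<Rightarrow> real) \<Rightarrow> real ^ 'n \<Rightarrow> real" where
  "partial i f x = frechet_derivative f (at x) (axis i 1)"

text \<open>A list of coordinates plays the role of a multi-index.\<close>

definition partials :: "'n::finite list \<Rightarrow> (real ^ 'n \<Rightarrow> real) \<Rightarrow> real ^ 'n \<Rightarrow> real" where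
  "partials \<alpha> f = foldr partial \<alpha> f"

text \<open>\<open>C\<^sub>c\<^sup>\<infinity>\<close>: if all iterated partial derivatives are (Frechet) differentiable, they are in particular
all continuous.\<close>

definition test_functions :: "(real ^ 'n::finite \<Rightarrow> real) set" where
  "test_functions =
    {\<phi>. compact (closure {x. \<phi> x \<noteq> 0}) \<and> (\<forall>\<alpha> x. partials \<alpha> \<phi> differentiable (at x))}"

definition has_weak_partials ::
  "'n::finite list \<Rightarrow> (real ^ 'n \<Rightarrow> 'b::euclidean_space) \<Rightarrow> (real ^ 'n \<Rightarrow> 'b) \<Rightarrow> bool" where
  "has_weak_partials \<alpha> u g \<longleftrightarrow>
    (\<forall>\<phi>\<in>test_functions.
      (\<integral>x. partials \<alpha> \<phi> x *\<^sub>R u x \<partial>lebesgue) = (-1) ^ length \<alpha> *\<^sub>R (\<integral>x. \<phi> x *\<^sub>R g x \<partial>lebesgue))"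

definition sobolev :: "nat \<Rightarrow> (real ^ 'n::finite \<Rightarrow> 'b::euclidean_space) set" where
  "sobolev s = {u \<in> L2. \<forall>\<alpha>. length \<alpha> \<le> s \<longrightarrow> (\<exists>g\<in>L2. has_weak_partials \<alpha> u g)}"

text \<open>A representative of the weak derivative of \<open>u\<close> in direction \<open>i\<close>, which is unique almost
everywhere if it exists in \<open>L\<^sup>2\<close>.\<close>

definition weak_partial ::
  "'n::finite \<Rightarrow> (real ^ 'n \<Rightarrow> 'b::euclidean_space) \<Rightarrow> real ^ 'n \<Rightarrow> 'b" where
  "weak_partial i u = (SOME g. g \<in> L2 \<and> has_weak_partials [i] u g)"

text \<open>An operator is given by a domain \<open>S\<close> and an action \<open>A\<close> on functions. The number \<open>z\<close> is in the
resolvent set if \<open>A - z\<close> has an everywhere defined bounded two-sided inverse \<open>R\<close>.\<close>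

definition resolvent_set ::
  "(real ^ 'n::finite \<Rightarrow> complex ^ 'd::finite) set
    \<Rightarrow> ((real ^ 'n \<Rightarrow> complex ^ 'd) \<Rightarrow> real ^ 'n \<Rightarrow> complex ^ 'd) \<Rightarrow> complex set" where
  "resolvent_set S A =
    {z. \<exists>R B.
      (\<forall>f\<in>L2. R f \<in> S \<and> L2_norm (R f) \<le> B * L2_norm f \<and>
         (AE x in lebesgue. A (R f) x - z *s R f x = f x)) \<and>
      (\<forall>u\<in>S. AE x in lebesgue. R (\<lambda>y. A u y - z *s u y) x = u x)}"

definition spectrum ::
  "(real ^ 'n::finite \<Rightarrow> complex ^ 'd::finite) set
    \<Rightarrow> ((real ^ 'n \<Rightarrow> complex ^ 'd) \<Rightarrow> real ^ 'n \<Rightarrow> complex ^ 'd) \<Rightarrow> complex set" where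
  "spectrum S A = - resolvent_set S A"

definition is_eigenvalue ::
  "(real ^ 'n::finite \<Rightarrow> complex ^ 'd::finite) set
    \<Rightarrow> ((real ^ 'n \<Rightarrow> complex ^ 'd) \<Rightarrow> real ^ 'n \<Rightarrow> complex ^ 'd) \<Rightarrow> complex \<Rightarrow> bool" where
  "is_eigenvalue S A z \<longleftrightarrow>
    (\<exists>u\<in>S. \<not> (AE x in lebesgue. u x = 0) \<and> (AE x in lebesgue. A u x = z *s u x))"

text \<open>The signs are opposite to the usual Wirtinger convention: \<open>1/i = -i\<close>.\<close>

definition d_zbar :: "(real ^ 2 \<Rightarrow> complex) \<Rightarrow> real ^ 2 \<Rightarrow> complex" where
  "d_zbar f x = 1 / 2 * (weak_partial 1 f x + 1 / \<i> * weak_partial 2 f x)"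

definition d_z :: "(real ^ 2 \<Rightarrow> complex) \<Rightarrow> real ^ 2 \<Rightarrow> complex" where
  "d_z f x = 1 / 2 * (weak_partial 1 f x - 1 / \<i> * weak_partial 2 f x)"

definition D_free :: "real \<Rightarrow> (real ^ 2 \<Rightarrow> complex ^ 2) \<Rightarrow> real ^ 2 \<Rightarrow> complex ^ 2" where
  "D_free m u x =
    vector [of_real m * u x $ 1 + 4 * d_zbar (d_zbar (\<lambda>y. u y $ 2)) x,
            4 * d_z (d_z (\<lambda>y. u y $ 1)) x - of_real m * u x $ 2]"

definition D_pert ::
  "real \<Rightarrow> (real ^ 2 \<Rightarrow> complex ^ 2 ^ 2) \<Rightarrow> (real ^ 2 \<Rightarrow> complex ^ 2) \<Rightarrow> real ^ 2 \<Rightarrow> complex ^ 2" where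
  "D_pert m V u x = D_free m u x + V x *v u x"

definition ctranspose :: "complex ^ 'n ^ 'm \<Rightarrow> complex ^ 'm ^ 'n" where
  "ctranspose A = (\<chi> i j. cnj (A $ j $ i))"

definition hermitian :: "complex ^ 'n ^ 'n \<Rightarrow> bool" where
  "hermitian A \<longleftrightarrow> ctranspose A = A"

definition pos_semidef :: "complex ^ 'n::finite ^ 'n \<Rightarrow> bool" where
  "pos_semidef A \<longleftrightarrow> hermitian A \<and> (\<forall>v. 0 \<le> Re (\<Sum>i\<in>UNIV. cnj (v $ i) * (A *v v) $ i))"

text \<open>\<open>(A\<^sup>* A)\<^sup>1\<^sup>/\<^sup>2\<close>, the unique positive semidefinite square root.\<close>

definition matrix_abs :: "complex ^ 'n::finite ^ 'n \<Rightarrow> complex ^ 'n ^ 'n" where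
  "matrix_abs A = (THE P. pos_semidef P \<and> P ** P = ctranspose A ** A)"

end

theory Submission
  imports Defs "HOL-Probability.Probability"
begin

text \<open>
The inequality is a Birman--Schwinger estimate in which the free resolvent enters only through its
Fourier symbol. If the trace of \<open>|V|\<close> is not integrable, there is nothing to prove. Otherwise let \<open>u\<close>
be an eigenfunction, \<open>v = W u\<close> and \<open>f = - \<i> W v\<close>, so that \<open>(D\<^sub>m - k) u = f\<close>. Then \<open>v\<close> is square-integrable,
and \<open>f\<close> is integrable. On the Fourier side \<open>D\<^sub>m\<close> is multiplication by a Hermitian matrix \<open>D\<^sub>m(\<xi>)\<close> with
\<open>D\<^sub>m(\<xi>)\<^sup>2 = |\<xi>|\<^sup>4 + m\<^sup>2\<close>, so the transform of \<open>u\<close> is \<open>(D\<^sub>m(\<xi>) - k)\<^sup>-\<^sup>1\<close> applied to the transform of \<open>f\<close>.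

Two computations give the result. First, \<open>W\<close> is Hermitian, hence the square norm \<open>N\<close> of \<open>v\<close> equals \<open>\<i> \<langle>u, f\<rangle>\<close>, and
since the symbol is Hermitian too, this is \<open>(2 \<pi>)\<^sup>-\<^sup>2 Im k\<close> times the square norm of the transform of \<open>u\<close>
(\<open>hermitian_energy_identity\<close>, \<open>resolvent_dissipation\<close>). Here \<open>N\<close> is not 0, because \<open>v = 0\<close> would imply \<open>f = 0\<close>
and \<open>u = 0\<close>; in particular \<open>Im k > 0\<close>. Second, by Cauchy--Schwarz the transform of \<open>f\<^sub>j\<close> is at every
frequency at most the square root of \<open>A\<^sub>j N\<close>, where \<open>A\<^sub>j\<close> is the square integral of the row \<open>j\<close> of \<open>W\<close>. Up to a factor 2, the
remaining integral over the frequencies has the integrand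
\<open>Im k (|k \<plusminus> m|\<^sup>2 + |\<xi>|\<^sup>4) / ||\<xi>|\<^sup>4 - \<mu>\<^sup>2|\<^sup>2 = Im ((k \<plusminus> m) / (|\<xi>|\<^sup>4 - \<mu>\<^sup>2))\<close>,
and its value is \<open>\<pi>\<^sup>2 / 2 Re ((k \<plusminus> m) / \<mu>)\<close> (\<open>resolvent_plane_integral\<close>). Dividing by \<open>N\<close> leaves
\<open>4 \<le> A\<^sub>1 Re ((k + m) / \<mu>) + A\<^sub>2 Re ((k - m) / \<mu>)\<close> (\<open>Birman_Schwinger_bound\<close>). Since \<open>Re z \<le> |z - 1| + 1\<close> and
\<open>A\<^sub>1 + A\<^sub>2\<close> is the integral of the trace of \<open>W\<^sup>2 = |V|\<close>, the constant \<open>C = 1\<close> works.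

The Fourier transform of \<open>u\<close>, which is only square-integrable, is obtained without a general \<open>L\<^sup>2\<close> theory. The weak
equation is tested with plane waves that are cut off at distance \<open>n\<close>; for every fixed frequency the commutator terms
vanish as \<open>n \<rightarrow> \<infinity>\<close> (\<open>wave_transform\<close>), and the truncated transforms converge to the solution of a linear
system (\<open>eigenfunction_fourier_limit\<close>). The identity between \<open>\<langle>u, f\<rangle>\<close> and the integral over the frequencies is the limit of
Gaussian sums (\<open>cutoff_pairing\<close>); it rests on the continuity of translations in \<open>L\<^sup>2\<close> (\<open>correlation_tendsto\<close>).
\<close>

section \<open>Elementary estimates\<close>

lemma borel_measurable_cnj [measurable (raw)]:
  "f \<in> borel_measurable M \<Longrightarrow> (\<lambda>x. cnj (f x)) \<in> borel_measurable M"
  by (rule measurable_compose[OF _ borel_measurable_continuous_onI]) (auto intro!: continuous_intros)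

lemma cmod_add_sq_le: "(cmod (x + y))\<^sup>2 \<le> 2 * (cmod x)\<^sup>2 + 2 * (cmod y)\<^sup>2"
proof -
  have "(cmod (x + y))\<^sup>2 \<le> (cmod x + cmod y)\<^sup>2"
    by (intro power_mono norm_triangle_ineq) simp
  also have "\<dots> \<le> 2 * (cmod x)\<^sup>2 + 2 * (cmod y)\<^sup>2"
    using sum_squares_bound[of "cmod x" "cmod y"] by (simp add: power2_sum)
  finally show ?thesis .
qed

lemma cmod_diff_sq_le: "(cmod (x - y))\<^sup>2 \<le> 2 * (cmod x)\<^sup>2 + 2 * (cmod y)\<^sup>2"
  using cmod_add_sq_le[of x "- y"] by simp

lemma mult_le_sum_squares:
  fixes a b :: real
  assumes "0 \<le> a" "0 \<le> b"
  shows "a * b \<le> a\<^sup>2 + b\<^sup>2"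
  using sum_squares_bound[of a b] mult_nonneg_nonneg[OF assms] by linarith

lemma integrable_indicator_cball:
  "integrable lborel (\<lambda>x :: 'a::euclidean_space. c * indicat_real (cball 0 r) x)"
  using emeasure_lborel_cball_finite[of "0 :: 'a" r]
  by (intro integrable_mult_right integrable_real_indicator) auto

section \<open>Smooth functions\<close>

text \<open>The functions \<open>exp (- 1 / t) / t ^ n\<close>, extended by 0 to \<open>t \<le> 0\<close>. Their linear span is closed under
differentiation, which is why all powers are kept and not only \<open>n = 0\<close>.\<close>

definition flat :: "nat \<Rightarrow> real \<Rightarrow> real" where
  "flat n t = (if 0 < t then exp (- 1 / t) / t ^ n else 0)"

text \<open>One term of the exponential series at \<open>1 / t\<close> already dominates every power of \<open>1 / t\<close>, so all the
functions \<open>flat n\<close> vanish at 0 together with their derivatives.\<close>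

lemma flat_le: "\<bar>flat n t\<bar> \<le> fact (Suc n) * \<bar>t\<bar>"
proof (cases "0 < t")
  case True
  have "(\<Sum>k\<in>{Suc n}. (1 / t) ^ k /\<^sub>R fact k) \<le> exp (1 / t)"
    unfolding exp_def using True by (intro sum_le_suminf summable_exp_generic) auto
  then have "(1 / t) ^ Suc n / fact (Suc n) \<le> exp (1 / t)"
    by (simp add: divide_inverse mult.commute del: fact_Suc power_Suc)
  then have "1 \<le> exp (1 / t) * (fact (Suc n) * t ^ Suc n)"
    using True by (simp add: divide_le_eq power_one_over mult_ac del: fact_Suc power_Suc)
  then have "exp (- (1 / t)) \<le> fact (Suc n) * t ^ Suc n"
    by (simp add: exp_minus inverse_eq_divide divide_le_eq mult_ac del: fact_Suc power_Suc)
  with True show ?thesis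
    by (simp add: flat_def divide_le_eq mult_ac del: fact_Suc)
qed (simp add: flat_def mult_nonneg_nonpos del: fact_Suc)

lemma flat_derivative:
  "(flat n has_real_derivative (flat (n + 2) t - real n * flat (n + 1) t)) (at t)"
proof -
  consider "t > 0" | "t < 0" | "t = 0" by linarith
  then show ?thesis
  proof cases
    case 1
    have "((\<lambda>t. exp (- 1 / t) / t ^ n) has_real_derivative
        (flat (n + 2) t - real n * flat (n + 1) t)) (at t)"
    proof -
      have "((\<lambda>t. t ^ n) has_real_derivative real n * t ^ n / t) (at t)"
        using DERIV_pow[of n t] 1 by (cases n) auto
      moreover have "((\<lambda>t. exp (- 1 / t)) has_real_derivative exp (- 1 / t) / t\<^sup>2) (at t)"
        using 1 by (auto intro!: derivative_eq_intros simp: power2_eq_square)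
      ultimately have "((\<lambda>t. exp (- 1 / t) / t ^ n) has_real_derivative
        (exp (- 1 / t) / t\<^sup>2 * t ^ n - exp (- 1 / t) * (real n * t ^ n / t)) / (t ^ n * t ^ n)) (at t)"
        using 1 by (intro DERIV_divide) auto
      also have "(exp (- 1 / t) / t\<^sup>2 * t ^ n - exp (- 1 / t) * (real n * t ^ n / t)) / (t ^ n * t ^ n)
        = flat (n + 2) t - real n * flat (n + 1) t"
        using 1 by (simp add: flat_def field_simps power_add power2_eq_square)
      finally show ?thesis .
    qed
    then show ?thesis
      by (rule has_field_derivative_transform_within_open[of _ _ _ "{0<..}"])
        (use 1 in \<open>auto simp: flat_def\<close>)
  next
    case 2
    have "((\<lambda>t. 0) has_real_derivative (flat (n + 2) t - real n * flat (n + 1) t)) (at t)"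
      using 2 by (simp add: flat_def)
    then show ?thesis
      by (rule has_field_derivative_transform_within_open[of _ _ _ "{..<0}"])
        (use 2 in \<open>auto simp: flat_def\<close>)
  next
    case 3
    have *: "(flat (Suc n) \<longlongrightarrow> 0) (at 0)"
    proof (rule Lim_null_comparison)
      show "\<forall>\<^sub>F h in at 0. norm (flat (Suc n) h) \<le> fact (Suc (Suc n)) * \<bar>h\<bar>"
        using flat_le[of "Suc n"] by simp
      show "((\<lambda>h::real. fact (Suc (Suc n)) * \<bar>h\<bar>) \<longlongrightarrow> 0) (at 0)"
        by (auto intro!: tendsto_eq_intros simp del: fact_Suc)
    qed
    have "((\<lambda>h. (flat n (0 + h) - flat n 0) / h) \<longlongrightarrow> 0) (at 0)"
      by (rule Lim_transform_eventually[OF *])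
        (auto simp: flat_def eventually_at_filter)
    then show ?thesis
      using 3 by (simp add: DERIV_def flat_def)
  qed
qed

text \<open>A family of functions that is closed under directional derivatives, and therefore consists of
smooth functions. It contains everything that is needed below: bump functions and plane waves.\<close>

inductive_set smooth_algebra :: "(real ^ 'n::finite \<Rightarrow> real) set" where
  const: "(\<lambda>x. c) \<in> smooth_algebra"
| flat: "(\<lambda>x. flat n (a \<bullet> x + c)) \<in> smooth_algebra"
| cos: "(\<lambda>x. cos (a \<bullet> x + c)) \<in> smooth_algebra"
| add: "f \<in> smooth_algebra \<Longrightarrow> g \<in> smooth_algebra \<Longrightarrow> (\<lambda>x. f x + g x) \<in> smooth_algebra"
| mult: "f \<in> smooth_algebra \<Longrightarrow> g \<in> smooth_algebra \<Longrightarrow> (\<lambda>x. f x * g x) \<in> smooth_algebra"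

lemma partial_eqI:
  "(f has_derivative f') (at x) \<Longrightarrow> partial i f x = f' (axis i 1)"
  unfolding partial_def by (metis frechet_derivative_at)

text \<open>The sine arises here as a cosine with shifted phase, so that it needs no generator of its own.\<close>

lemma smooth_algebra_has_derivative:
  fixes f :: "real ^ 'n::finite \<Rightarrow> real"
  assumes "f \<in> smooth_algebra"
  shows "\<exists>f'. (\<forall>x. (f has_derivative f' x) (at x)) \<and> (\<forall>h. (\<lambda>x. f' x h) \<in> smooth_algebra)"
  using assms
proof induction
  case (const c)
  show ?case
    by (rule exI[of _ "\<lambda>x h. 0"]) (auto intro: smooth_algebra.const)
next
  case (flat n a c)
  have "((\<lambda>x. flat n (a \<bullet> x + c)) has_derivative
      (\<lambda>h. (flat (n + 2) (a \<bullet> x + c) + (- real n) * flat (n + 1) (a \<bullet> x + c)) * (a \<bullet> h))) (at x)"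
    for x :: "real ^ 'n"
  proof -
    have "((\<lambda>x. a \<bullet> x + c) has_derivative (\<lambda>h. a \<bullet> h)) (at x)"
      by (auto intro!: derivative_eq_intros)
    from has_derivative_compose[OF this flat_derivative[unfolded has_field_derivative_def]]
    show ?thesis by simp
  qed
  then show ?case
    by (intro exI[of _ "\<lambda>x h. (flat (n + 2) (a \<bullet> x + c) + (- real n) * flat (n + 1) (a \<bullet> x + c)) * (a \<bullet> h)"]
        conjI allI smooth_algebra.intros)
next
  case (cos a c)
  have "(\<lambda>x. cos (a \<bullet> x + (c + pi / 2)) * (a \<bullet> h)) \<in> smooth_algebra" for h :: "real ^ 'n"
    by (intro smooth_algebra.intros)
  moreover have "cos (a \<bullet> x + (c + pi / 2)) = - sin (a \<bullet> x + c)" for x :: "real ^ 'n"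
    using cos_add[of "a \<bullet> x + c" "pi / 2"] by (simp add: add.assoc)
  ultimately show ?case
    by (intro exI[of _ "\<lambda>x h. - sin (a \<bullet> x + c) * (a \<bullet> h)"])
      (auto intro!: derivative_eq_intros)
next
  case (add f g)
  then obtain f' g' where
    "\<forall>x. (f has_derivative f' x) (at x)" "\<forall>h. (\<lambda>x. f' x h) \<in> smooth_algebra"
    "\<forall>x. (g has_derivative g' x) (at x)" "\<forall>h. (\<lambda>x. g' x h) \<in> smooth_algebra"
    by blast
  then show ?case
    by (intro exI[of _ "\<lambda>x h. f' x h + g' x h"])
      (auto intro!: smooth_algebra.intros has_derivative_add)
next
  case (mult f g)
  then obtain f' g' where
    "\<forall>x. (f has_derivative f' x) (at x)" "\<forall>h. (\<lambda>x. f' x h) \<in> smooth_algebra"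
    "\<forall>x. (g has_derivative g' x) (at x)" "\<forall>h. (\<lambda>x. g' x h) \<in> smooth_algebra"
    by blast
  with mult.hyps show ?case
    by (intro exI[of _ "\<lambda>x h. f x * g' x h + f' x h * g x"])
      (auto intro!: smooth_algebra.intros has_derivative_mult)
qed

lemma smooth_algebra_differentiable: "f \<in> smooth_algebra \<Longrightarrow> f differentiable (at x)"
  using smooth_algebra_has_derivative differentiable_def by blast

lemma partial_smooth_algebra: "f \<in> smooth_algebra \<Longrightarrow> partial i f \<in> smooth_algebra"
proof -
  assume "f \<in> smooth_algebra"
  then obtain f' where f': "\<forall>x. (f has_derivative f' x) (at x)" "\<forall>h. (\<lambda>x. f' x h) \<in> smooth_algebra"
    using smooth_algebra_has_derivative by blast
  then have "partial i f = (\<lambda>x. f' x (axis i 1))"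
    by (auto intro: partial_eqI)
  with f' show ?thesis by simp
qed

lemma smooth_algebra_test_function:
  assumes "f \<in> smooth_algebra" "\<And>x. f x \<noteq> 0 \<Longrightarrow> norm x \<le> R"
  shows "f \<in> test_functions"
proof -
  have "partials \<alpha> f \<in> smooth_algebra" for \<alpha>
    unfolding partials_def by (induction \<alpha>) (auto intro: assms partial_smooth_algebra)
  moreover have "compact (closure {x. f x \<noteq> 0})"
    using assms(2) by (auto simp: bounded_iff)
  ultimately show ?thesis
    by (auto simp: test_functions_def smooth_algebra_differentiable)
qed

text \<open>A derivative vanishes off the closed support of the function, so differentiation does not enlarge
the support; this makes test functions available for iterated weak derivatives.\<close>

lemma partial_test_function:
  assumes "\<phi> \<in> test_functions"
  shows "partial i \<phi> \<in> test_functions"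
proof -
  have "partials \<alpha> (partial i \<phi>) = partials (\<alpha> @ [i]) \<phi>" for \<alpha>
    by (simp add: partials_def)
  moreover have "{x. partial i \<phi> x \<noteq> 0} \<subseteq> closure {x. \<phi> x \<noteq> 0}"
  proof
    fix x assume x: "x \<in> {x. partial i \<phi> x \<noteq> 0}"
    show "x \<in> closure {x. \<phi> x \<noteq> 0}"
    proof (rule ccontr)
      assume *: "x \<notin> closure {x. \<phi> x \<noteq> 0}"
      have "((\<lambda>y. 0) has_derivative (\<lambda>h. 0)) (at x)"
        by simp
      then have "(\<phi> has_derivative (\<lambda>h. 0)) (at x)"
      proof (rule has_derivative_transform_within_open)
        show "open (- closure {x. \<phi> x \<noteq> 0})" "x \<in> - closure {x. \<phi> x \<noteq> 0}"
          using * by auto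
        show "0 = \<phi> y" if "y \<in> - closure {x. \<phi> x \<noteq> 0}" for y
          using that closure_subset[of "{x. \<phi> x \<noteq> 0}"] by auto
      qed
      from partial_eqI[OF this, of i] have "partial i \<phi> x = 0" .
      with x show False by simp
    qed
  qed
  then have "closure {x. partial i \<phi> x \<noteq> 0} \<subseteq> closure {x. \<phi> x \<noteq> 0}"
    by (simp add: closure_minimal)
  then have "compact (closure {x. partial i \<phi> x \<noteq> 0})"
    using assms compact_Int_closed[of "closure {x. \<phi> x \<noteq> 0}" "closure {x. partial i \<phi> x \<noteq> 0}"]
    by (simp add: test_functions_def Int_absorb1 del: compact_closure)
  ultimately show ?thesis
    using assms by (auto simp: test_functions_def)
qed

section \<open>Second weak derivatives of Sobolev functions\<close>

lemma L2_measurable: "u \<in> L2 \<Longrightarrow> u \<in> borel_measurable lebesgue"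
  by (simp add: L2_def)

lemma L2_integrable_norm_sq: "u \<in> L2 \<Longrightarrow> integrable lebesgue (\<lambda>x. (norm (u x))\<^sup>2)"
  by (simp add: L2_def)

lemma L2_lincomb:
  fixes u v :: "real ^ 'n::finite \<Rightarrow> complex"
  assumes "u \<in> L2" "v \<in> L2"
  shows "(\<lambda>x. a * u x + b * v x) \<in> L2"
proof -
  have [measurable]: "u \<in> borel_measurable lebesgue" "v \<in> borel_measurable lebesgue"
    using assms by (auto simp: L2_measurable)
  have "integrable lebesgue (\<lambda>x. 2 * (cmod a)\<^sup>2 * (cmod (u x))\<^sup>2 + 2 * (cmod b)\<^sup>2 * (cmod (v x))\<^sup>2)"
    using assms by (intro Bochner_Integration.integrable_add integrable_mult_right L2_integrable_norm_sq)
  then have "integrable lebesgue (\<lambda>x. (cmod (a * u x + b * v x))\<^sup>2)"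
  proof (rule Bochner_Integration.integrable_bound)
    have "(cmod (a * u x + b * v x))\<^sup>2 \<le> 2 * (cmod a)\<^sup>2 * (cmod (u x))\<^sup>2 + 2 * (cmod b)\<^sup>2 * (cmod (v x))\<^sup>2" for x
      using cmod_add_sq_le[of "a * u x" "b * v x"] by (simp add: norm_mult power_mult_distrib)
    then show "AE x in lebesgue. norm ((cmod (a * u x + b * v x))\<^sup>2)
        \<le> norm (2 * (cmod a)\<^sup>2 * (cmod (u x))\<^sup>2 + 2 * (cmod b)\<^sup>2 * (cmod (v x))\<^sup>2)"
      by (auto simp: abs_of_nonneg)
  qed measurable
  then show ?thesis
    by (simp add: L2_def)
qed

lemma test_function_continuous: "\<phi> \<in> test_functions \<Longrightarrow> continuous_on UNIV \<phi>"
proof -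
  assume "\<phi> \<in> test_functions"
  then have "partials [] \<phi> differentiable (at x)" for x
    unfolding test_functions_def by blast
  then show ?thesis
    by (auto simp: partials_def intro!: continuous_at_imp_continuous_on differentiable_imp_continuous_within)
qed

lemma test_function_bounded:
  assumes "\<phi> \<in> test_functions"
  obtains M R where "0 \<le> M" "\<And>x. \<bar>\<phi> x\<bar> \<le> M * indicator (cball 0 R) x"
proof -
  let ?S = "closure {x. \<phi> x \<noteq> 0}"
  have S: "compact ?S"
    using assms by (simp add: test_functions_def del: compact_closure)
  then obtain R where R: "\<And>x. x \<in> ?S \<Longrightarrow> norm x \<le> R"
    using compact_imp_bounded[OF S] by (auto simp: bounded_iff)
  have "compact (\<phi> ` ?S)"
    by (rule compact_continuous_image[OF continuous_on_subset[OF test_function_continuous[OF assms]] S]) simp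
  then obtain M where "\<forall>y\<in>\<phi> ` ?S. norm y \<le> M"
    using compact_imp_bounded bounded_iff by blast
  then have M: "\<bar>\<phi> x\<bar> \<le> M" if "x \<in> ?S" for x
    using that by auto
  have "\<bar>\<phi> x\<bar> \<le> max M 0 * indicator (cball 0 R) x" for x
  proof (cases "\<phi> x = 0")
    case False
    then have "x \<in> ?S"
      using closure_subset[of "{x. \<phi> x \<noteq> 0}"] by auto
    then show ?thesis
      using R[of x] M[of x] by (auto simp: indicator_def)
  qed simp
  then show thesis
    by (intro that[of "max M 0" R]) auto
qed

lemma integrable_test_function_scaleR:
  fixes u :: "real ^ 'n::finite \<Rightarrow> 'b::euclidean_space"
  assumes "\<phi> \<in> test_functions" "u \<in> L2"
  shows "integrable lebesgue (\<lambda>x. \<phi> x *\<^sub>R u x)"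
proof -
  obtain M R where M: "0 \<le> M" "\<And>x. \<bar>\<phi> x\<bar> \<le> M * indicator (cball 0 R) x"
    using test_function_bounded[OF assms(1)] by blast
  have [measurable]: "u \<in> borel_measurable lebesgue"
    using assms by (simp add: L2_measurable)
  have [measurable]: "\<phi> \<in> borel_measurable lebesgue"
    using borel_measurable_continuous_onI[OF test_function_continuous[OF assms(1)]]
    by (simp add: measurable_completion)
  have "integrable lebesgue (\<lambda>x. M\<^sup>2 * indicat_real (cball 0 R) x + (norm (u x))\<^sup>2)"
    using assms by (intro Bochner_Integration.integrable_add integrable_mult_right L2_integrable_norm_sq)
      (use emeasure_lborel_cball_finite[of "0 :: real ^ 'n" R] in \<open>auto intro!: integrable_real_indicator\<close>)
  then show ?thesis
  proof (rule Bochner_Integration.integrable_bound)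
    have bound: "norm (\<phi> x *\<^sub>R u x) \<le> M\<^sup>2 * indicat_real (cball 0 R) x + (norm (u x))\<^sup>2" for x
    proof -
      have "norm (\<phi> x *\<^sub>R u x) \<le> (M * indicator (cball 0 R) x) * norm (u x)"
        using M(2)[of x] by (simp add: mult_right_mono)
      also have "\<dots> \<le> (M * indicator (cball 0 R) x)\<^sup>2 + (norm (u x))\<^sup>2"
        using M(1) by (intro mult_le_sum_squares) auto
      finally show ?thesis
        by (cases "norm x \<le> R") (simp_all add: power_mult_distrib)
    qed
    show "AE x in lebesgue. norm (\<phi> x *\<^sub>R u x)
        \<le> norm (M\<^sup>2 * indicat_real (cball 0 R) x + (norm (u x))\<^sup>2)"
      unfolding real_norm_def[of "_ + _"] by (intro AE_I2 order_trans[OF bound abs_ge_self])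
  qed measurable
qed

lemma weak_partial:
  assumes "\<exists>g\<in>L2. has_weak_partials [i] u g"
  shows "weak_partial i u \<in> L2" "has_weak_partials [i] u (weak_partial i u)"
  using assms unfolding weak_partial_def by (metis (mono_tags, lifting) someI)+

lemma has_weak_partial_integral:
  assumes "has_weak_partials [i] u g" "\<phi> \<in> test_functions"
  shows "(\<integral>x. partial i \<phi> x *\<^sub>R u x \<partial>lebesgue) = - (\<integral>x. \<phi> x *\<^sub>R g x \<partial>lebesgue)"
  using assms by (auto simp: has_weak_partials_def partials_def)

lemma integral_test_function_lincomb:
  fixes u v :: "real ^ 'n::finite \<Rightarrow> complex"
  assumes "\<phi> \<in> test_functions" "u \<in> L2" "v \<in> L2"
  shows "(\<integral>x. \<phi> x *\<^sub>R (a * u x + b * v x) \<partial>lebesgue)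
    = a * (\<integral>x. \<phi> x *\<^sub>R u x \<partial>lebesgue) + b * (\<integral>x. \<phi> x *\<^sub>R v x \<partial>lebesgue)"
proof -
  have "(\<integral>x. \<phi> x *\<^sub>R (a * u x + b * v x) \<partial>lebesgue)
      = (\<integral>x. a * (\<phi> x *\<^sub>R u x) + b * (\<phi> x *\<^sub>R v x) \<partial>lebesgue)"
    by (simp add: algebra_simps scaleR_conv_of_real)
  also have "\<dots> = a * (\<integral>x. \<phi> x *\<^sub>R u x \<partial>lebesgue) + b * (\<integral>x. \<phi> x *\<^sub>R v x \<partial>lebesgue)"
    using integrable_test_function_scaleR[OF assms(1,2)] integrable_test_function_scaleR[OF assms(1,3)]
    by (subst Bochner_Integration.integral_add) (auto simp del: mult_scaleR_right)
  finally show ?thesis .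
qed

lemma vec_component_L2:
  fixes g :: "real ^ 'n::finite \<Rightarrow> complex ^ 'd::finite"
  assumes "g \<in> L2"
  shows "(\<lambda>x. g x $ j) \<in> L2"
proof -
  have "(\<lambda>y :: complex ^ 'd. y $ j) \<in> borel_measurable borel"
    by (intro borel_measurable_continuous_onI continuous_intros)
  then have m: "(\<lambda>x. g x $ j) \<in> borel_measurable lebesgue"
    by (rule measurable_compose[OF L2_measurable[OF assms]])
  have "integrable lebesgue (\<lambda>x. (cmod (g x $ j))\<^sup>2)"
    by (rule Bochner_Integration.integrable_bound[OF L2_integrable_norm_sq[OF assms]])
      (use m in \<open>auto intro!: power_mono Finite_Cartesian_Product.norm_nth_le\<close>)
  then show ?thesis by (simp add: L2_def m)
qed

lemma sobolev_component:
  fixes u :: "real ^ 'n::finite \<Rightarrow> complex ^ 'd::finite"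
  assumes "u \<in> sobolev s"
  shows "(\<lambda>x. u x $ j) \<in> sobolev s"
proof -
  have int: "(\<integral>x. \<phi> x *\<^sub>R (g x $ j) \<partial>lebesgue) = (\<integral>x. \<phi> x *\<^sub>R g x \<partial>lebesgue) $ j"
    if "\<phi> \<in> test_functions" "g \<in> L2" for \<phi> and g :: "real ^ 'n \<Rightarrow> complex ^ 'd"
    using integral_bounded_linear[OF bounded_linear_vec_nth integrable_test_function_scaleR[OF that], of j]
    by simp
  have parts: "partials \<alpha> \<phi> \<in> test_functions" if "\<phi> \<in> test_functions" for \<alpha> and \<phi> :: "real ^ 'n \<Rightarrow> real"
    using that unfolding partials_def by (induction \<alpha>) (auto intro: partial_test_function)
  have "\<exists>g\<in>L2. has_weak_partials \<alpha> (\<lambda>x. u x $ j) g" if len: "length \<alpha> \<le> s" for \<alpha> :: "'n list"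
  proof -
    obtain g where g: "g \<in> L2" "has_weak_partials \<alpha> u g"
      using assms len unfolding sobolev_def by blast
    have "has_weak_partials \<alpha> (\<lambda>x. u x $ j) (\<lambda>x. g x $ j)"
      using g assms by (auto simp: has_weak_partials_def int parts sobolev_def)
    with vec_component_L2[OF g(1)] show ?thesis by blast
  qed
  then show ?thesis
    using assms vec_component_L2 by (auto simp: sobolev_def)
qed

text \<open>The two Cauchy--Riemann operators: \<open>s = - \<i>\<close> gives \<open>d_zbar\<close> and \<open>s = \<i>\<close> gives \<open>d_z\<close>.\<close>

definition weak_CR :: "complex \<Rightarrow> (real ^ 2 \<Rightarrow> complex) \<Rightarrow> real ^ 2 \<Rightarrow> complex" where
  "weak_CR s f x = 1 / 2 * (weak_partial 1 f x + s * weak_partial 2 f x)"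

lemma d_zbar_eq_weak_CR: "d_zbar = weak_CR (- \<i>)"
  by (auto simp: fun_eq_iff d_zbar_def weak_CR_def)

lemma d_z_eq_weak_CR: "d_z = weak_CR \<i>"
  by (auto simp: fun_eq_iff d_z_def weak_CR_def)

text \<open>The operator \<open>weak_CR s\<close> is built from chosen representatives of first weak derivatives of a function
that is itself such a combination. Moving one derivative at a time to the test function shows that
these representatives exist, and that the result is the weak form of \<open>(\<partial>\<^sub>1 + s \<partial>\<^sub>2)\<^sup>2\<close>.\<close>

lemma weak_CR_twice:
  fixes v :: "real ^ 2 \<Rightarrow> complex"
  assumes v: "v \<in> sobolev 2"
  shows "weak_CR s (weak_CR s v) \<in> L2"
    and "\<phi> \<in> test_functions \<Longrightarrow>
      4 * (\<integral>x. \<phi> x *\<^sub>R weak_CR s (weak_CR s v) x \<partial>lebesgue)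
      = (\<integral>x. partial 1 (partial 1 \<phi>) x *\<^sub>R v x \<partial>lebesgue)
        + s * (\<integral>x. partial 1 (partial 2 \<phi>) x *\<^sub>R v x \<partial>lebesgue)
        + s * (\<integral>x. partial 2 (partial 1 \<phi>) x *\<^sub>R v x \<partial>lebesgue)
        + s\<^sup>2 * (\<integral>x. partial 2 (partial 2 \<phi>) x *\<^sub>R v x \<partial>lebesgue)"
proof -
  have wp: "weak_partial i v \<in> L2" "has_weak_partials [i] v (weak_partial i v)" for i
    using v by (auto intro!: weak_partial simp: sobolev_def)
  let ?w = "weak_CR s v"
  have w_eq: "?w = (\<lambda>x. 1 / 2 * weak_partial 1 v x + s / 2 * weak_partial 2 v x)"
    by (auto simp: weak_CR_def fun_eq_iff field_simps)
  have "?w \<in> L2"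
    unfolding w_eq by (intro L2_lincomb wp)
  have int_w: "(\<integral>x. partial i \<phi> x *\<^sub>R ?w x \<partial>lebesgue) =
      - (1 / 2 * (\<integral>x. partial 1 (partial i \<phi>) x *\<^sub>R v x \<partial>lebesgue)
        + s / 2 * (\<integral>x. partial 2 (partial i \<phi>) x *\<^sub>R v x \<partial>lebesgue))"
    if \<phi>: "\<phi> \<in> test_functions" for i \<phi>
    unfolding w_eq
    using has_weak_partial_integral[OF wp(2) partial_test_function[OF \<phi>, of i]]
    by (subst integral_test_function_lincomb[OF partial_test_function[OF \<phi>] wp(1) wp(1)]) simp
  have "\<exists>g\<in>L2. has_weak_partials [i] ?w g" for i
  proof -
    obtain k1 where k1: "k1 \<in> L2" "has_weak_partials [1, i] v k1"
      using v unfolding sobolev_def by force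
    obtain k2 where k2: "k2 \<in> L2" "has_weak_partials [2, i] v k2"
      using v unfolding sobolev_def by force
    have "has_weak_partials [i] ?w (\<lambda>x. 1 / 2 * k1 x + s / 2 * k2 x)"
      unfolding has_weak_partials_def
    proof
      fix \<phi> :: "real ^ 2 \<Rightarrow> real" assume \<phi>: "\<phi> \<in> test_functions"
      show "(\<integral>x. partials [i] \<phi> x *\<^sub>R ?w x \<partial>lebesgue) =
        (- 1) ^ length [i] *\<^sub>R (\<integral>x. \<phi> x *\<^sub>R (1 / 2 * k1 x + s / 2 * k2 x) \<partial>lebesgue)"
        using k1(2) k2(2) \<phi> int_w[OF \<phi>, of i] integral_test_function_lincomb[OF \<phi> k1(1) k2(1), of "1/2" "s/2"]
        by (simp add: partials_def has_weak_partials_def)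
    qed
    then show ?thesis
      by (intro bexI[OF _ L2_lincomb[OF k1(1) k2(1)]])
  qed
  note wp2 = weak_partial[OF this]
  have ww_eq: "weak_CR s ?w = (\<lambda>x. 1 / 2 * weak_partial 1 ?w x + s / 2 * weak_partial 2 ?w x)"
    by (subst weak_CR_def[abs_def]) (simp add: fun_eq_iff field_simps)
  show "weak_CR s ?w \<in> L2"
    unfolding ww_eq by (intro L2_lincomb wp2)
  assume \<phi>: "\<phi> \<in> test_functions"
  have "(\<integral>x. \<phi> x *\<^sub>R weak_CR s ?w x \<partial>lebesgue) =
      1 / 2 * (- (\<integral>x. partial 1 \<phi> x *\<^sub>R ?w x \<partial>lebesgue))
      + s / 2 * (- (\<integral>x. partial 2 \<phi> x *\<^sub>R ?w x \<partial>lebesgue))"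
    unfolding ww_eq using has_weak_partial_integral[OF wp2(2) \<phi>]
    by (subst integral_test_function_lincomb[OF \<phi> wp2(1) wp2(1)]) simp
  then show "4 * (\<integral>x. \<phi> x *\<^sub>R weak_CR s ?w x \<partial>lebesgue)
      = (\<integral>x. partial 1 (partial 1 \<phi>) x *\<^sub>R v x \<partial>lebesgue)
        + s * (\<integral>x. partial 1 (partial 2 \<phi>) x *\<^sub>R v x \<partial>lebesgue)
        + s * (\<integral>x. partial 2 (partial 1 \<phi>) x *\<^sub>R v x \<partial>lebesgue)
        + s\<^sup>2 * (\<integral>x. partial 2 (partial 2 \<phi>) x *\<^sub>R v x \<partial>lebesgue)"
    by (simp add: int_w[OF \<phi>] algebra_simps power2_eq_square)
qed

section \<open>Truncated plane waves as test functions\<close>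

text \<open>The bounded linear map \<open>l\<close> is the real or the imaginary part: test functions are real-valued, whereas
plane waves are complex.\<close>

lemma partial_separable:
  fixes g h :: "real \<Rightarrow> complex"
  assumes g: "\<And>t. (g has_vector_derivative g' t) (at t)"
    and h: "\<And>t. (h has_vector_derivative h' t) (at t)"
    and l: "bounded_linear l"
  shows "partial 1 (\<lambda>x :: real ^ 2. l (g (x $ 1) * h (x $ 2))) = (\<lambda>x. l (g' (x $ 1) * h (x $ 2)))"
    and "partial 2 (\<lambda>x :: real ^ 2. l (g (x $ 1) * h (x $ 2))) = (\<lambda>x. l (g (x $ 1) * h' (x $ 2)))"
proof -
  have g1: "((\<lambda>x :: real ^ 2. g (x $ 1)) has_derivative (\<lambda>d. (d $ 1) *\<^sub>R g' (x $ 1))) (at x)" for x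
    by (rule has_derivative_compose[OF bounded_linear_imp_has_derivative[OF bounded_linear_vec_nth]
          g[unfolded has_vector_derivative_def]])
  have h2: "((\<lambda>x :: real ^ 2. h (x $ 2)) has_derivative (\<lambda>d. (d $ 2) *\<^sub>R h' (x $ 2))) (at x)" for x
    by (rule has_derivative_compose[OF bounded_linear_imp_has_derivative[OF bounded_linear_vec_nth]
          h[unfolded has_vector_derivative_def]])
  have *: "((\<lambda>x :: real ^ 2. l (g (x $ 1) * h (x $ 2))) has_derivative
      (\<lambda>d. l (g (x $ 1) * ((d $ 2) *\<^sub>R h' (x $ 2)) + ((d $ 1) *\<^sub>R g' (x $ 1)) * h (x $ 2)))) (at x)" for x
    by (rule bounded_linear.has_derivative[OF l has_derivative_mult[OF g1 h2]])
  show "partial 1 (\<lambda>x :: real ^ 2. l (g (x $ 1) * h (x $ 2))) = (\<lambda>x. l (g' (x $ 1) * h (x $ 2)))"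
    "partial 2 (\<lambda>x :: real ^ 2. l (g (x $ 1) * h (x $ 2))) = (\<lambda>x. l (g (x $ 1) * h' (x $ 2)))"
    by (auto simp: fun_eq_iff partial_eqI[OF *] axis_def)
qed

lemma complex_test_function_integral:
  fixes v :: "real ^ 'n::finite \<Rightarrow> complex"
  assumes "(\<lambda>x. Re (G x)) \<in> test_functions" "(\<lambda>x. Im (G x)) \<in> test_functions" "v \<in> L2"
  shows "integrable lebesgue (\<lambda>x. G x * v x)"
    and "(\<integral>x. G x * v x \<partial>lebesgue) =
      (\<integral>x. Re (G x) *\<^sub>R v x \<partial>lebesgue) + \<i> * (\<integral>x. Im (G x) *\<^sub>R v x \<partial>lebesgue)"
proof -
  have eq: "(\<lambda>x. G x * v x) = (\<lambda>x. Re (G x) *\<^sub>R v x + \<i> * (Im (G x) *\<^sub>R v x))"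
  proof
    show "G x * v x = Re (G x) *\<^sub>R v x + \<i> * (Im (G x) *\<^sub>R v x)" for x
      by (subst complex_eq[of "G x"]) (simp add: scaleR_conv_of_real algebra_simps)
  qed
  note int = integrable_test_function_scaleR[OF assms(1,3)] integrable_test_function_scaleR[OF assms(2,3)]
  show "integrable lebesgue (\<lambda>x. G x * v x)"
    unfolding eq using int by (intro Bochner_Integration.integrable_add integrable_mult_right)
  show "(\<integral>x. G x * v x \<partial>lebesgue) =
      (\<integral>x. Re (G x) *\<^sub>R v x \<partial>lebesgue) + \<i> * (\<integral>x. Im (G x) *\<^sub>R v x \<partial>lebesgue)"
    unfolding eq using int
    by (subst Bochner_Integration.integral_add) (auto simp del: mult_scaleR_right)
qed

text \<open>The weak equation holds for complex test functions by linearity. For a product of functions of one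
variable the mixed derivatives in both orders are visibly equal, which gives the factor 2.\<close>

lemma weak_CR_twice_separable:
  fixes v :: "real ^ 2 \<Rightarrow> complex"
  assumes v: "v \<in> sobolev 2"
    and g: "\<And>t. (g has_vector_derivative g' t) (at t)" "\<And>t. (g' has_vector_derivative g'' t) (at t)"
    and h: "\<And>t. (h has_vector_derivative h' t) (at t)" "\<And>t. (h' has_vector_derivative h'' t) (at t)"
    and Re: "(\<lambda>x :: real ^ 2. Re (g (x $ 1) * h (x $ 2))) \<in> test_functions"
    and Im: "(\<lambda>x :: real ^ 2. Im (g (x $ 1) * h (x $ 2))) \<in> test_functions"
  shows "(\<integral>x. g (x $ 1) * h (x $ 2) * (4 * weak_CR s (weak_CR s v) x) \<partial>lebesgue) =
    (\<integral>x. (g'' (x $ 1) * h (x $ 2) + 2 * s * g' (x $ 1) * h' (x $ 2) + s\<^sup>2 * g (x $ 1) * h'' (x $ 2)) * v x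
      \<partial>lebesgue)"
proof -
  have vL2: "v \<in> L2"
    using v by (simp add: sobolev_def)
  define G where "G x = g (x $ 1) * h (x $ 2)" for x :: "real ^ 2"
  define G11 where "G11 x = g'' (x $ 1) * h (x $ 2)" for x :: "real ^ 2"
  define G12 where "G12 x = g' (x $ 1) * h' (x $ 2)" for x :: "real ^ 2"
  define G22 where "G22 x = g (x $ 1) * h'' (x $ 2)" for x :: "real ^ 2"
  have D: "partial 1 (partial 1 (\<lambda>x. l (G x))) = (\<lambda>x. l (G11 x))"
    "partial 1 (partial 2 (\<lambda>x. l (G x))) = (\<lambda>x. l (G12 x))"
    "partial 2 (partial 1 (\<lambda>x. l (G x))) = (\<lambda>x. l (G12 x))"
    "partial 2 (partial 2 (\<lambda>x. l (G x))) = (\<lambda>x. l (G22 x))"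
    if l: "bounded_linear l" for l :: "complex \<Rightarrow> real"
    unfolding G_def G11_def G12_def G22_def
    by (simp_all add: partial_separable[OF g(1) h(1) l] partial_separable[OF g(1) h(2) l]
        partial_separable[OF g(2) h(1) l])
  have T: "(\<lambda>x. l (G x)) \<in> test_functions" if "l = Re \<or> l = Im" for l
    using that Re Im by (auto simp: G_def)
  have l: "bounded_linear l" if "l = Re \<or> l = Im" for l
    using that bounded_linear_Re bounded_linear_Im by blast
  have T2: "(\<lambda>x. l (G11 x)) \<in> test_functions" "(\<lambda>x. l (G12 x)) \<in> test_functions"
    "(\<lambda>x. l (G22 x)) \<in> test_functions" if "l = Re \<or> l = Im" for l
    using D[OF l[OF that]] partial_test_function[OF partial_test_function[OF T[OF that]]]
    by metis+
  note I = complex_test_function_integral[OF _ _ vL2]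
  have *: "4 * (\<integral>x. l (G x) *\<^sub>R weak_CR s (weak_CR s v) x \<partial>lebesgue) =
      (\<integral>x. l (G11 x) *\<^sub>R v x \<partial>lebesgue) + s * (\<integral>x. l (G12 x) *\<^sub>R v x \<partial>lebesgue)
      + s * (\<integral>x. l (G12 x) *\<^sub>R v x \<partial>lebesgue) + s\<^sup>2 * (\<integral>x. l (G22 x) *\<^sub>R v x \<partial>lebesgue)"
    if "l = Re \<or> l = Im" for l
    using weak_CR_twice(2)[OF v T[OF that], of s] by (simp only: D[OF l[OF that]])
  have "(\<integral>x. G x * (4 * weak_CR s (weak_CR s v) x) \<partial>lebesgue) =
      4 * (\<integral>x. G x * weak_CR s (weak_CR s v) x \<partial>lebesgue)"
    by (subst integral_mult_right_zero[symmetric]) (simp add: mult_ac)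
  also have "\<dots> = 4 * (\<integral>x. Re (G x) *\<^sub>R weak_CR s (weak_CR s v) x \<partial>lebesgue)
      + \<i> * (4 * (\<integral>x. Im (G x) *\<^sub>R weak_CR s (weak_CR s v) x \<partial>lebesgue))"
    using complex_test_function_integral(2)[OF _ _ weak_CR_twice(1)[OF v], of G s] T
    by (simp add: algebra_simps)
  also have "\<dots> = (\<integral>x. G11 x * v x \<partial>lebesgue) + 2 * s * (\<integral>x. G12 x * v x \<partial>lebesgue)
      + s\<^sup>2 * (\<integral>x. G22 x * v x \<partial>lebesgue)"
    using *[of Re] *[of Im] I(2)[OF T2(1)[of Re] T2(1)[of Im]] I(2)[OF T2(2)[of Re] T2(2)[of Im]]
      I(2)[OF T2(3)[of Re] T2(3)[of Im]]
    by (simp add: algebra_simps)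
  also have "\<dots> = (\<integral>x. G11 x * v x + (2 * s) * (G12 x * v x) + s\<^sup>2 * (G22 x * v x) \<partial>lebesgue)"
    using I(1)[OF T2(1)[of Re] T2(1)[of Im]] I(1)[OF T2(2)[of Re] T2(2)[of Im]]
      I(1)[OF T2(3)[of Re] T2(3)[of Im]]
    by (subst Bochner_Integration.integral_add | (intro Bochner_Integration.integrable_add integrable_mult_right; simp) | simp)+
  finally show ?thesis
    by (simp add: G_def G11_def G12_def G22_def algebra_simps)
qed

text \<open>Normalised by \<open>exp 2\<close> to have \<open>bump 0 = 1\<close>. Being even, it also satisfies \<open>bump' 0 = 0\<close>, which is what
makes the first-order commutator terms disappear in the limit.\<close>

definition bump :: "real \<Rightarrow> real" where
  "bump t = exp 2 * (flat 0 (1 - t) * flat 0 (1 + t))"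

definition bump' :: "real \<Rightarrow> real" where
  "bump' t = exp 2 * (flat 0 (1 - t) * flat 2 (1 + t) - flat 2 (1 - t) * flat 0 (1 + t))"

definition bump'' :: "real \<Rightarrow> real" where
  "bump'' t = exp 2 * (flat 0 (1 - t) * (flat 4 (1 + t) - 2 * flat 3 (1 + t))
    - 2 * (flat 2 (1 - t) * flat 2 (1 + t))
    + (flat 4 (1 - t) - 2 * flat 3 (1 - t)) * flat 0 (1 + t))"

lemma bump_derivative: "(bump has_real_derivative bump' t) (at t)"
  and bump'_derivative: "(bump' has_real_derivative bump'' t) (at t)"
proof -
  have m: "((\<lambda>t. flat n (1 - t)) has_real_derivative - (flat (n + 2) (1 - t) - real n * flat (n + 1) (1 - t))) (at t)" for n
  proof -
    have "((\<lambda>t. 1 - t) has_real_derivative - 1) (at t)"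
      by (auto intro!: derivative_eq_intros)
    from DERIV_chain2[OF flat_derivative this] show ?thesis by simp
  qed
  have p: "((\<lambda>t. flat n (1 + t)) has_real_derivative (flat (n + 2) (1 + t) - real n * flat (n + 1) (1 + t))) (at t)" for n
  proof -
    have "((\<lambda>t. 1 + t) has_real_derivative 1) (at t)"
      by (auto intro!: derivative_eq_intros)
    from DERIV_chain2[OF flat_derivative this] show ?thesis by simp
  qed
  have p0: "((\<lambda>t. flat 0 (1 + t)) has_real_derivative flat 2 (1 + t)) (at t)"
    using p[of 0] by (simp add: numeral_2_eq_2)
  have m0: "((\<lambda>t. flat 0 (1 - t)) has_real_derivative - flat 2 (1 - t)) (at t)"
    using m[of 0] by (simp add: numeral_2_eq_2)
  have p2: "((\<lambda>t. flat 2 (1 + t)) has_real_derivative flat 4 (1 + t) - 2 * flat 3 (1 + t)) (at t)"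
    using p[of 2] by simp
  have m2: "((\<lambda>t. flat 2 (1 - t)) has_real_derivative - (flat 4 (1 - t) - 2 * flat 3 (1 - t))) (at t)"
    using m[of 2] by simp
  show "(bump has_real_derivative bump' t) (at t)"
    unfolding bump_def[abs_def] bump'_def
    by (rule derivative_eq_intros p0 m0 refl)+ (simp add: algebra_simps)
  show "(bump' has_real_derivative bump'' t) (at t)"
    unfolding bump'_def[abs_def] bump''_def
    by (rule derivative_eq_intros p0 m0 p2 m2 refl)+ (simp add: algebra_simps)
qed

lemma continuous_on_flat: "continuous_on UNIV (flat n)"
  using flat_derivative DERIV_isCont by (blast intro: continuous_at_imp_continuous_on)

lemma bump_0: "bump 0 = 1" "bump' 0 = 0"
  by (auto simp: bump_def bump'_def flat_def simp flip: exp_add)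

lemma bump_outside: "1 \<le> \<bar>t\<bar> \<Longrightarrow> bump t = 0" "1 \<le> \<bar>t\<bar> \<Longrightarrow> bump' t = 0" "1 \<le> \<bar>t\<bar> \<Longrightarrow> bump'' t = 0"
  by (auto simp: bump_def bump'_def bump''_def flat_def)

lemma continuous_on_bump:
  "continuous_on UNIV bump" "continuous_on UNIV bump'" "continuous_on UNIV bump''"
proof -
  have [continuous_intros]: "continuous_on UNIV (\<lambda>t. flat n (f t))" if "continuous_on UNIV f"
    for n and f :: "real \<Rightarrow> real"
    using continuous_on_compose2[OF continuous_on_flat that] by auto
  show "continuous_on UNIV bump" "continuous_on UNIV bump'" "continuous_on UNIV bump''"
    unfolding bump_def[abs_def] bump'_def[abs_def] bump''_def[abs_def] by (intro continuous_intros)+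
qed

lemma bump_bounded: "\<exists>M\<ge>0. \<forall>t. \<bar>bump t\<bar> \<le> M \<and> \<bar>bump' t\<bar> \<le> M \<and> \<bar>bump'' t\<bar> \<le> M"
proof -
  have *: "\<exists>M. \<forall>t. \<bar>f t\<bar> \<le> M" if "continuous_on UNIV f" "\<And>t. 1 \<le> \<bar>t\<bar> \<Longrightarrow> f t = 0"
    for f :: "real \<Rightarrow> real"
  proof -
    have "compact (f ` {-1..1})"
      by (intro compact_continuous_image continuous_on_subset[OF that(1)]) auto
    then obtain M where "\<forall>y\<in>f ` {-1..1}. norm y \<le> M"
      using compact_imp_bounded bounded_iff by blast
    then have M: "\<bar>f t\<bar> \<le> M" if "t \<in> {-1..1}" for t
      using that by auto
    have "\<bar>f t\<bar> \<le> max M 0" for t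
    proof (cases "1 \<le> \<bar>t\<bar>")
      case False
      then have "t \<in> {-1..1}" by auto
      then show ?thesis using M[of t] by simp
    qed (use that(2)[of t] in simp)
    then show ?thesis by blast
  qed
  obtain A where A: "\<bar>bump t\<bar> \<le> A" for t using *[OF continuous_on_bump(1) bump_outside(1)] by blast
  obtain B where B: "\<bar>bump' t\<bar> \<le> B" for t using *[OF continuous_on_bump(2) bump_outside(2)] by blast
  obtain C where C: "\<bar>bump'' t\<bar> \<le> C" for t using *[OF continuous_on_bump(3) bump_outside(3)] by blast
  show ?thesis
    using order_trans[OF abs_ge_zero A[of 0]]
    by (intro exI[of _ "max A (max B C)"]) (auto simp: le_max_iff_disj A B C)
qed

definition cutoff :: "nat \<Rightarrow> real ^ 2 \<Rightarrow> real" where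
  "cutoff n x = bump (x $ 1 / real (Suc n)) * bump (x $ 2 / real (Suc n))"

lemma cutoff_smooth: "cutoff n \<in> smooth_algebra"
proof -
  have "(\<lambda>x. bump (x $ i / L)) \<in> smooth_algebra" for i :: 2 and L
  proof -
    have "(\<lambda>x :: real ^ 2. exp 2 * (flat 0 (axis i (- 1 / L) \<bullet> x + 1) * flat 0 (axis i (1 / L) \<bullet> x + 1))) \<in> smooth_algebra"
      by (intro smooth_algebra.intros)
    then show ?thesis
      by (simp add: bump_def inner_axis' add.commute[of _ 1])
  qed
  then show ?thesis
    unfolding cutoff_def[abs_def] by (intro smooth_algebra.mult)
qed

lemma cutoff_support: "cutoff n x \<noteq> 0 \<Longrightarrow> norm x \<le> 2 * real (Suc n)"
proof -
  assume "cutoff n x \<noteq> 0"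
  then have "\<bar>x $ 1 / real (Suc n)\<bar> < 1" "\<bar>x $ 2 / real (Suc n)\<bar> < 1"
    using bump_outside(1) by (auto simp: cutoff_def not_le[symmetric] simp del: of_nat_Suc)
  then have *: "\<bar>x $ 1\<bar> \<le> real (Suc n)" "\<bar>x $ 2\<bar> \<le> real (Suc n)"
    by (simp_all add: abs_divide divide_less_eq del: of_nat_Suc)
  have "norm x \<le> \<bar>x $ 1\<bar> + \<bar>x $ 2\<bar>"
    using norm_le_l1_cart[of x] by (simp add: sum_2)
  also have "\<dots> \<le> real (Suc n) + real (Suc n)"
    by (intro add_mono *)
  finally show ?thesis by simp
qed

lemma cutoff_wave_test_function: "(\<lambda>x. cutoff n x * cos (\<xi> \<bullet> x + c)) \<in> test_functions"
  by (rule smooth_algebra_test_function[where R="2 * real (Suc n)"])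
    (auto intro!: smooth_algebra.mult cutoff_smooth smooth_algebra.cos cutoff_support simp del: of_nat_Suc)

section \<open>Commutators of the operator with the cutoffs\<close>

text \<open>The integral of a dilated indicator grows like the area \<open>N\<^sup>2\<close>. In two dimensions this growth is
exactly compensated by the factor \<open>1 / N\<close> that one derivative of a cutoff produces, after a
Cauchy--Schwarz argument with a square-integrable function.\<close>

lemma integral_indicator_cball_scaled:
  assumes "0 < N"
  shows "integrable lebesgue (\<lambda>x :: real ^ 2. indicat_real (cball 0 2) (x /\<^sub>R N))"
    and "(\<integral>x. indicat_real (cball (0 :: real ^ 2) 2) (x /\<^sub>R N) \<partial>lebesgue)
      = measure lebesgue (cball 0 2 :: (real ^ 2) set) * N\<^sup>2"
proof -
  have eq: "(\<lambda>x :: real ^ 2. indicat_real (cball 0 2) (x /\<^sub>R N)) = indicat_real (cball 0 (2 * N))"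
    using assms by (auto simp: fun_eq_iff indicator_def field_simps)
  show "integrable lebesgue (\<lambda>x :: real ^ 2. indicat_real (cball 0 2) (x /\<^sub>R N))"
    unfolding eq using emeasure_lborel_cball_finite[of "0 :: real ^ 2" "2 * N"]
    by (auto intro!: integrable_real_indicator)
  have "measure lebesgue (cball 0 (2 * N) :: (real ^ 2) set) =
      measure lebesgue (cball 0 2 :: (real ^ 2) set) * N\<^sup>2"
    using assms content_cball[of "2 * N" "0 :: real ^ 2"] content_cball[of 2 "0 :: real ^ 2"]
    by (simp add: power_mult_distrib)
  then show "(\<integral>x. indicat_real (cball (0 :: real ^ 2) 2) (x /\<^sub>R N) \<partial>lebesgue)
      = measure lebesgue (cball 0 2 :: (real ^ 2) set) * N\<^sup>2"
    unfolding eq by simp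
qed

abbreviation scaled_pairing ::
  "(real ^ 2 \<Rightarrow> complex) \<Rightarrow> (real ^ 2 \<Rightarrow> complex) \<Rightarrow> real \<Rightarrow> real" where
  "scaled_pairing \<kappa> v N \<equiv> \<integral>x. cmod (\<kappa> (x /\<^sub>R N)) * cmod (v x) \<partial>lebesgue"

text \<open>The function \<open>\<kappa> (x / N) / N\<close> has bounded \<open>L\<^sup>2\<close> norm, since \<open>\<kappa>\<close> is supported in a disc, so its pairing with
\<open>v \<in> L\<^sup>2\<close> is bounded. If moreover \<open>\<kappa> 0 = 0\<close>, then \<open>\<kappa> (x / N) \<rightarrow> 0\<close> for every fixed \<open>x\<close>, and the pairing tends
to 0: Young's inequality with weight \<open>|\<kappa>|\<close> splits it into a small multiple of the \<open>L\<^sup>1\<close> norm of \<open>\<kappa> (x / N) / N\<^sup>2\<close>,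
which stays bounded, and an integral of \<open>|\<kappa> (x / N)| |v|\<^sup>2\<close>, to which dominated convergence applies.\<close>

lemma scaled_profile_pairing:
  fixes v :: "real ^ 2 \<Rightarrow> complex" and \<kappa> :: "real ^ 2 \<Rightarrow> complex"
  assumes v: "v \<in> L2" and cont: "continuous_on UNIV \<kappa>" and M: "0 \<le> M"
    and \<kappa>: "\<And>y. cmod (\<kappa> y) \<le> M * indicator (cball 0 2) y"
  obtains K where "0 \<le> K"
    and "\<And>N. 1 \<le> N \<Longrightarrow> integrable lebesgue (\<lambda>x. cmod (\<kappa> (x /\<^sub>R N)) * cmod (v x))"
    and "\<And>N. 1 \<le> N \<Longrightarrow> scaled_pairing \<kappa> v N / N \<le> K"
    and "\<kappa> 0 = 0 \<Longrightarrow>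
      (\<lambda>n. scaled_pairing \<kappa> v (real (Suc n)) / real (Suc n)) \<longlonglongrightarrow> 0"
proof -
  define B where "B = measure lebesgue (cball 0 2 :: (real ^ 2) set)"
  define V where "V = (\<integral>x. (cmod (v x))\<^sup>2 \<partial>lebesgue)"
  have B: "0 \<le> B" and V: "0 \<le> V"
    by (auto simp: B_def V_def)
  note ind = integral_indicator_cball_scaled[folded B_def]
  have iV: "integrable lebesgue (\<lambda>x. (cmod (v x))\<^sup>2)"
    by (rule L2_integrable_norm_sq[OF v])
  have [measurable]: "v \<in> borel_measurable lebesgue"
    by (rule L2_measurable[OF v])
  have \<kappa>m [measurable]: "(\<lambda>x. \<kappa> (x /\<^sub>R N)) \<in> borel_measurable lebesgue" for N
  proof -
    have "(\<lambda>x. \<kappa> (x /\<^sub>R N)) \<in> borel_measurable borel"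
      by (intro borel_measurable_continuous_onI continuous_on_compose2[OF cont])
        (auto intro!: continuous_intros)
    then show ?thesis
      by (simp add: measurable_completion)
  qed
  have \<kappa>M: "cmod (\<kappa> y) \<le> M" for y
    using \<kappa>[of y] M by (cases "norm y \<le> 2") auto
  have int: "integrable lebesgue (\<lambda>x. cmod (\<kappa> (x /\<^sub>R N)) * cmod (v x))"
    and int2: "integrable lebesgue (\<lambda>x. cmod (\<kappa> (x /\<^sub>R N)) * (cmod (v x))\<^sup>2)"
    and int1: "integrable lebesgue (\<lambda>x. cmod (\<kappa> (x /\<^sub>R N)))"
    and le1: "(\<integral>x. cmod (\<kappa> (x /\<^sub>R N)) \<partial>lebesgue) \<le> M * B * N\<^sup>2"
    if N: "1 \<le> N" for N
  proof -
    have I: "integrable lebesgue (\<lambda>x. M * indicat_real (cball (0 :: real ^ 2) 2) (x /\<^sub>R N))"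
      using ind(1)[of N] N by simp
    show int1: "integrable lebesgue (\<lambda>x. cmod (\<kappa> (x /\<^sub>R N)))"
      by (rule Bochner_Integration.integrable_bound[OF I])
        (measurable, intro AE_I2, unfold real_norm_def abs_norm_cancel, rule order_trans[OF \<kappa> abs_ge_self])
    have "(\<integral>x. cmod (\<kappa> (x /\<^sub>R N)) \<partial>lebesgue) \<le> (\<integral>x. M * indicat_real (cball (0 :: real ^ 2) 2) (x /\<^sub>R N) \<partial>lebesgue)"
      by (intro integral_mono int1 I \<kappa>)
    also have "\<dots> = M * B * N\<^sup>2"
      using ind(2)[of N] N by simp
    finally show "(\<integral>x. cmod (\<kappa> (x /\<^sub>R N)) \<partial>lebesgue) \<le> M * B * N\<^sup>2" .
    show int2: "integrable lebesgue (\<lambda>x. cmod (\<kappa> (x /\<^sub>R N)) * (cmod (v x))\<^sup>2)"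
      by (rule Bochner_Integration.integrable_bound[OF integrable_mult_right[OF iV, of M]])
        (use \<kappa>M M in \<open>auto intro!: mult_right_mono\<close>)
    show "integrable lebesgue (\<lambda>x. cmod (\<kappa> (x /\<^sub>R N)) * cmod (v x))"
    proof (rule Bochner_Integration.integrable_bound[OF Bochner_Integration.integrable_add[OF int1 int2]])
      have "cmod (v x) \<le> 1 + (cmod (v x))\<^sup>2" for x
        using sum_squares_bound[of 1 "cmod (v x)"] by simp (smt (verit) norm_ge_zero)
      then have "cmod (\<kappa> (x /\<^sub>R N)) * cmod (v x) \<le> cmod (\<kappa> (x /\<^sub>R N)) * (1 + (cmod (v x))\<^sup>2)" for x
        by (intro mult_left_mono) auto
      then show "AE x in lebesgue. norm (cmod (\<kappa> (x /\<^sub>R N)) * cmod (v x))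
          \<le> norm (cmod (\<kappa> (x /\<^sub>R N)) + cmod (\<kappa> (x /\<^sub>R N)) * (cmod (v x))\<^sup>2)"
        by (simp add: algebra_simps)
    qed measurable
  qed
  have young: "scaled_pairing \<kappa> v N / N \<le>
      \<delta> * (M * B) / 2 + (\<integral>x. cmod (\<kappa> (x /\<^sub>R N)) * (cmod (v x))\<^sup>2 \<partial>lebesgue) / (2 * \<delta>)"
    if N: "1 \<le> N" and \<delta>: "0 < \<delta>" for N \<delta>
  proof -
    have pt: "cmod (\<kappa> (x /\<^sub>R N)) * cmod (v x) / N \<le>
        \<delta> / (2 * N\<^sup>2) * cmod (\<kappa> (x /\<^sub>R N)) + 1 / (2 * \<delta>) * (cmod (\<kappa> (x /\<^sub>R N)) * (cmod (v x))\<^sup>2)" for x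
    proof -
      have "0 \<le> (\<delta> / N - cmod (v x))\<^sup>2 / (2 * \<delta>)"
        using \<delta> by simp
      then have "cmod (v x) / N \<le> \<delta> / (2 * N\<^sup>2) + 1 / (2 * \<delta>) * (cmod (v x))\<^sup>2"
        using \<delta> N by (simp add: power2_eq_square field_simps)
      from mult_left_mono[OF this, of "cmod (\<kappa> (x /\<^sub>R N))"] show ?thesis
        by (simp add: algebra_simps)
    qed
    have "scaled_pairing \<kappa> v N / N =
        (\<integral>x. cmod (\<kappa> (x /\<^sub>R N)) * cmod (v x) / N \<partial>lebesgue)"
      by simp
    also have "\<dots> \<le> (\<integral>x. \<delta> / (2 * N\<^sup>2) * cmod (\<kappa> (x /\<^sub>R N))
        + 1 / (2 * \<delta>) * (cmod (\<kappa> (x /\<^sub>R N)) * (cmod (v x))\<^sup>2) \<partial>lebesgue)"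
      by (intro integral_mono pt Bochner_Integration.integrable_add integrable_mult_right
          integrable_divide_zero int int1 int2 N)
    also have "\<dots> = \<delta> / (2 * N\<^sup>2) * (\<integral>x. cmod (\<kappa> (x /\<^sub>R N)) \<partial>lebesgue)
        + 1 / (2 * \<delta>) * (\<integral>x. cmod (\<kappa> (x /\<^sub>R N)) * (cmod (v x))\<^sup>2 \<partial>lebesgue)"
      using int1[OF N] int2[OF N] by (subst Bochner_Integration.integral_add) auto
    also have "\<delta> / (2 * N\<^sup>2) * (\<integral>x. cmod (\<kappa> (x /\<^sub>R N)) \<partial>lebesgue) \<le> \<delta> / (2 * N\<^sup>2) * (M * B * N\<^sup>2)"
      using \<delta> by (intro mult_left_mono le1 N) auto
    finally show ?thesis
      using N by (simp add: field_simps)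
  qed
  have int2_le: "(\<integral>x. cmod (\<kappa> (x /\<^sub>R N)) * (cmod (v x))\<^sup>2 \<partial>lebesgue) \<le> M * V" if N: "1 \<le> N" for N
  proof -
    have "(\<integral>x. cmod (\<kappa> (x /\<^sub>R N)) * (cmod (v x))\<^sup>2 \<partial>lebesgue) \<le> (\<integral>x. M * (cmod (v x))\<^sup>2 \<partial>lebesgue)"
      by (intro integral_mono int2 N integrable_mult_right iV mult_right_mono \<kappa>M) auto
    then show ?thesis by (simp add: V_def)
  qed
  show thesis
  proof (rule that[of "M * B / 2 + M * V / 2"])
    show "0 \<le> M * B / 2 + M * V / 2"
      using M B V by simp
    show "integrable lebesgue (\<lambda>x. cmod (\<kappa> (x /\<^sub>R N)) * cmod (v x))" if "1 \<le> N" for N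
      by (rule int[OF that])
    show "scaled_pairing \<kappa> v N / N \<le> M * B / 2 + M * V / 2" if "1 \<le> N" for N
      using young[OF that, of 1] int2_le[OF that] by simp
  next
    assume \<kappa>0: "\<kappa> 0 = 0"
    let ?I = "\<lambda>n. (\<integral>x. cmod (\<kappa> (x /\<^sub>R real (Suc n))) * (cmod (v x))\<^sup>2 \<partial>lebesgue)"
    have "?I \<longlonglongrightarrow> (\<integral>x. 0 * (cmod (v x))\<^sup>2 \<partial>lebesgue)"
    proof (rule integral_dominated_convergence[where w="\<lambda>x. M * (cmod (v x))\<^sup>2"])
      show "integrable lebesgue (\<lambda>x. M * (cmod (v x))\<^sup>2)"
        by (intro integrable_mult_right iV)
      have "(\<lambda>n. cmod (\<kappa> (x /\<^sub>R real (Suc n)))) \<longlonglongrightarrow> cmod (\<kappa> 0)" for x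
      proof (intro tendsto_norm isCont_tendsto_compose[where g=\<kappa>])
        show "isCont \<kappa> 0"
          using cont by (simp add: continuous_on_eq_continuous_at)
        show "(\<lambda>n. x /\<^sub>R real (Suc n)) \<longlonglongrightarrow> 0"
          using tendsto_scaleR[OF LIMSEQ_inverse_real_of_nat tendsto_const[of x]] by simp
      qed
      then show "AE x in lebesgue. (\<lambda>n. cmod (\<kappa> (x /\<^sub>R real (Suc n))) * (cmod (v x))\<^sup>2) \<longlonglongrightarrow> 0 * (cmod (v x))\<^sup>2"
        unfolding \<kappa>0 norm_zero by (intro AE_I2 tendsto_mult tendsto_const)
      show "AE x in lebesgue. norm (cmod (\<kappa> (x /\<^sub>R real (Suc n))) * (cmod (v x))\<^sup>2) \<le> M * (cmod (v x))\<^sup>2" for n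
        using \<kappa>M by (auto intro!: mult_right_mono)
    qed measurable
    then have I0: "?I \<longlonglongrightarrow> 0"
      by simp
    show "(\<lambda>n. scaled_pairing \<kappa> v (real (Suc n)) / real (Suc n)) \<longlonglongrightarrow> 0"
    proof (rule LIMSEQ_I)
      fix e :: real assume e: "0 < e"
      \<comment> \<open>Adding 1 to the bound avoids a division by 0.\<close>
      define \<delta> where "\<delta> = e / (M * B + 1)"
      have MB: "0 \<le> M * B" using M B by simp
      then have \<delta>: "0 < \<delta>" using e by (simp add: \<delta>_def)
      have "\<delta> * (M * B) \<le> e"
        using MB e by (simp add: \<delta>_def divide_le_eq)
      obtain n0 where n0: "\<And>n. n \<ge> n0 \<Longrightarrow> norm (?I n - 0) < e * \<delta>"
        using LIMSEQ_D[OF I0, of "e * \<delta>"] e \<delta> by auto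
      have "norm (scaled_pairing \<kappa> v (real (Suc n)) / real (Suc n) - 0) < e"
        if "n \<ge> n0" for n
      proof -
        have "?I n / (2 * \<delta>) < e / 2"
          using n0[OF that] \<delta> by (auto simp: field_simps)
        moreover have "0 \<le> scaled_pairing \<kappa> v (real (Suc n)) / real (Suc n)"
          by simp
        ultimately show ?thesis
          using young[of "real (Suc n)" \<delta>] \<delta> \<open>\<delta> * (M * B) \<le> e\<close> by (simp del: of_nat_Suc)
      qed
      then show "\<exists>no. \<forall>n\<ge>no. norm (scaled_pairing \<kappa> v (real (Suc n)) / real (Suc n) - 0) < e"
        by blast
    qed
  qed
qed

lemma cis_linear_derivative:
  "((\<lambda>t. cis (- (a * t))) has_vector_derivative - \<i> * of_real a * cis (- (a * t))) (at t)"
proof -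
  have "((\<lambda>z. exp (\<i> * (- (of_real a * z)))) has_field_derivative - \<i> * of_real a * exp (\<i> * (- (of_real a * of_real t)))) (at (of_real t))"
    by (auto intro!: derivative_eq_intros)
  from has_vector_derivative_real_field[OF this] show ?thesis
    by (simp add: cis_conv_exp)
qed

lemma truncated_wave_derivative:
  fixes f :: "real \<Rightarrow> real"
  assumes f: "\<And>t. (f has_real_derivative f' t) (at t)"
  shows "((\<lambda>t. of_real (f (t / N)) * cis (- (a * t))) has_vector_derivative
    (of_real (f' (t / N) / N) - \<i> * of_real (a * f (t / N))) * cis (- (a * t))) (at t)"
proof -
  have "((\<lambda>t. f (t / N)) has_real_derivative f' (t / N) / N) (at t)"
  proof -
    have "((\<lambda>t. t / N) has_real_derivative 1 / N) (at t)"
      by (rule DERIV_cdivide[OF DERIV_ident])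
    from DERIV_chain2[OF f this] show ?thesis by simp
  qed
  then have "((\<lambda>t. complex_of_real (f (t / N))) has_vector_derivative of_real (f' (t / N) / N)) (at t)"
    by (intro has_vector_derivative_of_real) (simp add: has_real_derivative_iff_has_vector_derivative)
  from has_vector_derivative_mult[OF this cis_linear_derivative[of a t]]
  show ?thesis by (simp add: algebra_simps)
qed

lemma norm_sum_sq_le: "\<bar>(x :: real ^ 2) $ 1\<bar> + \<bar>x $ 2\<bar> \<le> 1 + (norm x)\<^sup>2"
proof -
  have "(norm x)\<^sup>2 = (x $ 1)\<^sup>2 + (x $ 2)\<^sup>2"
    by (simp add: norm_vec_def L2_set_def sum_2 real_sqrt_pow2)
  moreover have "2 * \<bar>x $ 1\<bar> \<le> 1 + (x $ 1)\<^sup>2" "2 * \<bar>x $ 2\<bar> \<le> 1 + (x $ 2)\<^sup>2"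
    using sum_squares_bound[of 1 "\<bar>x $ 1\<bar>"] sum_squares_bound[of 1 "\<bar>x $ 2\<bar>"] by simp_all
  moreover have "0 \<le> (x $ 1)\<^sup>2" "0 \<le> (x $ 2)\<^sup>2" by simp_all
  ultimately show ?thesis by linarith
qed

lemma cutoff_wave_integrable:
  fixes v :: "real ^ 2 \<Rightarrow> complex"
  assumes "v \<in> L2"
  shows "integrable lebesgue (\<lambda>x. of_real (cutoff n x) * cis (- (\<xi> \<bullet> x)) * v x)"
    and "(\<lambda>x. Re (of_real (cutoff n x) * cis (- (\<xi> \<bullet> x)))) \<in> test_functions"
    and "(\<lambda>x. Im (of_real (cutoff n x) * cis (- (\<xi> \<bullet> x)))) \<in> test_functions"
proof -
  show 1: "(\<lambda>x. Re (of_real (cutoff n x) * cis (- (\<xi> \<bullet> x)))) \<in> test_functions"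
    using cutoff_wave_test_function[of n \<xi> 0] by simp
  show 2: "(\<lambda>x. Im (of_real (cutoff n x) * cis (- (\<xi> \<bullet> x)))) \<in> test_functions"
    using cutoff_wave_test_function[of n \<xi> "pi / 2"] by (simp add: cos_add)
  show "integrable lebesgue (\<lambda>x. of_real (cutoff n x) * cis (- (\<xi> \<bullet> x)) * v x)"
    by (rule complex_test_function_integral(1)[OF 1 2 assms])
qed

text \<open>The terms of \<open>(\<partial>\<^sub>1 + s \<partial>\<^sub>2)\<^sup>2\<close> applied to a product of two truncated waves, sorted by powers of the inverse
truncation radius \<open>r\<close>. The letters \<open>b1\<close>, \<open>b1'\<close>, \<open>b1''\<close> stand for the bump function of the first variable and
its derivatives, \<open>c1\<close> for the wave, \<open>x1\<close> for the frequency.\<close>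

lemma wave_expansion:
  fixes b1 b1' b1'' b2 b2' b2'' s r x1 x2 c1 c2 v :: complex
  shows "((b1'' * r * r - \<i> * (x1 * b1' * r)) * c1 - \<i> * x1 * ((b1' * r - \<i> * (x1 * b1)) * c1)) * (b2 * c2)
      + 2 * s * ((b1' * r - \<i> * (x1 * b1)) * c1) * ((b2' * r - \<i> * (x2 * b2)) * c2)
      + s\<^sup>2 * (b1 * c1) * ((b2'' * r * r - \<i> * (x2 * b2' * r)) * c2 - \<i> * x2 * ((b2' * r - \<i> * (x2 * b2)) * c2))
    = (- \<i> * (x1 + s * x2))\<^sup>2 * (b1 * b2 * (c1 * c2))
      + ((b1'' * b2 + 2 * s * (b1' * b2') + s\<^sup>2 * (b1 * b2'')) * r\<^sup>2
        + 2 * (- \<i> * (x1 + s * x2)) * (b1' * b2 + s * (b1 * b2')) * r) * (c1 * c2)"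
  by algebra

text \<open>The weak form of \<open>F = (\<partial>\<^sub>1 + s \<partial>\<^sub>2)\<^sup>2 v\<close>, tested with a plane wave that is cut off at distance about \<open>n\<close>. When
both derivatives fall on the wave, they produce the square of the symbol. The remaining terms carry
at least one derivative of the cutoff, hence a factor \<open>1 / n\<close>, and they vanish for \<open>n \<rightarrow> \<infinity>\<close> at every
fixed frequency because \<open>v\<close> is square-integrable. In this way the pointwise Fourier transform of an \<open>L\<^sup>2\<close>
solution can be computed although \<open>v\<close> itself need not be integrable. The bound on \<open>E\<close> serves as a
dominating function for integrals over the frequency.\<close>

lemma wave_transform:
  fixes v :: "real ^ 2 \<Rightarrow> complex"
  assumes v: "v \<in> sobolev 2" and s: "cmod s = 1"
  obtains E K where
    "\<And>n \<xi>. (\<integral>x. of_real (cutoff n x) * cis (- (\<xi> \<bullet> x)) * (4 * weak_CR s (weak_CR s v) x) \<partial>lebesgue)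
      = (- \<i> * (of_real (\<xi> $ 1) + s * of_real (\<xi> $ 2)))\<^sup>2
          * (\<integral>x. of_real (cutoff n x) * cis (- (\<xi> \<bullet> x)) * v x \<partial>lebesgue) + E n \<xi>"
    "\<And>n \<xi>. cmod (E n \<xi>) \<le> K * (1 + (norm \<xi>)\<^sup>2)"
    "\<And>\<xi>. (\<lambda>n. E n \<xi>) \<longlonglongrightarrow> 0"
proof -
  have vL2: "v \<in> L2"
    using v by (simp add: sobolev_def)
  obtain M where M: "0 \<le> M" "\<And>t. \<bar>bump t\<bar> \<le> M" "\<And>t. \<bar>bump' t\<bar> \<le> M" "\<And>t. \<bar>bump'' t\<bar> \<le> M"
    using bump_bounded by blast
  define A :: "real ^ 2 \<Rightarrow> complex" where
    "A y = of_real (bump'' (y $ 1) * bump (y $ 2)) + 2 * s * of_real (bump' (y $ 1) * bump' (y $ 2))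
      + s\<^sup>2 * of_real (bump (y $ 1) * bump'' (y $ 2))" for y
  define B :: "real ^ 2 \<Rightarrow> complex" where
    "B y = of_real (bump' (y $ 1) * bump (y $ 2)) + s * of_real (bump (y $ 1) * bump' (y $ 2))" for y
  have [continuous_intros]: "continuous_on UNIV (\<lambda>y. bump (y $ i))" "continuous_on UNIV (\<lambda>y. bump' (y $ i))"
    "continuous_on UNIV (\<lambda>y. bump'' (y $ i))" for i :: 2
    by (rule continuous_on_compose2[OF continuous_on_bump(1)] continuous_on_compose2[OF continuous_on_bump(2)]
        continuous_on_compose2[OF continuous_on_bump(3)], auto intro!: continuous_intros)+
  have contA: "continuous_on UNIV A" and contB: "continuous_on UNIV B"
    unfolding A_def[abs_def] B_def[abs_def] by (intro continuous_intros)+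
  have ball: "norm y \<le> 2" if "\<bar>y $ 1\<bar> < 1" "\<bar>y $ 2\<bar> < 1" for y :: "real ^ 2"
  proof -
    have "norm y \<le> \<bar>y $ 1\<bar> + \<bar>y $ 2\<bar>"
      using norm_le_l1_cart[of y] by (simp add: sum_2)
    with that show ?thesis by linarith
  qed
  have prod_le: "\<bar>a * b\<bar> \<le> M * M" if "\<bar>a\<bar> \<le> M" "\<bar>b\<bar> \<le> M" for a b :: real
    unfolding abs_mult by (intro mult_mono that M(1)) auto
  have A_le: "cmod (A y) \<le> (4 * (M * M)) * indicator (cball 0 2) y" for y
  proof (cases "\<bar>y $ 1\<bar> < 1 \<and> \<bar>y $ 2\<bar> < 1")
    case True
    have "cmod (A y) \<le> \<bar>bump'' (y $ 1) * bump (y $ 2)\<bar> + 2 * \<bar>bump' (y $ 1) * bump' (y $ 2)\<bar>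
        + \<bar>bump (y $ 1) * bump'' (y $ 2)\<bar>"
      unfolding A_def
      by (intro norm_triangle_le add_mono) (simp_all add: norm_mult s norm_power del: of_real_mult)
    also have "\<dots> \<le> M * M + 2 * (M * M) + M * M"
      by (intro add_mono mult_left_mono prod_le M) auto
    finally show ?thesis
      using ball[of y] True by simp
  next
    case False
    then have "1 \<le> \<bar>y $ 1\<bar> \<or> 1 \<le> \<bar>y $ 2\<bar>"
      by linarith
    then have "A y = 0"
      by (auto simp: A_def bump_outside)
    then show ?thesis
      using M(1) by simp
  qed
  have B_le: "cmod (B y) \<le> (2 * (M * M)) * indicator (cball 0 2) y" for y
  proof (cases "\<bar>y $ 1\<bar> < 1 \<and> \<bar>y $ 2\<bar> < 1")
    case True
    have "cmod (B y) \<le> \<bar>bump' (y $ 1) * bump (y $ 2)\<bar> + \<bar>bump (y $ 1) * bump' (y $ 2)\<bar>"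
      unfolding B_def
      by (intro norm_triangle_le add_mono) (simp_all add: norm_mult s del: of_real_mult)
    also have "\<dots> \<le> M * M + M * M"
      by (intro add_mono mult_left_mono prod_le M)
    finally show ?thesis
      using ball[of y] True by simp
  next
    case False
    then have "1 \<le> \<bar>y $ 1\<bar> \<or> 1 \<le> \<bar>y $ 2\<bar>"
      by linarith
    then have "B y = 0"
      by (auto simp: B_def bump_outside)
    then show ?thesis
      using M(1) by simp
  qed
  obtain KA where KA: "0 \<le> KA"
    and intA: "\<And>N. 1 \<le> N \<Longrightarrow> integrable lebesgue (\<lambda>x. cmod (A (x /\<^sub>R N)) * cmod (v x))"
    and leA: "\<And>N. 1 \<le> N \<Longrightarrow> scaled_pairing A v N / N \<le> KA"
  proof (rule scaled_profile_pairing[OF vL2 contA _ A_le])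
    show "0 \<le> 4 * (M * M)" using M(1) by simp
  qed (rule that)
  obtain KB where KB: "0 \<le> KB"
    and intB: "\<And>N. 1 \<le> N \<Longrightarrow> integrable lebesgue (\<lambda>x. cmod (B (x /\<^sub>R N)) * cmod (v x))"
    and leB: "\<And>N. 1 \<le> N \<Longrightarrow> scaled_pairing B v N / N \<le> KB"
    and limB: "B 0 = 0 \<Longrightarrow>
      (\<lambda>n. scaled_pairing B v (real (Suc n)) / real (Suc n)) \<longlonglongrightarrow> 0"
  proof (rule scaled_profile_pairing[OF vL2 contB _ B_le])
    show "0 \<le> 2 * (M * M)" using M(1) by simp
  qed (rule that)
  have B0: "B 0 = 0"
    by (simp add: B_def bump_0)
  define q :: "real ^ 2 \<Rightarrow> complex" where "q \<xi> = - \<i> * (of_real (\<xi> $ 1) + s * of_real (\<xi> $ 2))" for \<xi>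
  have q_le: "cmod (q \<xi>) \<le> 1 + (norm \<xi>)\<^sup>2" for \<xi>
  proof -
    have "cmod (q \<xi>) \<le> \<bar>\<xi> $ 1\<bar> + \<bar>\<xi> $ 2\<bar>"
      using norm_triangle_ineq[of "of_real (\<xi> $ 1)" "s * of_real (\<xi> $ 2)"]
      by (simp add: q_def norm_mult s)
    then show ?thesis
      using norm_sum_sq_le[of \<xi>] by linarith
  qed
  define P :: "nat \<Rightarrow> real ^ 2 \<Rightarrow> real ^ 2 \<Rightarrow> complex" where
    "P n \<xi> x = (A (x /\<^sub>R real (Suc n)) / (of_real (real (Suc n)))\<^sup>2
      + 2 * q \<xi> * B (x /\<^sub>R real (Suc n)) / of_real (real (Suc n))) * cis (- (\<xi> \<bullet> x)) * v x" for n \<xi> x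
  define E where "E n \<xi> = (\<integral>x. P n \<xi> x \<partial>lebesgue)" for n \<xi>
  have [measurable]: "v \<in> borel_measurable lebesgue"
    by (rule L2_measurable[OF vL2])
  have P_meas [measurable]: "P n \<xi> \<in> borel_measurable lebesgue" for n \<xi>
  proof -
    have "(\<lambda>x. A (x /\<^sub>R N)) \<in> borel_measurable borel" "(\<lambda>x. B (x /\<^sub>R N)) \<in> borel_measurable borel" for N
      by (intro borel_measurable_continuous_onI continuous_on_compose2[OF contA] continuous_on_compose2[OF contB];
          auto intro!: continuous_intros)+
    then have [measurable]: "(\<lambda>x. A (x /\<^sub>R N)) \<in> borel_measurable lebesgue" "(\<lambda>x. B (x /\<^sub>R N)) \<in> borel_measurable lebesgue" for N
      by (auto intro: measurable_completion)
    have "(\<lambda>x. cis (- (\<xi> \<bullet> x))) \<in> borel_measurable borel"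
      by (intro borel_measurable_continuous_onI continuous_intros)
    then have [measurable]: "(\<lambda>x. cis (- (\<xi> \<bullet> x))) \<in> borel_measurable lebesgue"
      by (auto intro: measurable_completion)
    show ?thesis
      unfolding P_def[abs_def] by measurable
  qed
  have P_le: "cmod (P n \<xi> x) \<le> 1 / (real (Suc n))\<^sup>2 * (cmod (A (x /\<^sub>R real (Suc n))) * cmod (v x))
      + 2 * cmod (q \<xi>) / real (Suc n) * (cmod (B (x /\<^sub>R real (Suc n))) * cmod (v x))" for n \<xi> x
  proof -
    have "cmod (P n \<xi> x) = cmod (A (x /\<^sub>R real (Suc n)) / (of_real (real (Suc n)))\<^sup>2
      + 2 * q \<xi> * B (x /\<^sub>R real (Suc n)) / of_real (real (Suc n))) * cmod (v x)"
      by (simp add: P_def norm_mult)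
    also have "\<dots> \<le> (cmod (A (x /\<^sub>R real (Suc n)) / (of_real (real (Suc n)))\<^sup>2)
      + cmod (2 * q \<xi> * B (x /\<^sub>R real (Suc n)) / of_real (real (Suc n)))) * cmod (v x)"
      by (intro mult_right_mono norm_triangle_ineq norm_ge_zero)
    also have "\<dots> = 1 / (real (Suc n))\<^sup>2 * (cmod (A (x /\<^sub>R real (Suc n))) * cmod (v x))
      + 2 * cmod (q \<xi>) / real (Suc n) * (cmod (B (x /\<^sub>R real (Suc n))) * cmod (v x))"
      by (simp add: norm_mult norm_divide norm_power algebra_simps del: of_nat_Suc)
    finally show ?thesis .
  qed
  have N1: "1 \<le> real (Suc n)" for n
    by simp
  have dom: "integrable lebesgue (\<lambda>x. 1 / (real (Suc n))\<^sup>2 * (cmod (A (x /\<^sub>R real (Suc n))) * cmod (v x))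
      + 2 * cmod (q \<xi>) / real (Suc n) * (cmod (B (x /\<^sub>R real (Suc n))) * cmod (v x)))" for n \<xi>
    by (intro Bochner_Integration.integrable_add integrable_mult_right intA intB N1)
  have P_int: "integrable lebesgue (P n \<xi>)" for n \<xi>
    by (rule Bochner_Integration.integrable_bound[OF dom[of n \<xi>]])
      (measurable, intro AE_I2 order_trans[OF P_le], unfold real_norm_def, rule abs_ge_self)
  have E_le: "cmod (E n \<xi>) \<le> 1 / real (Suc n) * KA
      + 2 * cmod (q \<xi>) * (scaled_pairing B v (real (Suc n)) / real (Suc n))" for n \<xi>
  proof -
    have "cmod (E n \<xi>) \<le> (\<integral>x. cmod (P n \<xi> x) \<partial>lebesgue)"
      unfolding E_def by (rule integral_norm_bound)
    also have "\<dots> \<le> (\<integral>x. 1 / (real (Suc n))\<^sup>2 * (cmod (A (x /\<^sub>R real (Suc n))) * cmod (v x))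
      + 2 * cmod (q \<xi>) / real (Suc n) * (cmod (B (x /\<^sub>R real (Suc n))) * cmod (v x)) \<partial>lebesgue)"
      by (intro integral_mono integrable_norm P_int dom P_le)
    also have "\<dots> = 1 / (real (Suc n))\<^sup>2 * (scaled_pairing A v (real (Suc n)))
      + 2 * cmod (q \<xi>) / real (Suc n) * (scaled_pairing B v (real (Suc n)))"
      using intA[OF N1[of n]] intB[OF N1[of n]]
      by (subst Bochner_Integration.integral_add) auto
    also have "1 / (real (Suc n))\<^sup>2 * (scaled_pairing A v (real (Suc n)))
        = 1 / real (Suc n) * (scaled_pairing A v (real (Suc n)) / real (Suc n))"
      by (simp add: power2_eq_square)
    also have "\<dots> \<le> 1 / real (Suc n) * KA"
      by (intro mult_left_mono leA N1) simp
    finally show ?thesis by simp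
  qed
  show thesis
  proof (rule that[of E "KA + 2 * KB"])
    fix n and \<xi> :: "real ^ 2"
    let ?N = "real (Suc n)"
    let ?c = "\<lambda>i t. cis (- (\<xi> $ i * t))"
    define g where "g i t = of_real (bump (t / ?N)) * ?c i t" for i t
    define g' where "g' i t = (of_real (bump' (t / ?N) / ?N) - \<i> * of_real (\<xi> $ i * bump (t / ?N))) * ?c i t" for i t
    define g'' where "g'' i t = ((of_real (bump'' (t / ?N) / ?N / ?N) - \<i> * of_real (\<xi> $ i * bump' (t / ?N) / ?N)) * ?c i t
      - \<i> * of_real (\<xi> $ i) * g' i t)" for i t
    have g: "(g i has_vector_derivative g' i t) (at t)" for i t
      unfolding g_def[abs_def] g'_def by (rule truncated_wave_derivative[OF bump_derivative])
    have g2: "(g' i has_vector_derivative g'' i t) (at t)" for i t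
    proof -
      have eq: "g' i = (\<lambda>t. of_real (1 / ?N) * (of_real (bump' (t / ?N)) * ?c i t) - \<i> * of_real (\<xi> $ i) * g i t)"
        by (auto simp: g'_def g_def fun_eq_iff algebra_simps)
      have "((\<lambda>t. of_real (1 / ?N) * (of_real (bump' (t / ?N)) * ?c i t) - \<i> * of_real (\<xi> $ i) * g i t)
        has_vector_derivative
          of_real (1 / ?N) * ((of_real (bump'' (t / ?N) / ?N) - \<i> * of_real (\<xi> $ i * bump' (t / ?N))) * ?c i t)
            - \<i> * of_real (\<xi> $ i) * g' i t) (at t)"
        by (intro has_vector_derivative_diff has_vector_derivative_mult_right truncated_wave_derivative
            bump'_derivative g)
      then have "(g' i has_vector_derivative
          of_real (1 / ?N) * ((of_real (bump'' (t / ?N) / ?N) - \<i> * of_real (\<xi> $ i * bump' (t / ?N))) * ?c i t)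
            - \<i> * of_real (\<xi> $ i) * g' i t) (at t)"
        by (simp only: eq[symmetric])
      then show ?thesis
        by (simp add: g''_def algebra_simps del: of_nat_Suc)
    qed
    have wave: "of_real (cutoff n x) * cis (- (\<xi> \<bullet> x)) = g 1 (x $ 1) * g 2 (x $ 2)" for x
    proof -
      have "cis (- (\<xi> \<bullet> x)) = ?c 1 (x $ 1) * ?c 2 (x $ 2)"
        by (simp add: inner_vec_def sum_2 cis_mult)
      then show ?thesis
        by (simp add: cutoff_def g_def del: of_nat_Suc)
    qed
    have "(\<integral>x. of_real (cutoff n x) * cis (- (\<xi> \<bullet> x)) * (4 * weak_CR s (weak_CR s v) x) \<partial>lebesgue) =
      (\<integral>x. (g'' 1 (x $ 1) * g 2 (x $ 2) + 2 * s * g' 1 (x $ 1) * g' 2 (x $ 2) + s\<^sup>2 * g 1 (x $ 1) * g'' 2 (x $ 2)) * v x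
      \<partial>lebesgue)"
      unfolding wave
      by (rule weak_CR_twice_separable[OF v g g2 g g2])
        (use cutoff_wave_integrable(2,3)[OF vL2, of n \<xi>, unfolded wave] in auto)
    also have "(\<lambda>x. (g'' 1 (x $ 1) * g 2 (x $ 2) + 2 * s * g' 1 (x $ 1) * g' 2 (x $ 2) + s\<^sup>2 * g 1 (x $ 1) * g'' 2 (x $ 2)) * v x)
      = (\<lambda>x. (q \<xi>)\<^sup>2 * (of_real (cutoff n x) * cis (- (\<xi> \<bullet> x)) * v x) + P n \<xi> x)"
    proof
      fix x
      have c: "cis (- (\<xi> \<bullet> x)) = ?c 1 (x $ 1) * ?c 2 (x $ 2)"
        by (simp add: inner_vec_def sum_2 cis_mult)
      have comp: "(x /\<^sub>R ?N) $ i = x $ i / ?N" for i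
        by (simp add: divide_inverse_commute del: of_nat_Suc)
      define r :: complex where "r = 1 / of_real ?N"
      have r: "of_real (y / ?N) = of_real y * r" "y' / of_real ?N = y' * r" for y :: real and y' :: complex
        by (simp_all add: r_def del: of_nat_Suc)
      have r2: "y / (of_real ?N)\<^sup>2 = y * r\<^sup>2" for y :: complex
        by (simp add: r_def power_one_over del: of_nat_Suc)
      show "(g'' 1 (x $ 1) * g 2 (x $ 2) + 2 * s * g' 1 (x $ 1) * g' 2 (x $ 2)
          + s\<^sup>2 * g 1 (x $ 1) * g'' 2 (x $ 2)) * v x
        = (q \<xi>)\<^sup>2 * (of_real (cutoff n x) * cis (- (\<xi> \<bullet> x)) * v x) + P n \<xi> x"
        unfolding P_def A_def B_def g''_def g'_def g_def q_def cutoff_def c comp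
        unfolding r r2 of_real_mult
        by (subst wave_expansion) (simp only: distrib_right mult.assoc)
    qed
    also have "(\<integral>x. (q \<xi>)\<^sup>2 * (of_real (cutoff n x) * cis (- (\<xi> \<bullet> x)) * v x) + P n \<xi> x \<partial>lebesgue) =
        (q \<xi>)\<^sup>2 * (\<integral>x. of_real (cutoff n x) * cis (- (\<xi> \<bullet> x)) * v x \<partial>lebesgue) + E n \<xi>"
      unfolding E_def
      by (subst Bochner_Integration.integral_add[OF integrable_mult_right[OF cutoff_wave_integrable(1)[OF vL2]] P_int]) simp
    finally show "(\<integral>x. of_real (cutoff n x) * cis (- (\<xi> \<bullet> x)) * (4 * weak_CR s (weak_CR s v) x) \<partial>lebesgue)
      = (- \<i> * (of_real (\<xi> $ 1) + s * of_real (\<xi> $ 2)))\<^sup>2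
          * (\<integral>x. of_real (cutoff n x) * cis (- (\<xi> \<bullet> x)) * v x \<partial>lebesgue) + E n \<xi>"
      by (simp add: q_def)
  next
    fix n \<xi>
    have "1 / real (Suc n) * KA \<le> KA"
      using mult_right_mono[OF _ KA, of "1 / real (Suc n)" 1] by simp
    moreover have "cmod (q \<xi>) * (scaled_pairing B v (real (Suc n)) / real (Suc n))
        \<le> (1 + (norm \<xi>)\<^sup>2) * KB"
      by (intro mult_mono q_le leB N1) auto
    moreover have "KA \<le> KA * (1 + (norm \<xi>)\<^sup>2)"
      using KA by (simp add: algebra_simps)
    ultimately show "cmod (E n \<xi>) \<le> (KA + 2 * KB) * (1 + (norm \<xi>)\<^sup>2)"
      using E_le[of n \<xi>] by (simp add: algebra_simps)
  next
    fix \<xi>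
    have "(\<lambda>n. 1 / real (Suc n) * KA
      + 2 * cmod (q \<xi>) * (scaled_pairing B v (real (Suc n)) / real (Suc n)))
      \<longlonglongrightarrow> 0 * KA + 2 * cmod (q \<xi>) * 0"
      by (intro tendsto_add tendsto_mult tendsto_const limB[OF B0])
        (use LIMSEQ_inverse_real_of_nat in \<open>simp add: inverse_eq_divide\<close>)
    then have lim: "(\<lambda>n. 1 / real (Suc n) * KA
      + 2 * cmod (q \<xi>) * (scaled_pairing B v (real (Suc n)) / real (Suc n)))
      \<longlonglongrightarrow> 0"
      by simp
    show "(\<lambda>n. E n \<xi>) \<longlonglongrightarrow> 0"
      by (rule Lim_null_comparison[OF _ lim]) (intro always_eventually allI E_le)
  qed
qed

section \<open>Fourier integrals and Gaussians\<close>

abbreviation square_integral :: "('a::euclidean_space \<Rightarrow> complex) \<Rightarrow> real" where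
  "square_integral f \<equiv> \<integral>x. (cmod (f x))\<^sup>2 \<partial>lborel"

abbreviation l2_inner :: "('a::euclidean_space \<Rightarrow> complex) \<Rightarrow> ('a \<Rightarrow> complex) \<Rightarrow> complex" where
  "l2_inner f g \<equiv> \<integral>x. cnj (f x) * g x \<partial>lborel"

abbreviation correlation :: "('a::euclidean_space \<Rightarrow> complex) \<Rightarrow> ('a \<Rightarrow> complex) \<Rightarrow> 'a \<Rightarrow> complex" where
  "correlation f g h \<equiv> \<integral>x. cnj (f (x - h)) * g x \<partial>lborel"

text \<open>Lebesgue measure on a Euclidean space is the image of a product of one-dimensional measures, so an
integral of a product over the coordinates factorises.\<close>

lemma lborel_integral_prod_Basis:
  fixes h :: "'a::euclidean_space \<Rightarrow> real \<Rightarrow> complex"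
  assumes h: "\<And>b. b \<in> Basis \<Longrightarrow> integrable lborel (h b)"
  shows "integrable lborel (\<lambda>x. \<Prod>b\<in>Basis. h b (x \<bullet> b))"
    and "(\<integral>x. (\<Prod>b\<in>Basis. h b (x \<bullet> b)) \<partial>lborel) = (\<Prod>b\<in>Basis. (\<integral>t. h b t \<partial>lborel))"
proof -
  interpret product_sigma_finite "\<lambda>_ :: 'a. lborel :: real measure" ..
  have m: "h b \<in> borel_measurable borel" if "b \<in> Basis" for b
    using borel_measurable_integrable[OF h[OF that]] by simp
  have [measurable]: "(\<lambda>x :: 'a. \<Prod>b\<in>Basis. h b (x \<bullet> b)) \<in> borel_measurable borel"
    by (intro borel_measurable_prod measurable_compose[OF _ m]) auto
  have eq: "(\<Prod>b\<in>Basis. h b ((\<Sum>c\<in>Basis. f c *\<^sub>R c) \<bullet> b)) = (\<Prod>b\<in>Basis. h b (f b))" for f :: "'a \<Rightarrow> real"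
    by (intro prod.cong) auto
  show "integrable lborel (\<lambda>x. \<Prod>b\<in>Basis. h b (x \<bullet> b))"
    by (subst lborel_eq, subst integrable_distr_eq)
      (auto simp: eq intro!: product_integrable_prod h)
  show "(\<integral>x. (\<Prod>b\<in>Basis. h b (x \<bullet> b)) \<partial>lborel) = (\<Prod>b\<in>Basis. (\<integral>t. h b t \<partial>lborel))"
    by (subst lborel_eq, subst integral_distr)
      (auto simp: eq intro!: product_integral_prod h)
qed

text \<open>The characteristic function of the standard normal distribution.\<close>

lemma gaussian_fourier_real:
  "integrable lborel (\<lambda>t. of_real (exp (- t\<^sup>2 / 2)) * cis (a * t))"
  "(\<integral>t. of_real (exp (- t\<^sup>2 / 2)) * cis (a * t) \<partial>lborel) = of_real (sqrt (2 * pi) * exp (- a\<^sup>2 / 2))"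
proof -
  have eq: "(\<lambda>t. of_real (exp (- t\<^sup>2 / 2)) * cis (a * t))
      = (\<lambda>t. of_real (sqrt (2 * pi)) * (std_normal_density t *\<^sub>R cis (a * t)))"
    by (auto simp: fun_eq_iff std_normal_density_def scaleR_conv_of_real)
  have int: "integrable lborel (\<lambda>t. std_normal_density t *\<^sub>R cis (a * t))"
  proof (rule Bochner_Integration.integrable_bound[OF integrable_normal_density[of 1 0]])
    have [measurable]: "(\<lambda>t. cis (a * t)) \<in> borel_measurable borel"
      by (intro borel_measurable_continuous_onI continuous_intros)
    show "(\<lambda>t. std_normal_density t *\<^sub>R cis (a * t)) \<in> borel_measurable lborel"
      by measurable
  qed auto
  have "(\<integral>t. std_normal_density t *\<^sub>R cis (a * t) \<partial>lborel) = char std_normal_distribution a"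
    unfolding char_def
    by (subst integral_density)
      (auto simp: cis_conv_exp normal_density_nonneg intro!: borel_measurable_continuous_onI continuous_intros)
  then have "(\<integral>t. std_normal_density t *\<^sub>R cis (a * t) \<partial>lborel) = of_real (exp (- a\<^sup>2 / 2))"
    by (simp add: char_std_normal_distribution)
  then show "(\<integral>t. of_real (exp (- t\<^sup>2 / 2)) * cis (a * t) \<partial>lborel) = of_real (sqrt (2 * pi) * exp (- a\<^sup>2 / 2))"
    unfolding eq by (subst integral_mult_right_zero) simp
  show "integrable lborel (\<lambda>t. of_real (exp (- t\<^sup>2 / 2)) * cis (a * t))"
    unfolding eq using int by (rule integrable_mult_right)
qed

definition gauss :: "'a::euclidean_space \<Rightarrow> real" where
  "gauss x = exp (- (norm x)\<^sup>2 / 2)"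

lemma gauss_pos: "0 < gauss x" and gauss_le_1: "gauss x \<le> 1"
  by (auto simp: gauss_def)

lemma continuous_on_gauss: "continuous_on UNIV gauss"
  unfolding gauss_def[abs_def] by (intro continuous_intros) auto

lemma borel_measurable_gauss [measurable]: "gauss \<in> borel_measurable borel"
  by (rule borel_measurable_continuous_onI[OF continuous_on_gauss])

lemma gaussian_fourier:
  fixes y :: "'a::euclidean_space"
  shows "integrable lborel (\<lambda>x. of_real (gauss x) * cis (x \<bullet> y))"
    and "(\<integral>x. of_real (gauss x) * cis (x \<bullet> y) \<partial>lborel) = of_real (sqrt (2 * pi) ^ DIM('a) * gauss y)"
proof -
  have cis_sum: "cis (\<Sum>b\<in>A. f b) = (\<Prod>b\<in>A. cis (f b))" if "finite A" for A :: "'a set" and f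
    using that by induction (auto simp: cis_mult[symmetric])
  have norm_sq: "(norm x)\<^sup>2 = (\<Sum>b\<in>Basis. (x \<bullet> b)\<^sup>2)" for x :: 'a
    by (subst power2_norm_eq_inner, subst euclidean_inner) (simp add: power2_eq_square)
  have gauss_prod: "gauss x = (\<Prod>b\<in>Basis. exp (- (x \<bullet> b)\<^sup>2 / 2))" for x :: 'a
    unfolding gauss_def norm_sq
    by (subst exp_sum[symmetric]) (auto simp: sum_negf sum_divide_distrib)
  have eq: "of_real (gauss x) * cis (x \<bullet> y)
      = (\<Prod>b\<in>Basis. of_real (exp (- (x \<bullet> b)\<^sup>2 / 2)) * cis ((y \<bullet> b) * (x \<bullet> b)))" for x
    unfolding gauss_prod euclidean_inner[of x y] by (simp add: cis_sum prod.distrib mult.commute)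
  show "integrable lborel (\<lambda>x. of_real (gauss x) * cis (x \<bullet> y))"
    unfolding eq
    by (rule lborel_integral_prod_Basis(1)[where h="\<lambda>b t. of_real (exp (- t\<^sup>2 / 2)) * cis ((y \<bullet> b) * t)"])
      (rule gaussian_fourier_real)
  have "(\<integral>x. of_real (gauss x) * cis (x \<bullet> y) \<partial>lborel)
      = (\<Prod>b\<in>(Basis :: 'a set). of_real (sqrt (2 * pi) * exp (- (y \<bullet> b)\<^sup>2 / 2)))"
    unfolding eq
    by (subst lborel_integral_prod_Basis(2)[where h="\<lambda>b t. of_real (exp (- t\<^sup>2 / 2)) * cis ((y \<bullet> b) * t)"])
      (rule gaussian_fourier_real(1), simp only: gaussian_fourier_real(2))
  also have "\<dots> = of_real (sqrt (2 * pi) ^ DIM('a) * gauss y)"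
    by (simp only: of_real_prod[symmetric] prod.distrib prod_constant gauss_prod)
  finally show "(\<integral>x. of_real (gauss x) * cis (x \<bullet> y) \<partial>lborel) = of_real (sqrt (2 * pi) ^ DIM('a) * gauss y)" .
qed

lemma gauss_integrable: "integrable lborel (gauss :: 'a::euclidean_space \<Rightarrow> real)"
  using integrable_norm[OF gaussian_fourier(1)[of "0 :: 'a"]]
  by (simp add: norm_mult abs_of_pos[OF gauss_pos])

lemma gauss_integral: "(\<integral>x. gauss (x :: 'a) \<partial>lborel) = sqrt (2 * pi) ^ DIM('a::euclidean_space)"
proof -
  have "of_real (\<integral>x. gauss (x :: 'a) \<partial>lborel) = complex_of_real (sqrt (2 * pi) ^ DIM('a))"
    using gaussian_fourier(2)[of "0 :: 'a"] by (simp add: gauss_def)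
  then show ?thesis by (simp only: of_real_eq_iff)
qed

lemma lborel_affine_integral:
  fixes f :: "'a::euclidean_space \<Rightarrow> 'b::{banach, second_countable_topology}"
  assumes r: "r \<noteq> 0" and f: "integrable lborel f"
  shows "integrable lborel (\<lambda>x. f (c + r *\<^sub>R x))"
    and "(\<integral>x. f x \<partial>lborel) = \<bar>r\<bar> ^ DIM('a) *\<^sub>R (\<integral>x. f (c + r *\<^sub>R x) \<partial>lborel)"
proof -
  have [measurable]: "f \<in> borel_measurable borel"
    using borel_measurable_integrable[OF f] by simp
  have "integrable (density (distr lborel borel (\<lambda>x. c + r *\<^sub>R x)) (\<lambda>_. \<bar>r\<bar> ^ DIM('a))) f"
    using f lborel_affine[OF r, of c] by simp
  then have "integrable lborel (\<lambda>x. \<bar>r\<bar> ^ DIM('a) *\<^sub>R f (c + r *\<^sub>R x))"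
    by (subst (asm) integrable_density) (auto simp: integrable_distr_eq)
  from integrable_scaleR_right[OF this, of "inverse (\<bar>r\<bar> ^ DIM('a))"]
  show "integrable lborel (\<lambda>x. f (c + r *\<^sub>R x))"
    using r by simp
  have "(\<integral>x. f x \<partial>lborel) = (\<integral>x. f x \<partial>density (distr lborel borel (\<lambda>x. c + r *\<^sub>R x)) (\<lambda>_. \<bar>r\<bar> ^ DIM('a)))"
    using lborel_affine[OF r, of c] by simp
  also have "\<dots> = \<bar>r\<bar> ^ DIM('a) *\<^sub>R (\<integral>x. f (c + r *\<^sub>R x) \<partial>lborel)"
    by (subst integral_density) (auto simp: integral_distr)
  finally show "(\<integral>x. f x \<partial>lborel) = \<bar>r\<bar> ^ DIM('a) *\<^sub>R (\<integral>x. f (c + r *\<^sub>R x) \<partial>lborel)" .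
qed

lemma lborel_reflect_integral:
  fixes f :: "'a::euclidean_space \<Rightarrow> 'b::{banach, second_countable_topology}"
  assumes "integrable lborel f"
  shows "integrable lborel (\<lambda>x. f (c - x))" "(\<integral>x. f x \<partial>lborel) = (\<integral>x. f (c - x) \<partial>lborel)"
  using lborel_affine_integral[OF _ assms, of "-1" c] by simp_all

lemma integrable_pair_mult:
  fixes f :: "'a::euclidean_space \<Rightarrow> complex" and g :: "'b::euclidean_space \<Rightarrow> complex"
  assumes f: "integrable lborel f" and g: "integrable lborel g"
    and m [measurable]: "k \<in> borel_measurable (borel \<Otimes>\<^sub>M borel)" and k: "\<And>x y. cmod (k (x, y)) \<le> 1"
  shows "integrable (lborel \<Otimes>\<^sub>M lborel) (\<lambda>(x, y). f x * g y * k (x, y))"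
proof -
  have [measurable]: "f \<in> borel_measurable borel" "g \<in> borel_measurable borel"
    using f g borel_measurable_integrable by fastforce+
  have "integrable (lborel \<Otimes>\<^sub>M lborel) (\<lambda>(x, y). f x * g y)"
  proof (rule lborel_pair.Fubini_integrable)
    show "(\<lambda>(x, y). f x * g y) \<in> borel_measurable (lborel \<Otimes>\<^sub>M lborel)" by measurable
    show "integrable lborel (\<lambda>x. \<integral>y. norm (case (x, y) of (x, y) \<Rightarrow> f x * g y) \<partial>lborel)"
      using integrable_norm[OF f] by (simp add: norm_mult)
    show "AE x in lborel. integrable lborel (\<lambda>y. case (x, y) of (x, y) \<Rightarrow> f x * g y)"
      using g by simp
  qed
  then show ?thesis
    by (rule Bochner_Integration.integrable_bound)
      (measurable, use k in \<open>auto simp: norm_mult intro!: AE_I2 mult_left_le\<close>)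
qed

definition fourier :: "('a::euclidean_space \<Rightarrow> complex) \<Rightarrow> 'a \<Rightarrow> complex" where
  "fourier f \<xi> = (\<integral>x. cis (- (\<xi> \<bullet> x)) * f x \<partial>lborel)"

lemma integrable_fourier_kernel:
  fixes f :: "'a::euclidean_space \<Rightarrow> complex"
  assumes "integrable lborel f"
  shows "integrable lborel (\<lambda>x. cis (\<xi> \<bullet> x) * f x)" "integrable lborel (\<lambda>x. cis (- (\<xi> \<bullet> x)) * f x)"
proof -
  have [measurable]: "f \<in> borel_measurable borel"
    using assms borel_measurable_integrable by fastforce
  have [measurable]: "(\<lambda>x. cis (\<xi> \<bullet> x)) \<in> borel_measurable borel" "(\<lambda>x. cis (- (\<xi> \<bullet> x))) \<in> borel_measurable borel"
    by (intro borel_measurable_continuous_onI continuous_intros)+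
  show "integrable lborel (\<lambda>x. cis (\<xi> \<bullet> x) * f x)" "integrable lborel (\<lambda>x. cis (- (\<xi> \<bullet> x)) * f x)"
    by (rule Bochner_Integration.integrable_bound[OF assms]; simp add: norm_mult)+
qed

lemma cis_inner_measurable [measurable]:
  "(\<lambda>p. cis (- (fst p \<bullet> snd p))) \<in> borel_measurable (borel \<Otimes>\<^sub>M (borel :: 'a::euclidean_space measure))"
  unfolding borel_prod by (intro borel_measurable_continuous_onI continuous_intros)

text \<open>The convolution theorem, with one factor reflected and conjugated.\<close>

lemma correlation_fourier:
  fixes a b :: "'a::euclidean_space \<Rightarrow> complex"
  assumes a: "integrable lborel a" and b: "integrable lborel b"
  defines "c \<equiv> \<lambda>h. correlation a b h"
  shows "integrable lborel c" and "cnj (fourier a \<xi>) * fourier b \<xi> = fourier c \<xi>"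
proof -
  have [measurable]: "a \<in> borel_measurable borel" "b \<in> borel_measurable borel"
    using a b borel_measurable_integrable by fastforce+
  have a': "integrable lborel (\<lambda>y. cnj (a y))"
    using a by simp
  have F: "integrable (lborel \<Otimes>\<^sub>M lborel) (\<lambda>(x, h). cnj (a (x - h)) * b x)"
  proof (rule lborel_pair.Fubini_integrable)
    show "(\<lambda>(x, h). cnj (a (x - h)) * b x) \<in> borel_measurable (lborel \<Otimes>\<^sub>M lborel)" by measurable
    have "(\<integral>h. norm (case (x, h) of (x, h) \<Rightarrow> cnj (a (x - h)) * b x) \<partial>lborel) = (\<integral>y. cmod (a y) \<partial>lborel) * cmod (b x)" for x
      using lborel_reflect_integral(2)[OF integrable_norm[OF a], of x] by (simp add: norm_mult)
    then show "integrable lborel (\<lambda>x. \<integral>h. norm (case (x, h) of (x, h) \<Rightarrow> cnj (a (x - h)) * b x) \<partial>lborel)"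
      using integrable_norm[OF b] by simp
    show "AE x in lborel. integrable lborel (\<lambda>h. case (x, h) of (x, h) \<Rightarrow> cnj (a (x - h)) * b x)"
      using lborel_reflect_integral(1)[OF a'] by simp
  qed
  show "integrable lborel c"
    unfolding c_def using lborel_pair.integrable_snd[OF F] by simp
  have [measurable]: "(\<lambda>h. cis (- (\<xi> \<bullet> h))) \<in> borel_measurable borel"
    by (intro borel_measurable_continuous_onI continuous_intros)
  have G: "integrable (lborel \<Otimes>\<^sub>M lborel) (\<lambda>(x, h). cis (- (\<xi> \<bullet> h)) * (cnj (a (x - h)) * b x))"
    by (rule Bochner_Integration.integrable_bound[OF F]) (auto simp: norm_mult split_beta)
  have "cnj (fourier a \<xi>) = (\<integral>y. cis (\<xi> \<bullet> y) * cnj (a y) \<partial>lborel)"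
  proof -
    have "cnj (cis (- t)) = cis t" for t
      by (simp add: complex_eq_iff)
    then have "(\<integral>y. cis (\<xi> \<bullet> y) * cnj (a y) \<partial>lborel) = (\<integral>y. cnj (cis (- (\<xi> \<bullet> y)) * a y) \<partial>lborel)"
      by simp
    also have "\<dots> = cnj (fourier a \<xi>)"
      unfolding fourier_def by (rule Bochner_Integration.integral_cnj)
    finally show ?thesis by (rule sym)
  qed
  also have "\<dots> = (\<integral>h. cis (\<xi> \<bullet> (x - h)) * cnj (a (x - h)) \<partial>lborel)" for x
    by (rule lborel_reflect_integral(2)[OF integrable_fourier_kernel(1)[OF a']])
  finally have A: "cnj (fourier a \<xi>) = (\<integral>h. cis (\<xi> \<bullet> (x - h)) * cnj (a (x - h)) \<partial>lborel)" for x .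
  have "cnj (fourier a \<xi>) * fourier b \<xi> = (\<integral>x. cnj (fourier a \<xi>) * (cis (- (\<xi> \<bullet> x)) * b x) \<partial>lborel)"
    unfolding fourier_def[of b] by simp
  also have "\<dots> = (\<integral>x. (\<integral>h. cis (- (\<xi> \<bullet> h)) * (cnj (a (x - h)) * b x) \<partial>lborel) \<partial>lborel)"
  proof (intro Bochner_Integration.integral_cong refl)
    fix x
    have "cnj (fourier a \<xi>) * (cis (- (\<xi> \<bullet> x)) * b x) =
        (\<integral>h. cis (\<xi> \<bullet> (x - h)) * cnj (a (x - h)) * (cis (- (\<xi> \<bullet> x)) * b x) \<partial>lborel)"
      unfolding A[of x] by simp
    also have "(\<lambda>h. cis (\<xi> \<bullet> (x - h)) * cnj (a (x - h)) * (cis (- (\<xi> \<bullet> x)) * b x))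
        = (\<lambda>h. (cis (\<xi> \<bullet> (x - h)) * cis (- (\<xi> \<bullet> x))) * (cnj (a (x - h)) * b x))"
      by (simp add: mult_ac)
    also have "\<dots> = (\<lambda>h. cis (- (\<xi> \<bullet> h)) * (cnj (a (x - h)) * b x))"
      by (simp add: cis_mult inner_diff_right)
    finally show "cnj (fourier a \<xi>) * (cis (- (\<xi> \<bullet> x)) * b x) =
        (\<integral>h. cis (- (\<xi> \<bullet> h)) * (cnj (a (x - h)) * b x) \<partial>lborel)" .
  qed
  also have "\<dots> = (\<integral>h. (\<integral>x. cis (- (\<xi> \<bullet> h)) * (cnj (a (x - h)) * b x) \<partial>lborel) \<partial>lborel)"
    using lborel_pair.Fubini_integral[OF G] by simp
  also have "\<dots> = fourier c \<xi>"
    by (simp add: fourier_def c_def)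
  finally show "cnj (fourier a \<xi>) * fourier b \<xi> = fourier c \<xi>" .
qed

lemma gauss_scaled_integrable:
  assumes "r \<noteq> 0"
  shows "integrable lborel (\<lambda>\<xi> :: 'a::euclidean_space. gauss (r *\<^sub>R \<xi>))"
  using lborel_affine_integral(1)[OF assms gauss_integrable, of 0] by simp

lemma gauss_fourier_multiplication:
  fixes c :: "'a::euclidean_space \<Rightarrow> complex"
  assumes r: "0 < r" and c: "integrable lborel c"
  shows "(\<integral>\<xi>. of_real (gauss (r *\<^sub>R \<xi>)) * fourier c \<xi> \<partial>lborel)
    = of_real (sqrt (2 * pi) ^ DIM('a)) * (\<integral>t. of_real (gauss t) * c (r *\<^sub>R t) \<partial>lborel)"
proof -
  have g: "integrable lborel (\<lambda>\<xi> :: 'a. complex_of_real (gauss (r *\<^sub>R \<xi>)))"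
    using gauss_scaled_integrable[of r, where 'a='a] r by (intro integrable_of_real) simp
  have G: "integrable (lborel \<Otimes>\<^sub>M lborel) (\<lambda>(\<xi>, h). of_real (gauss (r *\<^sub>R \<xi>)) * c h * cis (- (\<xi> \<bullet> h)))"
    using integrable_pair_mult[OF g c cis_inner_measurable] by (simp add: split_beta)
  have inner: "(\<integral>\<xi>. of_real (gauss (r *\<^sub>R \<xi>)) * cis (- (\<xi> \<bullet> h)) \<partial>lborel)
      = of_real (sqrt (2 * pi) ^ DIM('a) * gauss (h /\<^sub>R r) / r ^ DIM('a))" for h :: 'a
  proof -
    have cancel: "inverse r * (r * z) = z" for z
      using r by simp
    have "of_real (sqrt (2 * pi) ^ DIM('a) * gauss (h /\<^sub>R r)) = (\<integral>x. of_real (gauss x) * cis (x \<bullet> (- h /\<^sub>R r)) \<partial>lborel)"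
      using gaussian_fourier(2)[of "- h /\<^sub>R r"] by (simp add: gauss_def)
    also have "\<dots> = r ^ DIM('a) *\<^sub>R (\<integral>\<xi>. of_real (gauss (r *\<^sub>R \<xi>)) * cis (- (\<xi> \<bullet> h)) \<partial>lborel)"
      using lborel_affine_integral(2)[OF _ gaussian_fourier(1), of r "- h /\<^sub>R r" 0] r by (simp add: cancel)
    finally show ?thesis
      using r by (simp add: scaleR_conv_of_real field_simps)
  qed
  have "(\<integral>\<xi>. of_real (gauss (r *\<^sub>R \<xi>)) * fourier c \<xi> \<partial>lborel)
      = (\<integral>\<xi>. (\<integral>h. of_real (gauss (r *\<^sub>R \<xi>)) * c h * cis (- (\<xi> \<bullet> h)) \<partial>lborel) \<partial>lborel)"
    by (simp add: fourier_def mult_ac flip: integral_mult_right_zero)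
  also have "\<dots> = (\<integral>h. (\<integral>\<xi>. of_real (gauss (r *\<^sub>R \<xi>)) * c h * cis (- (\<xi> \<bullet> h)) \<partial>lborel) \<partial>lborel)"
    using lborel_pair.Fubini_integral[OF G] by simp
  also have "\<dots> = (\<integral>h. c h * (\<integral>\<xi>. of_real (gauss (r *\<^sub>R \<xi>)) * cis (- (\<xi> \<bullet> h)) \<partial>lborel) \<partial>lborel)"
    by (simp add: mult_ac flip: integral_mult_right_zero)
  also have "\<dots> = of_real (sqrt (2 * pi) ^ DIM('a) / r ^ DIM('a)) * (\<integral>h. of_real (gauss (h /\<^sub>R r)) * c h \<partial>lborel)"
    unfolding inner by (subst integral_mult_right_zero[symmetric]) (simp add: mult_ac)
  also have "(\<integral>h. of_real (gauss (h /\<^sub>R r)) * c h \<partial>lborel) = r ^ DIM('a) *\<^sub>R (\<integral>t. of_real (gauss t) * c (r *\<^sub>R t) \<partial>lborel)"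
  proof -
    have [measurable]: "c \<in> borel_measurable borel"
      using c borel_measurable_integrable by fastforce
    have "integrable lborel (\<lambda>h. of_real (gauss (h /\<^sub>R r)) * c h)"
      by (rule Bochner_Integration.integrable_bound[OF c])
        (measurable, auto simp: norm_mult abs_of_pos[OF gauss_pos]
          intro!: AE_I2 mult_left_le_one_le gauss_le_1 less_imp_le[OF gauss_pos])
    from lborel_affine_integral(2)[OF _ this, of r 0] show ?thesis
      using r by simp
  qed
  finally show ?thesis
    using r by (simp add: scaleR_conv_of_real)
qed

text \<open>A substitute for Plancherel's theorem that only involves absolutely convergent integrals: summing
\<open>cnj (fourier a) * fourier b\<close> with a Gaussian weight averages the correlation of \<open>a\<close> and \<open>b\<close> over a
Gaussian of width \<open>r\<close>, and for \<open>r \<rightarrow> 0\<close> this average tends to the value at 0, the inner product.\<close>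

lemma gauss_fourier_pairing:
  fixes a b :: "'a::euclidean_space \<Rightarrow> complex"
  assumes "0 < r" "integrable lborel a" "integrable lborel b"
  shows "(\<integral>\<xi>. of_real (gauss (r *\<^sub>R \<xi>)) * (cnj (fourier a \<xi>) * fourier b \<xi>) \<partial>lborel)
    = of_real (sqrt (2 * pi) ^ DIM('a))
      * (\<integral>t. of_real (gauss t) * (correlation a b (r *\<^sub>R t)) \<partial>lborel)"
  using gauss_fourier_multiplication[OF assms(1) correlation_fourier(1)[OF assms(2,3)]]
  by (simp add: correlation_fourier(2)[OF assms(2,3)])

section \<open>Continuity of translations in the space of square-integrable functions\<close>

text \<open>Borel (not merely Lebesgue) measurability makes functions of two points, such as
\<open>(x, h) \<mapsto> f (x - h)\<close>, measurable for the product measure.\<close>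

definition square_integrable :: "('a::euclidean_space \<Rightarrow> complex) \<Rightarrow> bool" where
  "square_integrable f \<longleftrightarrow> f \<in> borel_measurable borel \<and> integrable lborel (\<lambda>x. (cmod (f x))\<^sup>2)"

lemma square_integrableD:
  assumes "square_integrable f"
  shows "f \<in> borel_measurable borel" "integrable lborel (\<lambda>x. (cmod (f x))\<^sup>2)"
  using assms by (auto simp: square_integrable_def)

lemma square_integrable_affine:
  assumes "square_integrable f" "r \<noteq> 0"
  shows "square_integrable (\<lambda>x. f (c + r *\<^sub>R x))"
proof -
  have [measurable]: "f \<in> borel_measurable borel" using assms square_integrableD by blast
  show ?thesis
    using lborel_affine_integral(1)[OF assms(2) square_integrableD(2)[OF assms(1)]]
    by (auto simp: square_integrable_def)
qed

lemma young_product: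
  fixes \<delta> :: real
  assumes "0 < \<delta>"
  shows "a * b \<le> \<delta> / 2 * a\<^sup>2 + 1 / (2 * \<delta>) * b\<^sup>2"
proof -
  have "0 \<le> (\<delta> * a - b)\<^sup>2 / (2 * \<delta>)"
    using assms by simp
  then show ?thesis
    using assms by (simp add: power2_eq_square field_simps)
qed

lemma square_integrable_product:
  assumes u: "square_integrable u" and f: "square_integrable f"
  shows "integrable lborel (\<lambda>x. cnj (u x) * f x)"
    and "0 < \<delta> \<Longrightarrow> cmod (l2_inner u f)
      \<le> \<delta> / 2 * (square_integral u) + 1 / (2 * \<delta>) * (square_integral f)"
proof -
  note [measurable] = square_integrableD(1)[OF u] square_integrableD(1)[OF f]
  note int = square_integrableD(2)[OF u] square_integrableD(2)[OF f]
  have bound: "norm (cnj (u x) * f x) \<le> \<delta> / 2 * (cmod (u x))\<^sup>2 + 1 / (2 * \<delta>) * (cmod (f x))\<^sup>2"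
    if "0 < \<delta>" for \<delta> x
    using young_product[OF that, of "cmod (u x)" "cmod (f x)"] by (simp add: norm_mult)
  have dom: "integrable lborel (\<lambda>x. \<delta> / 2 * (cmod (u x))\<^sup>2 + 1 / (2 * \<delta>) * (cmod (f x))\<^sup>2)" for \<delta>
    by (intro Bochner_Integration.integrable_add integrable_mult_right int)
  show I: "integrable lborel (\<lambda>x. cnj (u x) * f x)"
    by (rule Bochner_Integration.integrable_bound[OF dom[of 1]])
      (measurable, intro AE_I2 order_trans[OF bound[of 1]], simp_all)
  show "cmod (l2_inner u f)
      \<le> \<delta> / 2 * (square_integral u) + 1 / (2 * \<delta>) * (square_integral f)" if "0 < \<delta>"
  proof -
    have "cmod (l2_inner u f) \<le> (\<integral>x. norm (cnj (u x) * f x) \<partial>lborel)"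
      by (rule integral_norm_bound)
    also have "\<dots> \<le> (\<integral>x. \<delta> / 2 * (cmod (u x))\<^sup>2 + 1 / (2 * \<delta>) * (cmod (f x))\<^sup>2 \<partial>lborel)"
      by (intro integral_mono integrable_norm I dom bound that)
    also have "\<dots> = \<delta> / 2 * (square_integral u) + 1 / (2 * \<delta>) * (square_integral f)"
      by (subst Bochner_Integration.integral_add[OF integrable_mult_right[OF int(1)] integrable_mult_right[OF int(2)]]) simp
    finally show ?thesis .
  qed
qed

text \<open>A measurable function is almost everywhere a limit of continuous functions \<open>g n\<close>. Limiting their size and
their support makes dominated convergence applicable in \<open>L\<^sup>2\<close>: the truncations \<open>h k\<close> of \<open>f\<close> converge to \<open>f\<close>,
and the same truncations \<open>hh n\<close> of \<open>g n\<close> converge to \<open>h k\<close>.\<close>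

lemma continuous_approximation:
  fixes f :: "'a::euclidean_space \<Rightarrow> complex"
  assumes f: "square_integrable f" and e: "0 < e"
  obtains g M R where "continuous_on UNIV g" "\<And>x. cmod (g x) \<le> M * indicator (cball 0 R) x" "0 \<le> M"
    "(\<integral>x. (cmod (f x - g x))\<^sup>2 \<partial>lborel) < e"
proof -
  note [measurable] = square_integrableD(1)[OF f]
  note int_f = square_integrableD(2)[OF f]
  have "f measurable_on UNIV"
    using square_integrableD(1)[OF f]
    by (intro lebesgue_measurable_imp_measurable_on) (auto intro: measurable_completion)
  then obtain N g where N: "negligible N" and g: "\<And>n. continuous_on UNIV (g n)"
    and lim: "\<And>x. x \<notin> N \<Longrightarrow> (\<lambda>n. g n x) \<longlonglongrightarrow> f x"
    by (auto simp: measurable_on_def)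
  have AE_N: "AE x in lborel. x \<notin> N"
    using N by (subst AE_completion_iff[symmetric]) (auto simp: negligible_iff_null_sets intro: AE_not_in)
  define cut :: "real \<Rightarrow> 'a \<Rightarrow> real" where "cut k x = max 0 (min 1 (k + 1 - norm x))" for k x
  define clamp :: "real \<Rightarrow> complex \<Rightarrow> complex" where "clamp k z = (k / max k (cmod z)) *\<^sub>R z" for k z
  have cut01: "0 \<le> cut k x" "cut k x \<le> 1" for k x
    by (auto simp: cut_def)
  have cut_out: "cut k x = 0" if "k + 1 \<le> norm x" for k x
    using that by (auto simp: cut_def)
  have cont_cut: "continuous_on UNIV (cut k)" for k
    unfolding cut_def[abs_def] by (intro continuous_intros)
  have cont_clamp: "continuous_on UNIV (clamp k)" if "1 \<le> k" for k
    unfolding clamp_def[abs_def] using that by (intro continuous_intros) auto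
  have clamp_le: "cmod (clamp k z) \<le> k" "cmod (clamp k z) \<le> cmod z" if "1 \<le> k" for k z
  proof -
    have "k * cmod z / max k (cmod z) \<le> k * 1"
      using that by (subst divide_le_eq) (auto simp: max_def)
    then show "cmod (clamp k z) \<le> k"
      using that by (simp add: clamp_def)
    have "k / max k (cmod z) \<le> 1"
      using that by (simp add: divide_le_eq)
    then have "k / max k (cmod z) * cmod z \<le> 1 * cmod z"
      by (intro mult_right_mono) auto
    then show "cmod (clamp k z) \<le> cmod z"
      using that by (simp add: clamp_def)
  qed
  define h where "h k x = cut (real (Suc k)) x *\<^sub>R clamp (real (Suc k)) (f x)" for k x
  have h_conv: "(\<lambda>k. h k x) \<longlonglongrightarrow> f x" for x
  proof (rule tendsto_eventually)
    obtain k0 where k0: "max (norm x) (cmod (f x)) \<le> real k0"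
      using real_arch_simple by blast
    have "h k x = f x" if "k \<ge> k0" for k
    proof -
      have "norm x \<le> real k" "cmod (f x) \<le> real k"
        using k0 that by auto
      then show ?thesis
        by (auto simp: h_def cut_def clamp_def max_def)
    qed
    then show "\<forall>\<^sub>F k in sequentially. h k x = f x"
      by (auto simp: eventually_sequentially)
  qed
  have h_eq: "cmod (f x - h k x) \<le> cmod (f x)" for k x
  proof -
    let ?l = "cut (real (Suc k)) x * (real (Suc k) / max (real (Suc k)) (cmod (f x)))"
    have "0 \<le> ?l"
      using cut01[of "real (Suc k)" x] by simp
    moreover have "?l \<le> 1"
      by (intro mult_le_one cut01) (auto simp: divide_le_eq simp del: of_nat_Suc)
    moreover have "f x - h k x = (1 - ?l) *\<^sub>R f x"
      by (simp add: h_def clamp_def algebra_simps)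
    ultimately show ?thesis
      by (simp add: mult_left_le_one_le del: of_nat_Suc)
  qed
  have h_meas [measurable]: "h k \<in> borel_measurable borel" for k
    unfolding h_def[abs_def]
    using borel_measurable_continuous_onI[OF cont_cut] borel_measurable_continuous_onI[OF cont_clamp, of "real (Suc k)"]
    by (auto intro!: borel_measurable_scaleR measurable_compose[OF square_integrableD(1)[OF f]] simp del: of_nat_Suc)
  have "(\<lambda>k. \<integral>x. (cmod (f x - h k x))\<^sup>2 \<partial>lborel) \<longlonglongrightarrow> (\<integral>x. 0 \<partial>(lborel :: 'a measure))"
  proof (rule integral_dominated_convergence[where w="\<lambda>x. (cmod (f x))\<^sup>2"])
    show "AE x in lborel. (\<lambda>k. (cmod (f x - h k x))\<^sup>2) \<longlonglongrightarrow> 0"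
      using h_conv by (auto intro!: AE_I2 tendsto_eq_intros)
    show "AE x in lborel. norm ((cmod (f x - h k x))\<^sup>2) \<le> (cmod (f x))\<^sup>2" for k
      using h_eq by (auto intro!: AE_I2 power_mono)
  qed (use int_f in auto)
  then obtain k where k: "(\<integral>x. (cmod (f x - h k x))\<^sup>2 \<partial>lborel) < e / 4"
    using e by (auto dest!: LIMSEQ_D[where r="e/4"] simp: abs_less_iff)
  let ?k = "real (Suc k)"
  have k1: "1 \<le> ?k" by simp
  define hh where "hh n x = cut ?k x *\<^sub>R clamp ?k (g n x)" for n x
  have hh_cont: "continuous_on UNIV (hh n)" for n
    unfolding hh_def[abs_def]
    by (intro continuous_intros cont_cut continuous_on_compose2[OF cont_clamp[OF k1] g]) auto
  have hh_meas [measurable]: "hh n \<in> borel_measurable borel" for n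
    by (rule borel_measurable_continuous_onI[OF hh_cont])
  have cut_clamp: "cmod (cut ?k x *\<^sub>R clamp ?k z) \<le> ?k * indicator (cball 0 (?k + 1)) x" for x z
  proof (cases "norm x \<le> ?k + 1")
    case True
    have "cut ?k x * cmod (clamp ?k z) \<le> 1 * ?k"
      by (intro mult_mono cut01 clamp_le k1) auto
    with True cut01[of ?k x] show ?thesis by simp
  qed (simp add: cut_out del: of_nat_Suc)
  have diff_le: "(cmod (h k x - hh n x))\<^sup>2 \<le> (2 * ?k)\<^sup>2 * indicat_real (cball 0 (?k + 1)) x" for x n
  proof -
    have "cmod (h k x - hh n x) \<le> cmod (h k x) + cmod (hh n x)"
      by (rule norm_triangle_ineq4)
    also have "\<dots> \<le> ?k * indicator (cball 0 (?k + 1)) x + ?k * indicator (cball 0 (?k + 1)) x"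
      unfolding h_def hh_def by (intro add_mono cut_clamp)
    also have "\<dots> = 2 * ?k * indicator (cball 0 (?k + 1)) x"
      by (simp only: mult_2 distrib_right)
    finally have "(cmod (h k x - hh n x))\<^sup>2 \<le> (2 * ?k * indicator (cball 0 (?k + 1)) x)\<^sup>2"
      by (rule power_mono) simp
    then show ?thesis
      by (cases "norm x \<le> ?k + 1") (simp_all del: of_nat_Suc)
  qed
  have "(\<lambda>n. \<integral>x. (cmod (h k x - hh n x))\<^sup>2 \<partial>lborel) \<longlonglongrightarrow> (\<integral>x. 0 \<partial>(lborel :: 'a measure))"
  proof (rule integral_dominated_convergence[where w="\<lambda>x. (2 * ?k)\<^sup>2 * indicat_real (cball 0 (?k + 1)) x"])
    have "(\<lambda>n. hh n x) \<longlonglongrightarrow> h k x" if "x \<notin> N" for x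
      unfolding hh_def h_def using cont_clamp[OF k1]
      by (intro tendsto_scaleR tendsto_const isCont_tendsto_compose[OF _ lim[OF that]])
        (simp add: continuous_on_eq_continuous_at)
    then show "AE x in lborel. (\<lambda>n. (cmod (h k x - hh n x))\<^sup>2) \<longlonglongrightarrow> 0"
      using AE_N by (auto intro!: tendsto_eq_intros elim!: eventually_mono)
    show "AE x in lborel. norm ((cmod (h k x - hh n x))\<^sup>2) \<le> (2 * ?k)\<^sup>2 * indicat_real (cball 0 (?k + 1)) x" for n
      using diff_le by (intro AE_I2) (simp del: of_nat_Suc)
  qed (use integrable_indicator_cball in auto)
  then obtain n where n: "(\<integral>x. (cmod (h k x - hh n x))\<^sup>2 \<partial>lborel) < e / 4"
    using e by (auto dest!: LIMSEQ_D[where r="e/4"] simp: abs_less_iff)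
  have int1: "integrable lborel (\<lambda>x. (cmod (f x - h k x))\<^sup>2)"
    by (rule Bochner_Integration.integrable_bound[OF int_f]) (use h_eq in \<open>auto intro!: AE_I2 power_mono\<close>)
  have int2: "integrable lborel (\<lambda>x. (cmod (h k x - hh n x))\<^sup>2)"
    by (rule Bochner_Integration.integrable_bound[OF integrable_indicator_cball])
      (measurable, intro AE_I2, unfold real_norm_def abs_power2, rule order_trans[OF diff_le abs_ge_self])
  have pt: "(cmod (f x - hh n x))\<^sup>2 \<le> 2 * (cmod (f x - h k x))\<^sup>2 + 2 * (cmod (h k x - hh n x))\<^sup>2" for x
    using cmod_add_sq_le[of "f x - h k x" "h k x - hh n x"] by simp
  have int12: "integrable lborel (\<lambda>x. 2 * (cmod (f x - h k x))\<^sup>2 + 2 * (cmod (h k x - hh n x))\<^sup>2)"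
    by (intro Bochner_Integration.integrable_add integrable_mult_right int1 int2)
  have "(\<integral>x. (cmod (f x - hh n x))\<^sup>2 \<partial>lborel) \<le> (\<integral>x. 2 * (cmod (f x - h k x))\<^sup>2 + 2 * (cmod (h k x - hh n x))\<^sup>2 \<partial>lborel)"
  proof (rule integral_mono[OF _ int12 pt])
    show "integrable lborel (\<lambda>x. (cmod (f x - hh n x))\<^sup>2)"
      by (rule Bochner_Integration.integrable_bound[OF int12])
        (measurable, intro AE_I2, unfold real_norm_def abs_power2, rule order_trans[OF pt abs_ge_self])
  qed
  also have "\<dots> = 2 * (\<integral>x. (cmod (f x - h k x))\<^sup>2 \<partial>lborel) + 2 * (\<integral>x. (cmod (h k x - hh n x))\<^sup>2 \<partial>lborel)"
    using int1 int2 by (subst Bochner_Integration.integral_add) auto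
  also have "\<dots> < e"
    using k n by simp
  finally have "(\<integral>x. (cmod (f x - hh n x))\<^sup>2 \<partial>lborel) < e" .
  moreover have "cmod (hh n x) \<le> ?k * indicator (cball 0 (?k + 1)) x" for x
    unfolding hh_def by (rule cut_clamp)
  ultimately show thesis
    using hh_cont by (intro that[of "hh n" ?k "?k + 1"]) simp_all
qed

text \<open>By a change of variable the translation can be moved to \<open>f\<close>. For a continuous function of compact
support in place of \<open>f\<close> dominated convergence applies, and the error of that replacement is bounded
independently of the translation.\<close>

lemma correlation_tendsto:
  fixes u f :: "'a::euclidean_space \<Rightarrow> complex"
  assumes u: "square_integrable u" and f: "square_integrable f" and s: "s \<longlonglongrightarrow> 0"
  shows "(\<lambda>n. correlation u f (s n)) \<longlonglongrightarrow> (l2_inner u f)"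
proof -
  have shift_f: "square_integrable (\<lambda>x. f (x + h))" if "square_integrable f" for f :: "'a \<Rightarrow> complex" and h
    using square_integrable_affine[OF that, of 1 h] by (simp add: add.commute)
  have shift: "(correlation u f h) = (\<integral>x. cnj (u x) * f (x + h) \<partial>lborel)" for h
  proof -
    have "square_integrable (\<lambda>x. u (x - h))"
      using square_integrable_affine[OF u, of 1 "- h"] by simp
    from lborel_affine_integral(2)[OF _ square_integrable_product(1)[OF this f], of 1 h]
    show ?thesis by (simp add: add.commute)
  qed
  define U where "U = (square_integral u)"
  have U: "0 \<le> U" by (simp add: U_def)
  note [measurable] = square_integrableD(1)[OF u] square_integrableD(1)[OF f]
  have "(\<lambda>n. \<integral>x. cnj (u x) * f (x + s n) \<partial>lborel) \<longlonglongrightarrow> (l2_inner u f)"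
  proof (rule LIMSEQ_I)
    fix e' :: real assume e': "0 < e'"
    \<comment> \<open>The estimate below consists of three errors of size at most \<open>e / 2\<close>.\<close>
    define e where "e = e' / 2"
    have e: "0 < e" using e' by (simp add: e_def)
    define \<delta> where "\<delta> = e / (2 * (U + 1))"
    have \<delta>: "0 < \<delta>" using e U by (simp add: \<delta>_def)
    have \<delta>U: "\<delta> * U \<le> e / 2" using e U by (simp add: \<delta>_def field_simps)
    obtain g M R where g: "continuous_on UNIV g" and gM: "\<And>x. cmod (g x) \<le> M * indicator (cball 0 R) x"
      and M: "0 \<le> M" and fg: "(\<integral>x. (cmod (f x - g x))\<^sup>2 \<partial>lborel) < e * \<delta> / 2"
      using continuous_approximation[OF f, of "e * \<delta> / 2"] e \<delta> by auto
    have [measurable]: "g \<in> borel_measurable borel"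
      by (rule borel_measurable_continuous_onI[OF g])
    have gM2: "cmod (g x) \<le> M * indicator (cball 0 (R + B)) (x - h)" if "norm h \<le> B" for x h B
    proof (cases "norm x \<le> R")
      case True
      then have "norm (x - h) \<le> R + B"
        using norm_triangle_ineq4[of x h] that by linarith
      then show ?thesis using gM[of x] True by simp
    next
      case False
      then show ?thesis using gM[of x] M by simp
    qed
    have sqg: "square_integrable g"
    proof -
      have g2: "(cmod (g x))\<^sup>2 \<le> M\<^sup>2 * indicat_real (cball 0 R) x" for x
        using power_mono[OF gM[of x], of 2] by (cases "norm x \<le> R") auto
      have "integrable lborel (\<lambda>x. (cmod (g x))\<^sup>2)"
        by (rule Bochner_Integration.integrable_bound[OF integrable_indicator_cball])
          (measurable, intro AE_I2, unfold real_norm_def abs_power2, rule order_trans[OF g2 abs_ge_self])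
      then show ?thesis
        by (simp add: square_integrable_def)
    qed
    have sqfg: "square_integrable (\<lambda>x. f x - g x)"
    proof -
      have "integrable lborel (\<lambda>x. 2 * (cmod (f x))\<^sup>2 + 2 * (cmod (g x))\<^sup>2)"
        by (intro Bochner_Integration.integrable_add integrable_mult_right square_integrableD(2) f sqg)
      then have "integrable lborel (\<lambda>x. (cmod (f x - g x))\<^sup>2)"
        by (rule Bochner_Integration.integrable_bound)
          (measurable, intro AE_I2, unfold real_norm_def abs_power2, rule order_trans[OF cmod_diff_sq_le abs_ge_self])
      then show ?thesis
        by (simp add: square_integrable_def)
    qed
    have err: "cmod ((\<integral>x. cnj (u x) * f (x + h) \<partial>lborel) - (\<integral>x. cnj (u x) * g (x + h) \<partial>lborel)) \<le> e / 2" for h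
    proof -
      have "(\<integral>x. cnj (u x) * f (x + h) \<partial>lborel) - (\<integral>x. cnj (u x) * g (x + h) \<partial>lborel)
          = (\<integral>x. cnj (u x) * (f (x + h) - g (x + h)) \<partial>lborel)"
        using square_integrable_product(1)[OF u shift_f[OF f, of h]] square_integrable_product(1)[OF u shift_f[OF sqg, of h]]
        by (simp add: right_diff_distrib)
      also have "cmod \<dots> \<le> \<delta> / 2 * U + 1 / (2 * \<delta>) * (\<integral>x. (cmod (f (x + h) - g (x + h)))\<^sup>2 \<partial>lborel)"
        unfolding U_def by (rule square_integrable_product(2)[OF u shift_f[OF sqfg] \<delta>])
      also have "(\<integral>x. (cmod (f (x + h) - g (x + h)))\<^sup>2 \<partial>lborel) = (\<integral>x. (cmod (f x - g x))\<^sup>2 \<partial>lborel)"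
        using lborel_affine_integral(2)[OF _ square_integrableD(2)[OF sqfg], of 1 h] by (simp add: add.commute)
      also have "1 / (2 * \<delta>) * \<dots> \<le> 1 / (2 * \<delta>) * (e * \<delta> / 2)"
        using fg \<delta> by (intro mult_left_mono) auto
      finally show ?thesis
        using \<delta>U \<delta> by simp
    qed
    have "(\<lambda>n. \<integral>x. cnj (u x) * g (x + s n) \<partial>lborel) \<longlonglongrightarrow> (l2_inner u g)"
    proof -
      obtain B where B: "\<And>n. norm (s n) \<le> B"
        using convergent_imp_Bseq[OF convergentI[OF s]] by (auto simp: Bseq_def)
      show ?thesis
      proof (rule integral_dominated_convergence[where w="\<lambda>x. M\<^sup>2 * indicat_real (cball (0 :: 'a) (R + B)) x + (cmod (u x))\<^sup>2"])
        show "integrable lborel (\<lambda>x. M\<^sup>2 * indicat_real (cball (0 :: 'a) (R + B)) x + (cmod (u x))\<^sup>2)"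
          by (intro Bochner_Integration.integrable_add integrable_indicator_cball square_integrableD(2) u)
        have "(\<lambda>n. g (x + s n)) \<longlonglongrightarrow> g (x + 0)" for x
          using g by (intro isCont_tendsto_compose[where g=g] tendsto_add tendsto_const s)
            (simp add: continuous_on_eq_continuous_at)
        then show "AE x in lborel. (\<lambda>n. cnj (u x) * g (x + s n)) \<longlonglongrightarrow> cnj (u x) * g x"
          by (intro AE_I2 tendsto_mult tendsto_const) simp
        show "AE x in lborel. norm (cnj (u x) * g (x + s n)) \<le> M\<^sup>2 * indicat_real (cball (0 :: 'a) (R + B)) x + (cmod (u x))\<^sup>2" for n
        proof (rule AE_I2)
          fix x
          have "norm (cnj (u x) * g (x + s n)) \<le> (M * indicator (cball 0 (R + B)) x) * cmod (u x)"
            using mult_right_mono[OF gM2[OF B[of n], of "x + s n"], of "cmod (u x)"]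
            by (simp add: norm_mult mult.commute)
          also have "\<dots> \<le> (M * indicator (cball 0 (R + B)) x)\<^sup>2 + (cmod (u x))\<^sup>2"
            using M by (intro mult_le_sum_squares) auto
          finally show "norm (cnj (u x) * g (x + s n)) \<le> M\<^sup>2 * indicat_real (cball (0 :: 'a) (R + B)) x + (cmod (u x))\<^sup>2"
            by (cases "norm x \<le> R + B") simp_all
        qed
      qed measurable
    qed
    from LIMSEQ_D[OF this, of "e / 2"] obtain n0 where
      n0: "\<And>n. n \<ge> n0 \<Longrightarrow> cmod ((\<integral>x. cnj (u x) * g (x + s n) \<partial>lborel) - (l2_inner u g)) < e / 2"
      using e by auto
    have "cmod ((\<integral>x. cnj (u x) * f (x + s n) \<partial>lborel) - (l2_inner u f)) < e'" if "n \<ge> n0" for n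
    proof -
      let ?F = "\<lambda>h. \<integral>x. cnj (u x) * f (x + h) \<partial>lborel" and ?G = "\<lambda>h. \<integral>x. cnj (u x) * g (x + h) \<partial>lborel"
      have "cmod (a - b) \<le> cmod (a - c) + cmod (c - d) + cmod (b - d)" for a b c d :: complex
        using order_trans[OF norm_triangle_ineq4 add_right_mono[OF norm_triangle_ineq[of "a - c" "c - d"]], of "b - d"]
        by simp
      then have "cmod (?F (s n) - ?F 0) \<le> cmod (?F (s n) - ?G (s n)) + cmod (?G (s n) - ?G 0) + cmod (?F 0 - ?G 0)" .
      also have "\<dots> \<le> e / 2 + e / 2 + e / 2"
      proof -
        have "cmod (?G (s n) - ?G 0) \<le> e / 2"
          using n0[OF that] by (simp only: add_0_right less_imp_le)
        then show ?thesis
          by (rule add_mono[OF add_mono[OF err _] err])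
      qed
      also have "\<dots> < e'"
        using e' by (simp add: e_def)
      finally show ?thesis
        by (simp only: add_0_right)
    qed
    then show "\<exists>no. \<forall>n\<ge>no. norm ((\<integral>x. cnj (u x) * f (x + s n) \<partial>lborel) - (l2_inner u f)) < e'"
      by blast
  qed
  then show ?thesis
    unfolding shift[symmetric] .
qed

section \<open>Gaussian summation of a pairing of Fourier transforms\<close>

abbreviation gauss_pairing :: "nat \<Rightarrow> ('a::euclidean_space \<Rightarrow> complex) \<Rightarrow> ('a \<Rightarrow> complex) \<Rightarrow> complex" where
  "gauss_pairing n U b \<equiv> \<integral>\<xi>. of_real (gauss (\<xi> /\<^sub>R real (Suc n))) * (cnj (U \<xi>) * fourier b \<xi>) \<partial>lborel"

text \<open>The polynomial is absorbed by half of the Gaussian exponent.\<close>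

lemma gauss_polynomial_integrable:
  assumes r: "0 < r"
  shows "integrable lborel (\<lambda>\<xi> :: 'a::euclidean_space. gauss (r *\<^sub>R \<xi>) * (K * (1 + (norm \<xi>)\<^sup>2)\<^sup>2))"
proof -
  have pt: "gauss (r *\<^sub>R \<xi>) * (1 + (norm \<xi>)\<^sup>2)\<^sup>2 \<le> (1 + 8 / r\<^sup>2)\<^sup>2 * gauss ((r / sqrt 2) *\<^sub>R \<xi>)" for \<xi> :: 'a
  proof -
    define y where "y = (norm \<xi>)\<^sup>2"
    have y: "0 \<le> y" by (simp add: y_def)
    \<comment> \<open>The constant 8 makes the square of this bound cost half of the exponent \<open>r\<^sup>2 y / 2\<close>.\<close>
    have "1 + y \<le> (1 + 8 / r\<^sup>2) * (1 + r\<^sup>2 * y / 8)"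
      using r y by (simp add: field_simps)
    also have "\<dots> \<le> (1 + 8 / r\<^sup>2) * exp (r\<^sup>2 * y / 8)"
      by (intro mult_left_mono exp_ge_add_one_self) auto
    finally have "(1 + y)\<^sup>2 \<le> ((1 + 8 / r\<^sup>2) * exp (r\<^sup>2 * y / 8))\<^sup>2"
      using y by (intro power_mono) auto
    also have "\<dots> = (1 + 8 / r\<^sup>2)\<^sup>2 * exp (r\<^sup>2 * y / 4)"
      by (simp add: power_mult_distrib flip: exp_of_nat_mult)
    finally have "exp (- (r\<^sup>2 * y) / 2) * (1 + y)\<^sup>2 \<le> exp (- (r\<^sup>2 * y) / 2) * ((1 + 8 / r\<^sup>2)\<^sup>2 * exp (r\<^sup>2 * y / 4))"
      by (intro mult_left_mono) auto
    also have "\<dots> = (1 + 8 / r\<^sup>2)\<^sup>2 * exp (- (r\<^sup>2 * y) / 4)"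
      by (simp add: exp_minus field_simps flip: exp_add)
    finally show ?thesis
      by (simp add: gauss_def y_def power_mult_distrib power_divide)
  qed
  have "integrable lborel (\<lambda>\<xi> :: 'a. (1 + 8 / r\<^sup>2)\<^sup>2 * gauss ((r / sqrt 2) *\<^sub>R \<xi>))"
    using r by (intro integrable_mult_right gauss_scaled_integrable) simp
  then have "integrable lborel (\<lambda>\<xi> :: 'a. gauss (r *\<^sub>R \<xi>) * (1 + (norm \<xi>)\<^sup>2)\<^sup>2)"
    by (rule Bochner_Integration.integrable_bound)
      (measurable, intro AE_I2, simp add: abs_mult abs_of_pos[OF gauss_pos] pt)
  from integrable_mult_right[OF this, of K] show ?thesis
    by (simp add: mult_ac)
qed

lemma fourier_measurable:
  fixes f :: "'a::euclidean_space \<Rightarrow> complex"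
  assumes "integrable lborel f"
  shows "fourier f \<in> borel_measurable borel"
proof -
  have [measurable]: "f \<in> borel_measurable borel"
    using assms borel_measurable_integrable by fastforce
  have "(\<lambda>p. cis (- (fst p \<bullet> snd p)) * f (snd p)) \<in> borel_measurable (borel \<Otimes>\<^sub>M lborel)"
    by measurable
  then have "(\<lambda>\<xi>. \<integral>x. cis (- (\<xi> \<bullet> x)) * f x \<partial>lborel) \<in> borel_measurable borel"
    by (intro lborel.borel_measurable_lebesgue_integral) (simp add: split_beta)
  then show ?thesis
    by (simp add: fourier_def[abs_def])
qed

lemma fourier_bound:
  assumes "integrable lborel f"
  shows "cmod (fourier f \<xi>) \<le> (\<integral>x. cmod (f x) \<partial>lborel)"
  unfolding fourier_def by (rule order_trans[OF integral_norm_bound]) (simp add: norm_mult)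

lemma square_integrable_reflected:
  assumes "square_integrable u"
  shows "square_integrable (\<lambda>x. u (x - h))"
    and "(\<integral>x. (cmod (u (x - h)))\<^sup>2 \<partial>lborel) = (square_integral u)"
  using square_integrable_affine[OF assms, of 1 "- h"]
    lborel_affine_integral(2)[OF _ square_integrableD(2)[OF assms], of 1 "- h"] by simp_all

text \<open>The function \<open>u\<close> is square-integrable but perhaps not integrable, so its Fourier transform \<open>U\<close> is understood as
the pointwise limit along the truncations \<open>\<eta> n\<close>. The growth condition on the truncated transforms
allows the passage to the limit under a Gaussian weight.\<close>

context
  fixes u b :: "'a::euclidean_space \<Rightarrow> complex" and \<eta> :: "nat \<Rightarrow> 'a \<Rightarrow> real"
    and U :: "'a \<Rightarrow> complex" and M K :: real
  assumes u: "square_integrable u" and b: "square_integrable b" and b1: "integrable lborel b"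
    and \<eta>_meas: "\<And>n. \<eta> n \<in> borel_measurable borel"
    and \<eta>_bound: "\<And>n x. \<bar>\<eta> n x\<bar> \<le> M" and \<eta>_lim: "\<And>x. (\<lambda>n. \<eta> n x) \<longlonglongrightarrow> 1"
    and \<eta>u: "\<And>n. integrable lborel (\<lambda>x. of_real (\<eta> n x) * u x)"
    and U_lim: "\<And>\<xi>. (\<lambda>n. fourier (\<lambda>x. of_real (\<eta> n x) * u x) \<xi>) \<longlonglongrightarrow> U \<xi>"
    and U_bound: "\<And>n \<xi>. cmod (fourier (\<lambda>x. of_real (\<eta> n x) * u x) \<xi>) \<le> K * (1 + (norm \<xi>)\<^sup>2)\<^sup>2"
begin

lemma truncated_correlation_bound:
  "cmod (\<integral>x. cnj (of_real (\<eta> n (x - h)) * u (x - h)) * b x \<partial>lborel)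
    \<le> M\<^sup>2 / 2 * (square_integral u) + 1 / 2 * (square_integral b)"
  and truncated_correlation_tendsto:
  "(\<lambda>n. \<integral>x. cnj (of_real (\<eta> n (x - h)) * u (x - h)) * b x \<partial>lborel)
    \<longlonglongrightarrow> (correlation u b h)"
proof -
  note [measurable] = square_integrableD(1)[OF u] square_integrableD(1)[OF b] \<eta>_meas
  have [measurable]: "(\<lambda>x. cnj (of_real (\<eta> n (x - h)) * u (x - h)) * b x) \<in> borel_measurable borel" for n
    unfolding complex_cnj_mult complex_cnj_complex_of_real by measurable
  let ?u = "\<lambda>x. u (x - h)"
  have M: "0 \<le> M"
    using order_trans[OF abs_ge_zero \<eta>_bound[of 0 0]] .
  have I: "integrable lborel (\<lambda>x. cnj (?u x) * b x)"
    by (rule square_integrable_product(1)[OF square_integrable_reflected(1)[OF u] b])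
  show "(\<lambda>n. \<integral>x. cnj (of_real (\<eta> n (x - h)) * u (x - h)) * b x \<partial>lborel)
    \<longlonglongrightarrow> (correlation u b h)"
  proof (rule integral_dominated_convergence[where w="\<lambda>x. M * cmod (cnj (?u x) * b x)"])
    show "AE x in lborel. (\<lambda>n. cnj (of_real (\<eta> n (x - h)) * u (x - h)) * b x) \<longlonglongrightarrow> cnj (u (x - h)) * b x"
    proof (rule AE_I2)
      fix x
      have "(\<lambda>n. cnj (of_real (\<eta> n (x - h)) * u (x - h)) * b x) \<longlonglongrightarrow> cnj (of_real 1 * u (x - h)) * b x"
        by (intro tendsto_mult tendsto_cnj tendsto_of_real \<eta>_lim tendsto_const)
      then show "(\<lambda>n. cnj (of_real (\<eta> n (x - h)) * u (x - h)) * b x) \<longlonglongrightarrow> cnj (u (x - h)) * b x"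
        by simp
    qed
    show "AE x in lborel. norm (cnj (of_real (\<eta> n (x - h)) * u (x - h)) * b x) \<le> M * cmod (cnj (?u x) * b x)" for n
      using \<eta>_bound by (auto simp: norm_mult mult.assoc intro!: AE_I2 mult_right_mono)
  qed (use I in auto)
  have "cmod (\<integral>x. cnj (of_real (\<eta> n (x - h)) * u (x - h)) * b x \<partial>lborel)
      \<le> 1 / 2 * (\<integral>x. (cmod (of_real (\<eta> n (x - h)) * ?u x))\<^sup>2 \<partial>lborel) + 1 / (2 * 1) * (square_integral b)
      \<and> (\<integral>x. (cmod (of_real (\<eta> n (x - h)) * ?u x))\<^sup>2 \<partial>lborel) \<le> (\<integral>x. M\<^sup>2 * (cmod (?u x))\<^sup>2 \<partial>lborel)"
  proof
    have pt: "(cmod (of_real (\<eta> n (x - h)) * ?u x))\<^sup>2 \<le> M\<^sup>2 * (cmod (?u x))\<^sup>2" for x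
      using power_mono[OF \<eta>_bound[of n "x - h"] abs_ge_zero, of 2]
      by (simp add: norm_mult power_mult_distrib mult_right_mono)
    have J: "integrable lborel (\<lambda>x. M\<^sup>2 * (cmod (?u x))\<^sup>2)"
      by (intro integrable_mult_right square_integrableD(2) square_integrable_reflected u)
    have J2: "integrable lborel (\<lambda>x. (cmod (of_real (\<eta> n (x - h)) * ?u x))\<^sup>2)"
      by (rule Bochner_Integration.integrable_bound[OF J])
        (measurable, intro AE_I2, unfold real_norm_def abs_power2, rule order_trans[OF pt abs_ge_self])
    show "(\<integral>x. (cmod (of_real (\<eta> n (x - h)) * ?u x))\<^sup>2 \<partial>lborel) \<le> (\<integral>x. M\<^sup>2 * (cmod (?u x))\<^sup>2 \<partial>lborel)"
      by (rule integral_mono[OF J2 J pt])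
    have "square_integrable (\<lambda>x. of_real (\<eta> n (x - h)) * ?u x)"
      using J2 by (auto simp: square_integrable_def)
    from square_integrable_product(2)[OF this b, of 1]
    show "cmod (\<integral>x. cnj (of_real (\<eta> n (x - h)) * u (x - h)) * b x \<partial>lborel)
      \<le> 1 / 2 * (\<integral>x. (cmod (of_real (\<eta> n (x - h)) * ?u x))\<^sup>2 \<partial>lborel) + 1 / (2 * 1) * (square_integral b)"
      by simp
  qed
  then show "cmod (\<integral>x. cnj (of_real (\<eta> n (x - h)) * u (x - h)) * b x \<partial>lborel)
    \<le> M\<^sup>2 / 2 * (square_integral u) + 1 / 2 * (square_integral b)"
    using square_integrable_reflected(2)[OF u, of h] by simp
qed

text \<open>Passing to the limit in the Gaussian pairing of the truncated functions: the frequency side is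
dominated by a Gaussian times a polynomial, the other side by a constant multiple of a Gaussian.\<close>

lemma fourier_limit_pairing:
  assumes r: "0 < r"
  shows "(\<integral>\<xi>. of_real (gauss (r *\<^sub>R \<xi>)) * (cnj (U \<xi>) * fourier b \<xi>) \<partial>lborel)
    = of_real (sqrt (2 * pi) ^ DIM('a))
      * (\<integral>t. of_real (gauss t) * (correlation u b (r *\<^sub>R t)) \<partial>lborel)"
proof -
  let ?a = "\<lambda>n x. of_real (\<eta> n x) * u x"
  let ?T = "\<lambda>n h. \<integral>x. cnj (of_real (\<eta> n (x - h)) * u (x - h)) * b x \<partial>lborel"
  let ?B = "\<integral>x. cmod (b x) \<partial>lborel"
  define C where "C = M\<^sup>2 / 2 * (square_integral u) + 1 / 2 * (square_integral b)"
  note [measurable] = fourier_measurable[OF b1] fourier_measurable[OF \<eta>u] square_integrableD(1)[OF u] square_integrableD(1)[OF b] \<eta>_meas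
  have [measurable]: "U \<in> borel_measurable borel"
    by (rule borel_measurable_LIMSEQ_metric[OF fourier_measurable[OF \<eta>u] U_lim])
  have L: "(\<lambda>n. \<integral>\<xi>. of_real (gauss (r *\<^sub>R \<xi>)) * (cnj (fourier (?a n) \<xi>) * fourier b \<xi>) \<partial>lborel)
      \<longlonglongrightarrow> (\<integral>\<xi>. of_real (gauss (r *\<^sub>R \<xi>)) * (cnj (U \<xi>) * fourier b \<xi>) \<partial>lborel)"
  proof (rule integral_dominated_convergence[where w="\<lambda>\<xi>. gauss (r *\<^sub>R \<xi>) * (K * ?B * (1 + (norm \<xi>)\<^sup>2)\<^sup>2)"])
    show "integrable lborel (\<lambda>\<xi> :: 'a. gauss (r *\<^sub>R \<xi>) * (K * ?B * (1 + (norm \<xi>)\<^sup>2)\<^sup>2))"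
      by (rule gauss_polynomial_integrable[OF r])
    show "AE \<xi> in lborel. (\<lambda>n. of_real (gauss (r *\<^sub>R \<xi>)) * (cnj (fourier (?a n) \<xi>) * fourier b \<xi>))
        \<longlonglongrightarrow> of_real (gauss (r *\<^sub>R \<xi>)) * (cnj (U \<xi>) * fourier b \<xi>)"
      by (intro AE_I2 tendsto_mult tendsto_cnj U_lim tendsto_const)
    show "AE \<xi> in lborel. norm (of_real (gauss (r *\<^sub>R \<xi>)) * (cnj (fourier (?a n) \<xi>) * fourier b \<xi>))
        \<le> gauss (r *\<^sub>R \<xi>) * (K * ?B * (1 + (norm \<xi>)\<^sup>2)\<^sup>2)" for n
    proof (rule AE_I2)
      fix \<xi> :: 'a
      have "cmod (fourier (?a n) \<xi>) * cmod (fourier b \<xi>) \<le> K * (1 + (norm \<xi>)\<^sup>2)\<^sup>2 * ?B"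
        by (intro mult_mono U_bound fourier_bound b1 order_trans[OF norm_ge_zero U_bound]) auto
      then have "gauss (r *\<^sub>R \<xi>) * (cmod (fourier (?a n) \<xi>) * cmod (fourier b \<xi>)) \<le> gauss (r *\<^sub>R \<xi>) * (K * (1 + (norm \<xi>)\<^sup>2)\<^sup>2 * ?B)"
        by (intro mult_left_mono less_imp_le[OF gauss_pos])
      then show "norm (of_real (gauss (r *\<^sub>R \<xi>)) * (cnj (fourier (?a n) \<xi>) * fourier b \<xi>))
        \<le> gauss (r *\<^sub>R \<xi>) * (K * ?B * (1 + (norm \<xi>)\<^sup>2)\<^sup>2)"
        by (simp add: norm_mult abs_of_pos[OF gauss_pos] mult_ac)
    qed
  qed measurable
  have R: "(\<lambda>n. \<integral>t. of_real (gauss t) * ?T n (r *\<^sub>R t) \<partial>lborel)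
      \<longlonglongrightarrow> (\<integral>t. of_real (gauss t) * (correlation u b (r *\<^sub>R t)) \<partial>lborel)"
  proof (rule integral_dominated_convergence[where w="\<lambda>t. C * gauss t"])
    have meas: "(\<lambda>t. correlation g b (r *\<^sub>R t)) \<in> borel_measurable lborel"
      if [measurable]: "g \<in> borel_measurable borel" for g :: "'a \<Rightarrow> complex"
    proof -
      have "(\<lambda>p. cnj (g (snd p - r *\<^sub>R fst p)) * b (snd p)) \<in> borel_measurable (borel \<Otimes>\<^sub>M lborel)"
        by measurable
      then show ?thesis
        using lborel.borel_measurable_lebesgue_integral[of "\<lambda>t x. cnj (g (x - r *\<^sub>R t)) * b x" borel]
        by (simp add: split_beta)
    qed
    show "(\<lambda>t. of_real (gauss t) * (correlation u b (r *\<^sub>R t))) \<in> borel_measurable lborel"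
      using meas[of u] by measurable
    show "(\<lambda>t. of_real (gauss t) * ?T n (r *\<^sub>R t)) \<in> borel_measurable lborel" for n
      using meas[of "?a n"] by measurable
    show "integrable lborel (\<lambda>t :: 'a. C * gauss t)"
      by (intro integrable_mult_right gauss_integrable)
    show "AE t in lborel. (\<lambda>n. of_real (gauss t) * ?T n (r *\<^sub>R t)) \<longlonglongrightarrow> of_real (gauss t) * (correlation u b (r *\<^sub>R t))"
      by (intro AE_I2 tendsto_mult tendsto_const truncated_correlation_tendsto)
    show "AE t in lborel. norm (of_real (gauss t) * ?T n (r *\<^sub>R t)) \<le> C * gauss t" for n
    proof (rule AE_I2)
      fix t :: 'a
      have "cmod (?T n (r *\<^sub>R t)) \<le> C"
        unfolding C_def by (rule truncated_correlation_bound)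
      then show "norm (of_real (gauss t) * ?T n (r *\<^sub>R t)) \<le> C * gauss t"
        unfolding norm_mult norm_of_real abs_of_pos[OF gauss_pos] mult.commute[of "gauss t"]
        by (rule mult_right_mono) (rule less_imp_le[OF gauss_pos])
    qed
  qed
  have "(\<lambda>n. \<integral>\<xi>. of_real (gauss (r *\<^sub>R \<xi>)) * (cnj (fourier (?a n) \<xi>) * fourier b \<xi>) \<partial>lborel)
      \<longlonglongrightarrow> of_real (sqrt (2 * pi) ^ DIM('a)) * (\<integral>t. of_real (gauss t) * (correlation u b (r *\<^sub>R t)) \<partial>lborel)"
    unfolding gauss_fourier_pairing[OF r \<eta>u b1] by (intro tendsto_mult tendsto_const R)
  with L show ?thesis
    by (rule LIMSEQ_unique)
qed

lemma fourier_limit_integrable: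
  assumes r: "0 < r"
  shows "integrable lborel (\<lambda>\<xi>. of_real (gauss (r *\<^sub>R \<xi>)) * (cnj (U \<xi>) * fourier b \<xi>))"
proof -
  note [measurable] = fourier_measurable[OF b1]
  have [measurable]: "U \<in> borel_measurable borel"
    by (rule borel_measurable_LIMSEQ_metric[OF fourier_measurable[OF \<eta>u] U_lim])
  have Ub: "cmod (U \<xi>) \<le> K * (1 + (norm \<xi>)\<^sup>2)\<^sup>2" for \<xi>
    by (rule LIMSEQ_le_const2[OF tendsto_norm[OF U_lim]]) (use U_bound in blast)
  show ?thesis
  proof (rule Bochner_Integration.integrable_bound[OF gauss_polynomial_integrable[OF r, of "K * (\<integral>x. cmod (b x) \<partial>lborel)"]])
    show "AE \<xi> in lborel. norm (of_real (gauss (r *\<^sub>R \<xi>)) * (cnj (U \<xi>) * fourier b \<xi>))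
        \<le> norm (gauss (r *\<^sub>R \<xi>) * (K * (\<integral>x. cmod (b x) \<partial>lborel) * (1 + (norm \<xi>)\<^sup>2)\<^sup>2))"
    proof (rule AE_I2)
      fix \<xi> :: 'a
      have "cmod (U \<xi>) * cmod (fourier b \<xi>) \<le> K * (1 + (norm \<xi>)\<^sup>2)\<^sup>2 * (\<integral>x. cmod (b x) \<partial>lborel)"
        by (intro mult_mono Ub fourier_bound b1 order_trans[OF norm_ge_zero Ub]) auto
      then have "gauss (r *\<^sub>R \<xi>) * (cmod (U \<xi>) * cmod (fourier b \<xi>))
          \<le> gauss (r *\<^sub>R \<xi>) * (K * (\<integral>x. cmod (b x) \<partial>lborel) * (1 + (norm \<xi>)\<^sup>2)\<^sup>2)"
        by (intro mult_left_mono less_imp_le[OF gauss_pos]) (simp add: mult_ac)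
      also have "\<dots> \<le> \<bar>\<dots>\<bar>"
        by (rule abs_ge_self)
      finally show "norm (of_real (gauss (r *\<^sub>R \<xi>)) * (cnj (U \<xi>) * fourier b \<xi>))
        \<le> norm (gauss (r *\<^sub>R \<xi>) * (K * (\<integral>x. cmod (b x) \<partial>lborel) * (1 + (norm \<xi>)\<^sup>2)\<^sup>2))"
        by (simp add: norm_mult abs_of_pos[OF gauss_pos] del: abs_mult)
    qed
  qed measurable
qed

lemma fourier_limit_pairing_tendsto:
  "(\<lambda>n. gauss_pairing n U b)
    \<longlonglongrightarrow> of_real ((2 * pi) ^ DIM('a)) * (l2_inner u b)"
proof -
  define C where "C = 1 / 2 * (square_integral u) + 1 / 2 * (square_integral b)"
  let ?T = "\<lambda>h. correlation u b h"
  let ?r = "\<lambda>n. inverse (real (Suc n))"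
  note [measurable] = square_integrableD(1)[OF u] square_integrableD(1)[OF b]
  have T_meas: "(\<lambda>t. ?T (r *\<^sub>R t)) \<in> borel_measurable lborel" for r
  proof -
    have "(\<lambda>p. cnj (u (snd p - r *\<^sub>R fst p)) * b (snd p)) \<in> borel_measurable (borel \<Otimes>\<^sub>M lborel)"
      by measurable
    then show ?thesis
      using lborel.borel_measurable_lebesgue_integral[of "\<lambda>t x. cnj (u (x - r *\<^sub>R t)) * b x" borel]
      by (simp add: split_beta)
  qed
  have T_bound: "cmod (?T h) \<le> C" for h
    using square_integrable_product(2)[OF square_integrable_reflected(1)[OF u] b, of 1 h]
      square_integrable_reflected(2)[OF u, of h] by (simp add: C_def)
  have lim: "(\<lambda>n. \<integral>t. of_real (gauss t) * ?T (?r n *\<^sub>R t) \<partial>lborel)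
      \<longlonglongrightarrow> (\<integral>t. of_real (gauss (t :: 'a)) * (l2_inner u b) \<partial>lborel)"
  proof (rule integral_dominated_convergence[where w="\<lambda>t. C * gauss t"])
    show "(\<lambda>t. of_real (gauss t) * ?T (?r n *\<^sub>R t)) \<in> borel_measurable lborel" for n
      using T_meas[of "?r n"] by measurable
    show "integrable lborel (\<lambda>t :: 'a. C * gauss t)"
      by (intro integrable_mult_right gauss_integrable)
    have "(\<lambda>n. ?r n *\<^sub>R t) \<longlonglongrightarrow> 0" for t :: 'a
      using tendsto_scaleR[OF LIMSEQ_inverse_real_of_nat tendsto_const[of t]] by simp
    then show "AE t in lborel. (\<lambda>n. of_real (gauss t) * ?T (?r n *\<^sub>R t)) \<longlonglongrightarrow> of_real (gauss t) * (l2_inner u b)"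
      by (intro AE_I2 tendsto_mult tendsto_const correlation_tendsto[OF u b])
    show "AE t in lborel. norm (of_real (gauss t) * ?T (?r n *\<^sub>R t)) \<le> C * gauss t" for n
      unfolding norm_mult norm_of_real abs_of_pos[OF gauss_pos] mult.commute[of "gauss _"]
      by (intro AE_I2 mult_right_mono T_bound less_imp_le[OF gauss_pos])
  qed measurable
  let ?c = "complex_of_real (sqrt (2 * pi) ^ DIM('a))"
  have total: "(\<integral>t. of_real (gauss (t :: 'a)) * (l2_inner u b) \<partial>lborel)
      = ?c * (l2_inner u b)"
    using gauss_integral[where 'a='a] by simp
  have "sqrt (2 * pi) ^ DIM('a) * sqrt (2 * pi) ^ DIM('a) = (2 * pi) ^ DIM('a)"
    by (subst power_mult_distrib[symmetric]) simp
  then have c2: "?c * ?c = of_real ((2 * pi) ^ DIM('a))"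
    by (metis of_real_mult)
  have "(\<lambda>n. ?c * (\<integral>t. of_real (gauss t) * ?T (?r n *\<^sub>R t) \<partial>lborel)) \<longlonglongrightarrow> ?c * (?c * (l2_inner u b))"
    by (rule tendsto_mult[OF tendsto_const lim[unfolded total]])
  then show ?thesis
    unfolding mult.assoc[symmetric, of ?c ?c] c2
    by (subst fourier_limit_pairing) simp_all
qed

end

section \<open>The integral of the resolvent symbol over the plane\<close>

text \<open>Polar coordinates for functions of \<open>|\<xi>|\<^sup>2\<close>: discs of squared radius \<open>a\<close> have area \<open>\<pi> a\<close>, and these areas determine
the image measure.\<close>

lemma distr_norm_sq_plane:
  "distr lborel borel (\<lambda>\<xi> :: real ^ 2. (norm \<xi>)\<^sup>2) = density lborel (\<lambda>s. ennreal pi * indicator {0..} s)"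
proof (rule measure_eqI_generator_eq[where E="range (\<lambda>a :: real. {..a})" and \<Omega>=UNIV and A="\<lambda>n. {..real n}"])
  show "Int_stable (range (\<lambda>a :: real. {..a}))"
    by (auto simp: Int_stable_def)
  show "sets (distr lborel borel (\<lambda>\<xi> :: real ^ 2. (norm \<xi>)\<^sup>2)) = sigma_sets UNIV (range (\<lambda>a :: real. {..a}))"
    "sets (density lborel (\<lambda>s. ennreal pi * indicator {0..} s)) = sigma_sets UNIV (range (\<lambda>a :: real. {..a}))"
    by (simp_all add: borel_eq_atMost)
  have val: "emeasure (distr lborel borel (\<lambda>\<xi> :: real ^ 2. (norm \<xi>)\<^sup>2)) {..a} = ennreal (pi * max 0 a)"
    for a :: real
  proof (cases "0 \<le> a")
    case True
    have "(\<lambda>\<xi> :: real ^ 2. (norm \<xi>)\<^sup>2) -` {..a} = cball 0 (sqrt a)"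
      by (auto simp: real_le_rsqrt) (metis real_sqrt_le_iff real_sqrt_abs abs_norm_cancel real_le_lsqrt norm_ge_zero real_sqrt_pow2 True power_mono)+
    then show ?thesis
      using True emeasure_cball[of "sqrt a" "0 :: real ^ 2"]
      by (simp add: emeasure_distr unit_ball_vol_2)
  next
    case False
    then have "(\<lambda>\<xi> :: real ^ 2. (norm \<xi>)\<^sup>2) -` {..a} = {}"
      by (auto dest: order_trans[OF zero_le_power2])
    with False show ?thesis
      by (simp add: emeasure_distr)
  qed
  have val2: "emeasure (density lborel (\<lambda>s. ennreal pi * indicator {0..} s)) {..a} = ennreal (pi * max 0 a)"
    for a :: real
  proof -
    have "emeasure (density lborel (\<lambda>s. ennreal pi * indicator {0..} s)) {..a}
        = (\<integral>\<^sup>+ s. ennreal pi * indicator {0..a} s \<partial>lborel)"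
      by (subst emeasure_density) (auto intro!: nn_integral_cong simp: indicator_def)
    also have "\<dots> = ennreal pi * emeasure lborel {0..a}"
      by (simp add: nn_integral_cmult)
    also have "\<dots> = ennreal (pi * max 0 a)"
      by (cases "0 \<le> a") (simp_all add: ennreal_mult)
    finally show ?thesis .
  qed
  show "emeasure (distr lborel borel (\<lambda>\<xi> :: real ^ 2. (norm \<xi>)\<^sup>2)) X
      = emeasure (density lborel (\<lambda>s. ennreal pi * indicator {0..} s)) X"
    if "X \<in> range (\<lambda>a :: real. {..a})" for X
    using that val val2 by auto
  show "emeasure (distr lborel borel (\<lambda>\<xi> :: real ^ 2. (norm \<xi>)\<^sup>2)) {..real n} \<noteq> \<infinity>" for n
    by (simp add: val)
  show "(\<Union>i. {..real i}) = UNIV"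
    using real_arch_simple by auto
qed auto

lemma nn_integral_radial_plane:
  assumes [measurable]: "F \<in> borel_measurable borel"
  shows "(\<integral>\<^sup>+ \<xi>. F ((norm (\<xi> :: real ^ 2))\<^sup>2) \<partial>lborel) = ennreal pi * (\<integral>\<^sup>+ s. F s * indicator {0..} s \<partial>lborel)"
proof -
  have "(\<integral>\<^sup>+ \<xi>. F ((norm (\<xi> :: real ^ 2))\<^sup>2) \<partial>lborel) = (\<integral>\<^sup>+ s. F s \<partial>distr lborel borel (\<lambda>\<xi> :: real ^ 2. (norm \<xi>)\<^sup>2))"
    by (simp add: nn_integral_distr)
  also have "\<dots> = (\<integral>\<^sup>+ s. ennreal pi * (F s * indicator {0..} s) \<partial>lborel)"
    unfolding distr_norm_sq_plane by (subst nn_integral_density) (auto simp: mult_ac)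
  finally show ?thesis
    by (simp add: nn_integral_cmult)
qed

text \<open>Positivity of the imaginary part of the resolvent: the function integrated over the frequency plane is the
imaginary part of a meromorphic one, and so has an explicit antiderivative.\<close>

lemma Im_resolvent:
  fixes k \<mu> p :: complex and c s :: real
  assumes \<mu>: "\<mu>\<^sup>2 = k\<^sup>2 - (of_real c)\<^sup>2" and p: "p = k + of_real c"
  shows "Im (p / (of_real (s\<^sup>2) - \<mu>\<^sup>2)) = Im k * ((cmod p)\<^sup>2 + s\<^sup>2) / (cmod (of_real (s\<^sup>2) - \<mu>\<^sup>2))\<^sup>2"
proof -
  have \<mu>': "\<mu>\<^sup>2 = p * (k - of_real c)"
  proof -
    have "p * (k - of_real c) = k\<^sup>2 - (of_real c)\<^sup>2"
      by (simp add: p algebra_simps power2_eq_square)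
    then show ?thesis by (simp add: \<mu>)
  qed
  have "Im (p * cnj (of_real (s\<^sup>2) - \<mu>\<^sup>2)) = Im k * ((cmod p)\<^sup>2 + s\<^sup>2)"
    unfolding \<mu>' cmod_power2 by (simp add: p algebra_simps power2_eq_square)
  moreover have "Im (p / (of_real (s\<^sup>2) - \<mu>\<^sup>2)) = Im (p * cnj (of_real (s\<^sup>2) - \<mu>\<^sup>2)) / (cmod (of_real (s\<^sup>2) - \<mu>\<^sup>2))\<^sup>2"
    by (subst complex_div_cnj) (simp add: Im_divide_of_real del: complex_cnj_diff of_real_power flip: of_real_power)
  ultimately show ?thesis by simp
qed

text \<open>The antiderivative of \<open>1 / (s\<^sup>2 - \<mu>\<^sup>2)\<close> is \<open>(Ln (s - \<mu>) - Ln (s + \<mu>)) / (2 \<mu>)\<close>. Since \<open>Im \<mu> > 0\<close>, the points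
\<open>s - \<mu>\<close> and \<open>s + \<mu>\<close> stay in the lower and in the upper half-plane, away from the branch cut. At infinity the
antiderivative vanishes, and at \<open>s = 0\<close> the two logarithms differ by \<open>- \<i> \<pi>\<close>.\<close>

lemma resolvent_line_integral:
  fixes k \<mu> p :: complex and c :: real
  assumes \<mu>: "\<mu>\<^sup>2 = k\<^sup>2 - (of_real c)\<^sup>2" and p: "p = k + of_real c" and Im\<mu>: "0 < Im \<mu>" and k: "0 \<le> Im k"
  shows "(\<integral>\<^sup>+ s. ennreal (Im k * ((cmod p)\<^sup>2 + s\<^sup>2) / (cmod (of_real (s\<^sup>2) - \<mu>\<^sup>2))\<^sup>2) * indicator {0..} s \<partial>lborel)
    = ennreal (pi / 2 * Re (p / \<mu>))"
    and "0 \<le> Re (p / \<mu>)"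
proof -
  have \<mu>0: "\<mu> \<noteq> 0" using Im\<mu> by auto
  define A :: "complex \<Rightarrow> complex" where "A z = (Ln (z - \<mu>) - Ln (z + \<mu>)) / (2 * \<mu>)" for z
  define H where "H s = Im (p * A (of_real s))" for s :: real
  have ne: "of_real s - \<mu> \<noteq> 0" "of_real s + \<mu> \<noteq> 0" "of_real s - \<mu> \<notin> \<real>\<^sub>\<le>\<^sub>0" "of_real s + \<mu> \<notin> \<real>\<^sub>\<le>\<^sub>0" for s :: real
    using Im\<mu> by (auto simp: complex_eq_iff complex_nonpos_Reals_iff)
  have DA: "(A has_field_derivative 1 / ((of_real s)\<^sup>2 - \<mu>\<^sup>2)) (at (of_real s))" for s :: real
  proof -
    have "(A has_field_derivative (1 / (of_real s - \<mu>) - 1 / (of_real s + \<mu>)) / (2 * \<mu>)) (at (of_real s))"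
      unfolding A_def[abs_def] using ne[of s] \<mu>0
      by (auto intro!: derivative_eq_intros simp: divide_simps)
    also have "(1 / (of_real s - \<mu>) - 1 / (of_real s + \<mu>)) / (2 * \<mu>) = 1 / ((of_real s)\<^sup>2 - \<mu>\<^sup>2)"
    proof -
      have "(of_real s)\<^sup>2 - \<mu>\<^sup>2 = (of_real s - \<mu>) * (of_real s + \<mu>)"
        by (simp add: algebra_simps power2_eq_square)
      then show ?thesis
        using ne(1,2)[of s] \<mu>0 by (simp add: divide_simps)
    qed
    finally show ?thesis .
  qed
  have DH: "(H has_real_derivative Im k * ((cmod p)\<^sup>2 + s\<^sup>2) / (cmod (of_real (s\<^sup>2) - \<mu>\<^sup>2))\<^sup>2) (at s)" for s
  proof -
    have "((\<lambda>s. p * A (of_real s)) has_vector_derivative (p * (1 / ((of_real s)\<^sup>2 - \<mu>\<^sup>2)))) (at s)"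
      by (intro has_vector_derivative_mult_right has_vector_derivative_real_field DA)
    from bounded_linear.has_vector_derivative[OF bounded_linear_Im this] show ?thesis
      using Im_resolvent[OF \<mu> p, of s]
      by (simp add: H_def[abs_def] has_real_derivative_iff_has_vector_derivative)
  qed
  have lim: "(H \<longlongrightarrow> 0) at_top"
  proof -
    have ev: "\<forall>\<^sub>F s in at_top. (Ln (1 - \<mu> / of_real s) - Ln (1 + \<mu> / of_real s)) / (2 * \<mu>) = A (of_real s)"
      using eventually_gt_at_top[of 0]
    proof eventually_elim
      case (elim s)
      have "Ln (of_real s * (1 - \<mu> / of_real s)) = of_real (ln s) + Ln (1 - \<mu> / of_real s)"
        "Ln (of_real s * (1 + \<mu> / of_real s)) = of_real (ln s) + Ln (1 + \<mu> / of_real s)"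
      proof -
        have "1 - \<mu> / of_real s = (of_real s - \<mu>) / of_real s" "1 + \<mu> / of_real s = (of_real s + \<mu>) / of_real s"
          using elim by (simp_all add: divide_simps)
        then have nz: "1 - \<mu> / of_real s \<noteq> 0" "1 + \<mu> / of_real s \<noteq> 0"
          using elim ne(1,2)[of s] by simp_all
        show "Ln (of_real s * (1 - \<mu> / of_real s)) = of_real (ln s) + Ln (1 - \<mu> / of_real s)"
          using Ln_times_of_real[OF elim nz(1)] elim by (simp add: Ln_of_real)
        show "Ln (of_real s * (1 + \<mu> / of_real s)) = of_real (ln s) + Ln (1 + \<mu> / of_real s)"
          using Ln_times_of_real[OF elim nz(2)] elim by (simp add: Ln_of_real)
      qed
      moreover have "of_real s * (1 - \<mu> / of_real s) = of_real s - \<mu>" "of_real s * (1 + \<mu> / of_real s) = of_real s + \<mu>"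
        using elim by (simp_all add: right_diff_distrib distrib_left)
      ultimately show ?case
        by (simp add: A_def)
    qed
    have inv: "((\<lambda>s. \<mu> / of_real s) \<longlongrightarrow> 0) at_top"
    proof -
      have "((\<lambda>s. \<mu> * of_real (inverse s)) \<longlongrightarrow> \<mu> * of_real 0) at_top"
        by (intro tendsto_mult tendsto_const tendsto_of_real tendsto_inverse_0_at_top filterlim_ident)
      then show ?thesis by (simp add: divide_inverse)
    qed
    have "((\<lambda>s. (Ln (1 - \<mu> / of_real s) - Ln (1 + \<mu> / of_real s)) / (2 * \<mu>)) \<longlongrightarrow> (Ln (1 - 0) - Ln (1 + 0)) / (2 * \<mu>)) at_top"
      using \<mu>0 by (intro tendsto_intros inv) auto
    then have "((\<lambda>s. A (of_real s)) \<longlongrightarrow> 0) at_top"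
      by (rule Lim_transform_eventually[OF _ ev, THEN tendsto_eq_rhs]) simp
    then have "(H \<longlongrightarrow> Im (p * 0)) at_top"
      unfolding H_def by (intro tendsto_Im tendsto_mult tendsto_const)
    then show ?thesis by simp
  qed
  have H0: "H 0 = - (pi / 2 * Re (p / \<mu>))"
  proof -
    have "Ln (- \<mu>) = Ln \<mu> - \<i> * of_real pi"
      using Ln_minus[OF \<mu>0] Im\<mu> by simp
    then have "A 0 = - (\<i> * of_real pi) / (2 * \<mu>)"
      by (simp add: A_def)
    then have "p * A (of_real 0) = - (\<i> * of_real (pi / 2) * (p / \<mu>))"
      by simp
    moreover have "Im (- (\<i> * of_real r * z)) = - (r * Re z)" for r z
      by simp
    ultimately show ?thesis
      unfolding H_def by (simp only:)
  qed
  have "(\<integral>\<^sup>+ s. ennreal (Im k * ((cmod p)\<^sup>2 + s\<^sup>2) / (cmod (of_real (s\<^sup>2) - \<mu>\<^sup>2))\<^sup>2) * indicator {0..} s \<partial>lborel)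
    = ennreal (0 - H 0)"
    by (rule nn_integral_FTC_atLeast[OF _ DH _ lim]) (use k in auto)
  then show "(\<integral>\<^sup>+ s. ennreal (Im k * ((cmod p)\<^sup>2 + s\<^sup>2) / (cmod (of_real (s\<^sup>2) - \<mu>\<^sup>2))\<^sup>2) * indicator {0..} s \<partial>lborel)
    = ennreal (pi / 2 * Re (p / \<mu>))"
    by (simp add: H0)
  have "H 0 \<le> H t" if "0 \<le> t" for t
    by (rule DERIV_nonneg_imp_nondecreasing[OF that]) (use DH k in \<open>auto intro!: exI divide_nonneg_nonneg mult_nonneg_nonneg\<close>)
  then have "H 0 \<le> 0"
    by (intro tendsto_lowerbound[OF lim]) (auto intro: eventually_at_top_linorderI[of 0])
  then show "0 \<le> Re (p / \<mu>)"
    using pi_gt_zero by (auto simp: H0 zero_le_mult_iff)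
qed

lemma resolvent_plane_integral:
  fixes k \<mu> p :: complex and c :: real
  assumes \<mu>: "\<mu>\<^sup>2 = k\<^sup>2 - (of_real c)\<^sup>2" and p: "p = k + of_real c" and Im\<mu>: "0 < Im \<mu>" and k: "0 \<le> Im k"
  shows "(\<integral>\<^sup>+ \<xi>. ennreal (Im k * ((cmod p)\<^sup>2 + ((norm (\<xi> :: real ^ 2))\<^sup>2)\<^sup>2) / (cmod (of_real (((norm \<xi>)\<^sup>2)\<^sup>2) - \<mu>\<^sup>2))\<^sup>2) \<partial>lborel)
    = ennreal (pi\<^sup>2 / 2 * Re (p / \<mu>))"
proof -
  have "(\<integral>\<^sup>+ \<xi>. ennreal (Im k * ((cmod p)\<^sup>2 + ((norm (\<xi> :: real ^ 2))\<^sup>2)\<^sup>2) / (cmod (of_real (((norm \<xi>)\<^sup>2)\<^sup>2) - \<mu>\<^sup>2))\<^sup>2) \<partial>lborel)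
    = ennreal pi * ennreal (pi / 2 * Re (p / \<mu>))"
    unfolding resolvent_line_integral(1)[OF assms, symmetric] by (rule nn_integral_radial_plane) measurable
  also have "\<dots> = ennreal (pi * (pi / 2 * Re (p / \<mu>)))"
    by (rule ennreal_mult'[symmetric]) simp
  also have "pi * (pi / 2 * Re (p / \<mu>)) = pi\<^sup>2 / 2 * Re (p / \<mu>)"
    by (simp add: power2_eq_square)
  finally show ?thesis .
qed

section \<open>Positive square roots of two by two matrices\<close>

lemma matrix_mult_entry_2:
  fixes A B :: "complex ^ 2 ^ 2"
  shows "(A ** B) $ i $ j = A $ i $ 1 * B $ 1 $ j + A $ i $ 2 * B $ 2 $ j"
  by (simp add: matrix_matrix_mult_def sum_2)

lemma matrix_vector_entry_2:
  fixes A :: "complex ^ 2 ^ 2"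
  shows "(A *v x) $ i = A $ i $ 1 * x $ 1 + A $ i $ 2 * x $ 2"
  by (simp add: matrix_vector_mult_def sum_2)

lemma hermitian_entry: "hermitian A \<Longrightarrow> A $ j $ i = cnj (A $ i $ j)"
  unfolding hermitian_def ctranspose_def by (metis vec_lambda_beta)

text \<open>The determinant condition results from testing the form on the columns of the adjugate matrix. If both
diagonal entries vanish, these columns give nothing, and the form is tested on \<open>(1, - cnj b)\<close> instead.\<close>

lemma pos_semidef_2:
  fixes P :: "complex ^ 2 ^ 2"
  assumes P: "pos_semidef P"
  obtains a c :: real and b where "P $ 1 $ 1 = of_real a" "P $ 2 $ 2 = of_real c" "P $ 1 $ 2 = b" "P $ 2 $ 1 = cnj b"
    "0 \<le> a" "0 \<le> c" "(cmod b)\<^sup>2 \<le> a * c"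
proof -
  have herm: "P $ j $ i = cnj (P $ i $ j)" for i j
    using P hermitian_entry unfolding pos_semidef_def by blast
  define a where "a = Re (P $ 1 $ 1)"
  define c where "c = Re (P $ 2 $ 2)"
  define b where "b = P $ 1 $ 2"
  have E: "P $ 1 $ 1 = of_real a" "P $ 2 $ 2 = of_real c" "P $ 1 $ 2 = b" "P $ 2 $ 1 = cnj b"
    using herm[of 1 1] herm[of 2 2] herm[of 2 1] by (auto simp: a_def b_def c_def complex_eq_iff)
  have form: "0 \<le> Re (cnj x * (of_real a * x + b * y) + cnj y * (cnj b * x + of_real c * y))" for x y
  proof -
    have "0 \<le> Re (\<Sum>i\<in>UNIV. cnj ((vector [x, y] :: complex ^ 2) $ i) * (P *v vector [x, y]) $ i)"
      using P by (simp add: pos_semidef_def)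
    then show ?thesis
      by (simp add: sum_2 matrix_vector_entry_2 E)
  qed
  have a: "0 \<le> a" and c: "0 \<le> c"
    using form[of 1 0] form[of 0 1] by simp_all
  have sq: "(cmod b)\<^sup>2 = (Re b)\<^sup>2 + (Im b)\<^sup>2"
    by (rule cmod_power2)
  have 1: "0 \<le> a * (a * c - (cmod b)\<^sup>2)"
    using form[of "- b" "of_real a"] unfolding sq by (simp add: power2_eq_square algebra_simps)
  have 2: "0 \<le> c * (a * c - (cmod b)\<^sup>2)"
    using form[of "of_real c" "- cnj b"] unfolding sq by (simp add: power2_eq_square algebra_simps)
  have "(cmod b)\<^sup>2 \<le> a * c"
  proof (cases "a = 0 \<and> c = 0")
    case True
    then show ?thesis
      using form[of 1 "- cnj b"] unfolding sq by (simp add: power2_eq_square)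
  next
    case False
    then have "0 < a \<or> 0 < c"
      using a c by linarith
    then show ?thesis
      using 1 2 by (auto simp: zero_le_mult_iff)
  qed
  with E a c show thesis
    by (rule that)
qed

lemma real_eq_of_sq: "0 \<le> x \<Longrightarrow> 0 \<le> y \<Longrightarrow> x\<^sup>2 = y\<^sup>2 \<Longrightarrow> x = (y :: real)"
  by (rule power2_eq_imp_eq)

text \<open>The square determines determinant and trace of a positive semidefinite root: the determinant is the
nonnegative root of \<open>det (P\<^sup>2)\<close>, and \<open>(tr P)\<^sup>2 = tr (P\<^sup>2) + 2 det P\<close>. By Cayley--Hamilton, \<open>(tr P) P = P\<^sup>2 + (det P) 1\<close>, so \<open>P\<close>
itself is determined unless the trace is 0, and then \<open>P = 0\<close>.\<close>

lemma pos_semidef_sqrt_unique_2: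
  fixes P Q :: "complex ^ 2 ^ 2"
  assumes P: "pos_semidef P" and Q: "pos_semidef Q" and eq: "P ** P = Q ** Q"
  shows "P = Q"
proof -
  obtain a c b where p: "P $ 1 $ 1 = of_real a" "P $ 2 $ 2 = of_real c" "P $ 1 $ 2 = b" "P $ 2 $ 1 = cnj b"
    "0 \<le> a" "0 \<le> c" "(cmod b)\<^sup>2 \<le> a * c"
    using pos_semidef_2[OF P] by blast
  obtain a' c' b' where q: "Q $ 1 $ 1 = of_real a'" "Q $ 2 $ 2 = of_real c'" "Q $ 1 $ 2 = b'" "Q $ 2 $ 1 = cnj b'"
    "0 \<le> a'" "0 \<le> c'" "(cmod b')\<^sup>2 \<le> a' * c'"
    using pos_semidef_2[OF Q] by blast
  have e: "(P ** P) $ i $ j = (Q ** Q) $ i $ j" for i j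
    using eq by simp
  have bb: "z * cnj z = of_real ((cmod z)\<^sup>2)" "cnj z * z = of_real ((cmod z)\<^sup>2)" for z
    using complex_norm_square[of z] by (simp_all add: mult.commute)
  have "complex_of_real (a\<^sup>2 + (cmod b)\<^sup>2) = of_real (a'\<^sup>2 + (cmod b')\<^sup>2)"
    using e[of 1 1] by (simp add: matrix_mult_entry_2 p q bb power2_eq_square)
  then have e11: "a\<^sup>2 + (cmod b)\<^sup>2 = a'\<^sup>2 + (cmod b')\<^sup>2"
    by (simp only: of_real_eq_iff)
  have "complex_of_real (c\<^sup>2 + (cmod b)\<^sup>2) = of_real (c'\<^sup>2 + (cmod b')\<^sup>2)"
    using e[of 2 2] by (simp add: matrix_mult_entry_2 p q bb power2_eq_square add.commute)
  then have e22: "c\<^sup>2 + (cmod b)\<^sup>2 = c'\<^sup>2 + (cmod b')\<^sup>2"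
    by (simp only: of_real_eq_iff)
  have e12: "of_real (a + c) * b = of_real (a' + c') * b'"
    using e[of 1 2] by (simp add: matrix_mult_entry_2 p q algebra_simps)
  have n12: "(a + c)\<^sup>2 * (cmod b)\<^sup>2 = (a' + c')\<^sup>2 * (cmod b')\<^sup>2"
    using arg_cong[OF e12, of "\<lambda>z. (cmod z)\<^sup>2"] by (simp add: norm_mult power_mult_distrib del: of_real_add)
  have "(a * c - (cmod b)\<^sup>2)\<^sup>2 = (a\<^sup>2 + (cmod b)\<^sup>2) * (c\<^sup>2 + (cmod b)\<^sup>2) - (a + c)\<^sup>2 * (cmod b)\<^sup>2"
    by (simp add: power2_eq_square algebra_simps)
  also have "\<dots> = (a'\<^sup>2 + (cmod b')\<^sup>2) * (c'\<^sup>2 + (cmod b')\<^sup>2) - (a' + c')\<^sup>2 * (cmod b')\<^sup>2"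
    by (simp only: e11 e22 n12)
  also have "\<dots> = (a' * c' - (cmod b')\<^sup>2)\<^sup>2"
    by (simp add: power2_eq_square algebra_simps)
  finally have "(a * c - (cmod b)\<^sup>2)\<^sup>2 = (a' * c' - (cmod b')\<^sup>2)\<^sup>2" .
  then have det: "a * c - (cmod b)\<^sup>2 = a' * c' - (cmod b')\<^sup>2"
    by (rule real_eq_of_sq[rotated 2]) (use p(7) q(7) in linarith)+
  have "(a + c)\<^sup>2 = (a' + c')\<^sup>2"
    using e11 e22 det by (simp add: power2_sum)
  then have tr: "a + c = a' + c'"
    by (rule real_eq_of_sq[rotated 2]) (use p(5,6) q(5,6) in linarith)+
  have "a = a' \<and> c = c' \<and> b = b'"
  proof (cases "a + c = 0")
    case True
    then have "a = 0" "c = 0" "a' = 0" "c' = 0"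
      using p q tr by linarith+
    then show ?thesis
      using p(7) q(7) by simp
  next
    case False
    then have "b = b'"
      using e12 unfolding tr[symmetric] by (simp del: of_real_add)
    then have "a\<^sup>2 = a'\<^sup>2" "c\<^sup>2 = c'\<^sup>2"
      using e11 e22 by auto
    then show ?thesis
      using \<open>b = b'\<close> real_eq_of_sq[OF p(5) q(5)] real_eq_of_sq[OF p(6) q(6)] by simp
  qed
  then show ?thesis
    using p q by (simp add: vec_eq_iff forall_2)
qed

lemma matrix_abs_i_square:
  fixes W :: "complex ^ 2 ^ 2"
  assumes W: "hermitian W"
  shows "matrix_abs (map_matrix (\<lambda>w. \<i> * w) (W ** W)) = W ** W"
proof -
  let ?V = "map_matrix (\<lambda>w. \<i> * w) (W ** W)"
  have psd: "pos_semidef (W ** W)"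
    unfolding pos_semidef_def
  proof (intro conjI allI)
    have "cnj (W $ i $ j) = W $ j $ i" for i j
      by (rule hermitian_entry[OF W, symmetric])
    then show "hermitian (W ** W)"
      unfolding hermitian_def ctranspose_def
      by (simp add: vec_eq_iff matrix_mult_entry_2 mult.commute)
    fix v :: "complex ^ 2"
    have cc: "cnj (W $ i $ j) = W $ j $ i" for i j
      by (rule hermitian_entry[OF W, symmetric])
    have "(\<Sum>i\<in>UNIV. cnj (v $ i) * (W ** W *v v) $ i) = (\<Sum>i\<in>UNIV. cnj ((W *v v) $ i) * (W *v v) $ i)"
      by (simp add: sum_2 matrix_vector_entry_2 matrix_mult_entry_2 cc algebra_simps)
    also have "Re \<dots> \<ge> 0"
      by (simp add: sum_2)
    finally show "0 \<le> Re (\<Sum>i\<in>UNIV. cnj (v $ i) * (W ** W *v v) $ i)" .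
  qed
  have "M ** M = ctranspose (map_matrix (\<lambda>w. \<i> * w) M) ** map_matrix (\<lambda>w. \<i> * w) M"
    if "hermitian M" for M :: "complex ^ 2 ^ 2"
  proof -
    have "cnj (M $ i $ j) = M $ j $ i" for i j
      by (rule hermitian_entry[OF that, symmetric])
    moreover have "\<i> * x * (\<i> * y) = - (x * y)" for x y
    proof -
      have "\<i> * x * (\<i> * y) = (\<i> * \<i>) * (x * y)"
        by (simp only: mult_ac)
      then show ?thesis by simp
    qed
    ultimately show ?thesis
      by (simp add: vec_eq_iff matrix_mult_entry_2 ctranspose_def map_matrix_def)
  qed
  from this[of "W ** W"] have sq: "(W ** W) ** (W ** W) = ctranspose ?V ** ?V"
    using psd by (simp add: pos_semidef_def)
  show ?thesis
    unfolding matrix_abs_def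
    by (rule the_equality) (use psd sq pos_semidef_sqrt_unique_2[OF _ psd] in auto)
qed

lemma trace_square_hermitian_2:
  fixes W :: "complex ^ 2 ^ 2"
  assumes W: "hermitian W"
  shows "Re (trace (W ** W)) = (\<Sum>i\<in>UNIV. \<Sum>j\<in>UNIV. (cmod (W $ i $ j))\<^sup>2)"
proof -
  have cc: "W $ j $ i = cnj (W $ i $ j)" for i j
    using hermitian_entry[OF W, of j i] .
  have "W $ i $ j * W $ j $ i = of_real ((cmod (W $ i $ j))\<^sup>2)" for i j
    using complex_norm_square[of "W $ i $ j"] cc[of j i] by simp
  then show ?thesis
    by (simp add: trace_def sum_2 matrix_mult_entry_2 del: of_real_power)
qed

section \<open>Fourier transforms of truncated functions\<close>

text \<open>Optimising over \<open>\<delta>\<close> turns Young's inequality into the Cauchy--Schwarz inequality. For \<open>a = 0\<close> there is no optimal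
\<open>\<delta>\<close>, but letting \<open>\<delta>\<close> grow shows that \<open>x = 0\<close>.\<close>

lemma sq_le_of_young:
  fixes x a b :: real
  assumes x: "0 \<le> x" and a: "0 \<le> a" and b: "0 \<le> b"
    and young: "\<And>\<delta>. 0 < \<delta> \<Longrightarrow> x \<le> \<delta> / 2 * a + 1 / (2 * \<delta>) * b"
  shows "x\<^sup>2 \<le> a * b"
proof (cases "x = 0")
  case True
  then show ?thesis using a b by simp
next
  case False
  then have x: "0 < x" using x by simp
  have "x \<le> x / 2 + a * b / (2 * x) \<or> x \<le> 0" if "0 < a"
  proof -
    have "x \<le> (x / a) / 2 * a + 1 / (2 * (x / a)) * b"
      by (rule young) (use x that in simp)
    then show ?thesis using that x by (simp add: field_simps)
  qed
  moreover have "0 < a"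
  proof (rule ccontr)
    assume "\<not> 0 < a"
    then have "a = 0" using a by simp
    have "x \<le> 1 / (2 * (b / x + 1)) * b"
      using young[of "b / x + 1"] x b \<open>a = 0\<close> by (simp add: add_nonneg_pos)
    also have "\<dots> \<le> x / 2"
      using x b by (simp add: field_simps)
    finally show False using x by simp
  qed
  ultimately have "x / 2 \<le> a * b / (2 * x)"
    using x by linarith
  then show ?thesis
    using x by (simp add: field_simps power2_eq_square)
qed

lemma integral_Cauchy_Schwarz:
  assumes "square_integrable a" "square_integrable b"
  shows "(cmod (l2_inner a b))\<^sup>2 \<le> (square_integral a) * (square_integral b)"
proof (rule sq_le_of_young)
  show "cmod (l2_inner a b)
    \<le> \<delta> / 2 * (square_integral a) + 1 / (2 * \<delta>) * (square_integral b)"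
    if "0 < \<delta>" for \<delta>
    by (rule square_integrable_product(2)[OF assms that])
qed simp_all

lemma square_integrable_cnj:
  assumes "square_integrable f"
  shows "square_integrable (\<lambda>x. cnj (f x))"
  using assms by (auto simp: square_integrable_def)

lemma square_integrable_modulated:
  assumes "square_integrable f"
  shows "square_integrable (\<lambda>x. cis (\<xi> \<bullet> x) * f x)"
proof -
  have [measurable]: "f \<in> borel_measurable borel" "(\<lambda>x. cis (\<xi> \<bullet> x)) \<in> borel_measurable borel"
    by (auto intro!: square_integrableD(1)[OF assms] borel_measurable_continuous_onI continuous_intros)
  show ?thesis
    using assms by (simp add: square_integrable_def norm_mult)
qed

lemma square_integrable_mult_integrable:
  assumes "square_integrable f" "square_integrable g"
  shows "integrable lborel (\<lambda>x. f x * g x)"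
  using square_integrable_product(1)[OF square_integrable_cnj[OF assms(1)] assms(2)] by simp

lemma fourier_product_bound:
  assumes f: "square_integrable f" and g: "square_integrable g"
  shows "(cmod (fourier (\<lambda>x. f x * g x) \<xi>))\<^sup>2 \<le> (square_integral f) * (square_integral g)"
proof -
  have c: "cnj (cis (\<xi> \<bullet> x)) = cis (- (\<xi> \<bullet> x))" for x
    by (simp add: complex_eq_iff)
  have "fourier (\<lambda>x. f x * g x) \<xi> = (\<integral>x. cnj (cis (\<xi> \<bullet> x) * cnj (f x)) * g x \<partial>lborel)"
    unfolding fourier_def complex_cnj_mult c complex_cnj_cnj by (simp add: mult.assoc)
  then show ?thesis
    using integral_Cauchy_Schwarz[OF square_integrable_modulated[OF square_integrable_cnj[OF f]] g, of \<xi>]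
    by (simp add: norm_mult)
qed

lemma sq_add_le:
  fixes x y a b c d :: real
  assumes "x\<^sup>2 \<le> a * b" "y\<^sup>2 \<le> c * d" "0 \<le> x" "0 \<le> y" "0 \<le> a" "0 \<le> b" "0 \<le> c" "0 \<le> d"
  shows "(x + y)\<^sup>2 \<le> (a + c) * (b + d)"
proof -
  have "(2 * (x * y))\<^sup>2 = 4 * (x\<^sup>2 * y\<^sup>2)"
    by (simp add: power_mult_distrib)
  also have "\<dots> \<le> 4 * ((a * b) * (c * d))"
    using assms by (intro mult_left_mono mult_mono) auto
  also have "\<dots> = 4 * ((a * d) * (c * b))"
    by (simp add: mult_ac)
  also have "\<dots> \<le> (a * d + c * b)\<^sup>2"
  proof -
    have "4 * (p * q) \<le> (p + q)\<^sup>2" for p q :: real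
      using sum_squares_bound[of p q] by (simp add: power2_sum)
    then show ?thesis .
  qed
  finally have "2 * (x * y) \<le> a * d + c * b"
    by (rule power2_le_imp_le) (use assms in auto)
  then show ?thesis
    using assms by (simp add: power2_sum algebra_simps)
qed

abbreviation cut_fourier :: "nat \<Rightarrow> (real ^ 2 \<Rightarrow> complex) \<Rightarrow> real ^ 2 \<Rightarrow> complex" where
  "cut_fourier n f \<equiv> fourier (\<lambda>x. of_real (cutoff n x) * f x)"

lemma continuous_on_cutoff: "continuous_on UNIV (cutoff n)"
  unfolding cutoff_def[abs_def]
  by (intro continuous_intros continuous_on_compose2[OF continuous_on_bump(1)]) auto

lemma cutoff_tendsto: "(\<lambda>n. cutoff n x) \<longlonglongrightarrow> 1"
proof -
  have "(\<lambda>n. bump (y / real (Suc n))) \<longlonglongrightarrow> bump 0" for y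
  proof (rule isCont_tendsto_compose[where g=bump])
    show "isCont bump 0"
      using continuous_on_bump(1) by (simp add: continuous_on_eq_continuous_at)
    show "(\<lambda>n. y / real (Suc n)) \<longlonglongrightarrow> 0"
      using tendsto_mult[OF tendsto_const[of y] LIMSEQ_inverse_real_of_nat] by (simp add: divide_inverse)
  qed
  then have "(\<lambda>n. cutoff n x) \<longlonglongrightarrow> bump 0 * bump 0"
    unfolding cutoff_def by (intro tendsto_mult)
  then show ?thesis by (simp add: bump_0)
qed

lemma cutoff_bounded: "\<exists>M. \<forall>n x. \<bar>cutoff n x\<bar> \<le> M"
proof -
  obtain M where "0 \<le> M" "\<forall>t. \<bar>bump t\<bar> \<le> M"
    using bump_bounded by blast
  then have "\<bar>cutoff n x\<bar> \<le> M * M" for n x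
    unfolding cutoff_def abs_mult by (intro mult_mono) auto
  then show ?thesis by blast
qed

lemma cutoff_integrable:
  assumes "square_integrable f"
  shows "integrable lborel (\<lambda>x. of_real (cutoff n x) * f x)"
proof (rule square_integrable_mult_integrable[OF _ assms])
  obtain M where M: "\<And>x. \<bar>cutoff n x\<bar> \<le> M"
    using cutoff_bounded by blast
  have [measurable]: "cutoff n \<in> borel_measurable borel"
    by (rule borel_measurable_continuous_onI[OF continuous_on_cutoff])
  have pt: "\<bar>cutoff n x\<bar>\<^sup>2 \<le> M\<^sup>2 * indicat_real (cball 0 (2 * real (Suc n))) x" for x
  proof (cases "cutoff n x = 0")
    case False
    then show ?thesis
      using cutoff_support[OF False] power_mono[OF M[of x] abs_ge_zero, of 2] by (simp del: of_nat_Suc)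
  qed simp
  have "integrable lborel (\<lambda>x. \<bar>cutoff n x\<bar>\<^sup>2)"
    by (rule Bochner_Integration.integrable_bound[OF integrable_indicator_cball])
      (measurable, intro AE_I2, unfold real_norm_def abs_power2, unfold power2_abs, rule order_trans[OF _ abs_ge_self],
       rule pt[unfolded power2_abs])
  then show "square_integrable (\<lambda>x. complex_of_real (cutoff n x))"
    by (simp add: square_integrable_def)
qed

lemma cutoff_fourier_tendsto:
  assumes f: "integrable lborel f"
  shows "(\<lambda>n. cut_fourier n f \<xi>) \<longlonglongrightarrow> fourier f \<xi>"
    and "\<exists>K. \<forall>n \<xi>. cmod (cut_fourier n f \<xi>) \<le> K"
proof -
  obtain M where M: "\<And>n x. \<bar>cutoff n x\<bar> \<le> M"
    using cutoff_bounded by blast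
  have [measurable]: "cutoff n \<in> borel_measurable borel" "f \<in> borel_measurable borel" for n
    using borel_measurable_integrable[OF f] by (auto intro: borel_measurable_continuous_onI[OF continuous_on_cutoff])
  have [measurable]: "(\<lambda>x. cis (- (\<xi> \<bullet> x))) \<in> borel_measurable borel" for \<xi> :: "real ^ 2"
    by (intro borel_measurable_continuous_onI continuous_intros)
  have dom: "integrable lborel (\<lambda>x. M * cmod (f x))"
    using f by (intro integrable_mult_right integrable_norm)
  have le: "norm (cis (- (\<xi> \<bullet> x)) * (of_real (cutoff n x) * f x)) \<le> M * cmod (f x)" for \<xi> x n
    using mult_right_mono[OF M[of n x] norm_ge_zero[of "f x"]] by (simp add: norm_mult)
  show "(\<lambda>n. cut_fourier n f \<xi>) \<longlonglongrightarrow> fourier f \<xi>"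
    unfolding fourier_def
  proof (rule integral_dominated_convergence[OF _ _ dom])
    have "(\<lambda>n. cis (- (\<xi> \<bullet> x)) * (of_real (cutoff n x) * f x)) \<longlonglongrightarrow> cis (- (\<xi> \<bullet> x)) * (of_real 1 * f x)" for x
      by (intro tendsto_mult tendsto_const tendsto_of_real cutoff_tendsto)
    then show "AE x in lborel. (\<lambda>n. cis (- (\<xi> \<bullet> x)) * (of_real (cutoff n x) * f x)) \<longlonglongrightarrow> cis (- (\<xi> \<bullet> x)) * f x"
      by simp
    show "AE x in lborel. norm (cis (- (\<xi> \<bullet> x)) * (of_real (cutoff n x) * f x)) \<le> M * cmod (f x)" for n
      using le by (intro AE_I2)
  qed measurable
  have "cmod (cut_fourier n f \<xi>) \<le> (\<integral>x. M * cmod (f x) \<partial>lborel)" for n \<xi>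
    unfolding fourier_def
  proof (rule order_trans[OF integral_norm_bound], rule integral_mono[OF _ dom le])
    show "integrable lborel (\<lambda>x. norm (cis (- (\<xi> \<bullet> x)) * (of_real (cutoff n x) * f x)))"
      by (rule Bochner_Integration.integrable_bound[OF dom])
        (measurable, intro AE_I2, unfold real_norm_def abs_norm_cancel, rule order_trans[OF le abs_ge_self])
  qed
  then show "\<exists>K. \<forall>n \<xi>. cmod (cut_fourier n f \<xi>) \<le> K"
    by blast
qed

section \<open>The symbol of the free resolvent\<close>

text \<open>The plane of frequencies is identified with the complex plane: the operator \<open>4 \<partial>\<^sub>z\<^sup>2\<close> acts on the wave
with frequency \<open>\<xi>\<close> as multiplication by \<open>- (frequency \<xi>)\<^sup>2\<close>, and the other off-diagonal entry of the
free operator as multiplication by the complex conjugate.\<close>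

definition frequency :: "real ^ 2 \<Rightarrow> complex" where
  "frequency \<xi> = of_real (\<xi> $ 1) + \<i> * of_real (\<xi> $ 2)"

lemma cmod_frequency: "(cmod (frequency \<xi>))\<^sup>2 = (norm \<xi>)\<^sup>2"
  by (simp add: frequency_def cmod_power2 norm_vec_def L2_set_def sum_2)

definition symbol_det :: "complex \<Rightarrow> real ^ 2 \<Rightarrow> complex" where
  "symbol_det \<mu> \<xi> = of_real (((norm \<xi>)\<^sup>2)\<^sup>2) - \<mu>\<^sup>2"

lemma symbol_det_eq: "symbol_det \<mu> \<xi> = (frequency \<xi>)\<^sup>2 * (cnj (frequency \<xi>))\<^sup>2 - \<mu>\<^sup>2"
proof -
  have "frequency \<xi> * cnj (frequency \<xi>) = of_real ((norm \<xi>)\<^sup>2)"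
    using complex_norm_square[of "frequency \<xi>"] cmod_frequency[of \<xi>] by (simp flip: of_real_power)
  then show ?thesis
    unfolding symbol_det_def power_mult_distrib[symmetric] by simp
qed

lemma symbol_det_lower_bound:
  assumes "0 < Im \<mu>"
  shows "(Im \<mu>)\<^sup>2 \<le> cmod (symbol_det \<mu> \<xi>)"
proof -
  let ?s = "(norm \<xi>)\<^sup>2"
  have "symbol_det \<mu> \<xi> = (of_real ?s - \<mu>) * (of_real ?s + \<mu>)"
    by (simp add: symbol_det_def power2_eq_square algebra_simps)
  moreover have "Im \<mu> \<le> cmod (of_real ?s - \<mu>)" "Im \<mu> \<le> cmod (of_real ?s + \<mu>)"
    using abs_Im_le_cmod[of "of_real ?s - \<mu>"] abs_Im_le_cmod[of "of_real ?s + \<mu>"] assms by auto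
  ultimately show ?thesis
    using assms by (simp add: norm_mult power2_eq_square mult_mono)
qed

text \<open>The two components of \<open>(D\<^sub>m(\<xi>) - k)\<^sup>-\<^sup>1 (F, G)\<close> by Cramer's rule, where \<open>D\<^sub>m(\<xi>)\<close> is the Hermitian matrix symbol of
the free operator. The determinant vanishes only where \<open>|\<xi>|\<^sup>4 = \<mu>\<^sup>2\<close>, that is nowhere if \<open>Im \<mu> > 0\<close>.\<close>

definition resolvent1 :: "complex \<Rightarrow> real \<Rightarrow> complex \<Rightarrow> real ^ 2 \<Rightarrow> complex \<Rightarrow> complex \<Rightarrow> complex" where
  "resolvent1 k m \<mu> \<xi> F G = ((k + of_real m) * F - (cnj (frequency \<xi>))\<^sup>2 * G) / symbol_det \<mu> \<xi>"

definition resolvent2 :: "complex \<Rightarrow> real \<Rightarrow> complex \<Rightarrow> real ^ 2 \<Rightarrow> complex \<Rightarrow> complex \<Rightarrow> complex" where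
  "resolvent2 k m \<mu> \<xi> F G = ((k - of_real m) * G - (frequency \<xi>)\<^sup>2 * F) / symbol_det \<mu> \<xi>"

context
  fixes k \<mu> :: complex and m :: real
  assumes \<mu>: "\<mu>\<^sup>2 = k\<^sup>2 - (of_real m)\<^sup>2" and Im\<mu>: "0 < Im \<mu>"
begin

lemma symbol_det_nonzero: "symbol_det \<mu> \<xi> \<noteq> 0"
  using symbol_det_lower_bound[OF Im\<mu>, of \<xi>] Im\<mu> by auto

lemma resolvent_unique:
  assumes "F = (of_real m - k) * a - (cnj (frequency \<xi>))\<^sup>2 * b"
    and "G = - (frequency \<xi>)\<^sup>2 * a - (of_real m + k) * b"
  shows "a = resolvent1 k m \<mu> \<xi> F G" "b = resolvent2 k m \<mu> \<xi> F G"
proof -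
  have "(k + of_real m) * F - (cnj (frequency \<xi>))\<^sup>2 * G = symbol_det \<mu> \<xi> * a"
    unfolding symbol_det_eq \<mu> assms by (simp add: algebra_simps power2_eq_square)
  then show "a = resolvent1 k m \<mu> \<xi> F G"
    using symbol_det_nonzero[of \<xi>] by (simp add: resolvent1_def)
  have "(k - of_real m) * G - (frequency \<xi>)\<^sup>2 * F = symbol_det \<mu> \<xi> * b"
    unfolding symbol_det_eq \<mu> assms by (simp add: algebra_simps power2_eq_square)
  then show "b = resolvent2 k m \<mu> \<xi> F G"
    using symbol_det_nonzero[of \<xi>] by (simp add: resolvent2_def)
qed

lemma resolvent_solves:
  "F = (of_real m - k) * resolvent1 k m \<mu> \<xi> F G - (cnj (frequency \<xi>))\<^sup>2 * resolvent2 k m \<mu> \<xi> F G" (is ?A)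
  "G = - (frequency \<xi>)\<^sup>2 * resolvent1 k m \<mu> \<xi> F G - (of_real m + k) * resolvent2 k m \<mu> \<xi> F G" (is ?B)
proof -
  let ?D = "symbol_det \<mu> \<xi>"
  have "(of_real m - k) * ((k + of_real m) * F - (cnj (frequency \<xi>))\<^sup>2 * G)
      - (cnj (frequency \<xi>))\<^sup>2 * ((k - of_real m) * G - (frequency \<xi>)\<^sup>2 * F) = ?D * F"
    unfolding symbol_det_eq \<mu> by (simp add: algebra_simps power2_eq_square)
  then show ?A
    unfolding resolvent1_def resolvent2_def times_divide_eq_right diff_divide_distrib[symmetric]
    using symbol_det_nonzero[of \<xi>] by (simp only:) simp
  have "- (frequency \<xi>)\<^sup>2 * ((k + of_real m) * F - (cnj (frequency \<xi>))\<^sup>2 * G)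
      - (of_real m + k) * ((k - of_real m) * G - (frequency \<xi>)\<^sup>2 * F) = ?D * G"
    unfolding symbol_det_eq \<mu> by (simp add: algebra_simps power2_eq_square)
  then show ?B
    unfolding resolvent1_def resolvent2_def times_divide_eq_right diff_divide_distrib[symmetric]
    using symbol_det_nonzero[of \<xi>] by (simp only:) simp
qed

text \<open>The symbol \<open>D\<^sub>m(\<xi>)\<close> is Hermitian and \<open>(F, G) = (D\<^sub>m(\<xi>) - k) (a, b)\<close>, so only the spectral parameter contributes to the
imaginary part of the quadratic form.\<close>

lemma resolvent_dissipation:
  fixes F G :: complex and \<xi> :: "real ^ 2"
  defines "a \<equiv> resolvent1 k m \<mu> \<xi> F G" and "b \<equiv> resolvent2 k m \<mu> \<xi> F G"
  shows "Re (\<i> * (cnj a * F + cnj b * G)) = Im k * ((cmod a)\<^sup>2 + (cmod b)\<^sup>2)"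
proof -
  have F: "F = (of_real m - k) * a - (cnj (frequency \<xi>))\<^sup>2 * b" and G: "G = - (frequency \<xi>)\<^sup>2 * a - (of_real m + k) * b"
    unfolding a_def b_def by (rule resolvent_solves)+
  define z where "z = (frequency \<xi>)\<^sup>2"
  have z: "(cnj (frequency \<xi>))\<^sup>2 = cnj z"
    by (simp add: z_def)
  show ?thesis
    unfolding F G z z_def[symmetric] cmod_power2 by (simp add: algebra_simps power2_eq_square)
qed

text \<open>The factor 2 is the price for estimating the cross terms between the two components of the source.\<close>

lemma resolvent_norm_bound:
  "(cmod (resolvent1 k m \<mu> \<xi> F G))\<^sup>2 + (cmod (resolvent2 k m \<mu> \<xi> F G))\<^sup>2
    \<le> 2 * ((((cmod (k + of_real m))\<^sup>2 + ((norm \<xi>)\<^sup>2)\<^sup>2) / (cmod (symbol_det \<mu> \<xi>))\<^sup>2) * (cmod F)\<^sup>2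
      + (((cmod (k - of_real m))\<^sup>2 + ((norm \<xi>)\<^sup>2)\<^sup>2) / (cmod (symbol_det \<mu> \<xi>))\<^sup>2) * (cmod G)\<^sup>2)"
proof -
  let ?s = "(norm \<xi>)\<^sup>2" and ?D = "(cmod (symbol_det \<mu> \<xi>))\<^sup>2"
  have f4: "(cmod ((cnj (frequency \<xi>))\<^sup>2 * x))\<^sup>2 = ?s\<^sup>2 * (cmod x)\<^sup>2" "(cmod ((frequency \<xi>)\<^sup>2 * x))\<^sup>2 = ?s\<^sup>2 * (cmod x)\<^sup>2" for x
    by (simp_all only: norm_mult norm_power complex_mod_cnj cmod_frequency power_mult_distrib)
  have "(cmod (resolvent1 k m \<mu> \<xi> F G))\<^sup>2 \<le> (2 * ((cmod (k + of_real m))\<^sup>2 * (cmod F)\<^sup>2) + 2 * (?s\<^sup>2 * (cmod G)\<^sup>2)) / ?D"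
    using cmod_diff_sq_le[of "(k + of_real m) * F" "(cnj (frequency \<xi>))\<^sup>2 * G"]
    unfolding resolvent1_def norm_divide power_divide f4
    by (intro divide_right_mono) (simp_all add: norm_mult power_mult_distrib)
  moreover have "(cmod (resolvent2 k m \<mu> \<xi> F G))\<^sup>2 \<le> (2 * ((cmod (k - of_real m))\<^sup>2 * (cmod G)\<^sup>2) + 2 * (?s\<^sup>2 * (cmod F)\<^sup>2)) / ?D"
    using cmod_diff_sq_le[of "(k - of_real m) * G" "(frequency \<xi>)\<^sup>2 * F"]
    unfolding resolvent2_def norm_divide power_divide f4
    by (intro divide_right_mono) (simp_all add: norm_mult power_mult_distrib)
  ultimately show ?thesis
    by (simp add: add_divide_distrib algebra_simps)
qed

lemma resolvent_growth:
  assumes F: "cmod F \<le> A * (1 + (norm \<xi>)\<^sup>2)" and G: "cmod G \<le> A * (1 + (norm \<xi>)\<^sup>2)"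
  defines "K \<equiv> 2 * (cmod k + \<bar>m\<bar> + 1) * A / (Im \<mu>)\<^sup>2"
  shows "cmod (resolvent1 k m \<mu> \<xi> F G) \<le> K * (1 + (norm \<xi>)\<^sup>2)\<^sup>2"
    "cmod (resolvent2 k m \<mu> \<xi> F G) \<le> K * (1 + (norm \<xi>)\<^sup>2)\<^sup>2"
proof -
  let ?s = "(norm \<xi>)\<^sup>2" and ?B = "cmod k + \<bar>m\<bar> + 1"
  have main: "cmod ((p * x - q * y) / symbol_det \<mu> \<xi>) \<le> K * (1 + ?s)\<^sup>2"
    if "cmod p \<le> ?B" "cmod q = ?s" "cmod x \<le> A * (1 + ?s)" "cmod y \<le> A * (1 + ?s)" for p q x y
  proof -
    have A: "0 \<le> A * (1 + ?s)"
      using norm_ge_zero[of x] that(3) by linarith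
    have "cmod p \<le> ?B * (1 + ?s)"
      using that(1) mult_left_mono[of 1 "1 + ?s" ?B] by simp
    moreover have "cmod q \<le> ?B * (1 + ?s)"
      using that(2) mult_right_mono[of 1 ?B "1 + ?s"] by simp
    ultimately have "cmod p * cmod x + cmod q * cmod y \<le> ?B * (1 + ?s) * (A * (1 + ?s)) + ?B * (1 + ?s) * (A * (1 + ?s))"
      using A that by (intro add_mono mult_mono) auto
    then have num: "cmod (p * x - q * y) \<le> 2 * ?B * A * (1 + ?s)\<^sup>2"
      using norm_triangle_ineq4[of "p * x" "q * y"] by (simp add: norm_mult power2_eq_square algebra_simps)
    have "cmod ((p * x - q * y) / symbol_det \<mu> \<xi>) \<le> 2 * ?B * A * (1 + ?s)\<^sup>2 / (Im \<mu>)\<^sup>2"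
      unfolding norm_divide
      by (intro frac_le num symbol_det_lower_bound[OF Im\<mu>] order_trans[OF norm_ge_zero num]) (use Im\<mu> in auto)
    then show ?thesis
      by (simp add: K_def mult_ac)
  qed
  have p: "cmod (k + of_real m) \<le> ?B" "cmod (k - of_real m) \<le> ?B"
    using norm_triangle_ineq[of k "of_real m"] norm_triangle_ineq4[of k "of_real m"] by auto
  have q: "cmod ((cnj (frequency \<xi>))\<^sup>2) = ?s" "cmod ((frequency \<xi>)\<^sup>2) = ?s"
    by (simp_all only: norm_power complex_mod_cnj cmod_frequency)
  show "cmod (resolvent1 k m \<mu> \<xi> F G) \<le> K * (1 + ?s)\<^sup>2"
    unfolding resolvent1_def by (rule main[OF p(1) q(1) F G])
  show "cmod (resolvent2 k m \<mu> \<xi> F G) \<le> K * (1 + ?s)\<^sup>2"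
    unfolding resolvent2_def by (rule main[OF p(2) q(2) G F])
qed

lemma resolvent_tendsto:
  assumes "F \<longlonglongrightarrow> F'" "G \<longlonglongrightarrow> G'"
  shows "(\<lambda>n. resolvent1 k m \<mu> \<xi> (F n) (G n)) \<longlonglongrightarrow> resolvent1 k m \<mu> \<xi> F' G'"
    "(\<lambda>n. resolvent2 k m \<mu> \<xi> (F n) (G n)) \<longlonglongrightarrow> resolvent2 k m \<mu> \<xi> F' G'"
  unfolding resolvent1_def resolvent2_def
  by (intro tendsto_intros assms symbol_det_nonzero)+

end

section \<open>The Birman--Schwinger inequality\<close>

lemma cutoff_pairing:
  fixes u b :: "real ^ 2 \<Rightarrow> complex"
  assumes u: "square_integrable u" and b: "square_integrable b" and b1: "integrable lborel b"
    and U_lim: "\<And>\<xi>. (\<lambda>n. cut_fourier n u \<xi>) \<longlonglongrightarrow> U \<xi>"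
    and U_bound: "\<And>n \<xi>. cmod (cut_fourier n u \<xi>) \<le> K * (1 + (norm \<xi>)\<^sup>2)\<^sup>2"
  shows "(\<lambda>n. gauss_pairing n U b)
      \<longlonglongrightarrow> of_real ((2 * pi)\<^sup>2) * (l2_inner u b)"
    and "integrable lborel (\<lambda>\<xi>. of_real (gauss (\<xi> /\<^sub>R real (Suc n))) * (cnj (U \<xi>) * fourier b \<xi>))"
proof -
  obtain M where M: "\<And>n x. \<bar>cutoff n x\<bar> \<le> M"
    using cutoff_bounded by blast
  have c: "cutoff n \<in> borel_measurable borel" for n
    by (rule borel_measurable_continuous_onI[OF continuous_on_cutoff])
  note hyps = u b b1 c M cutoff_tendsto cutoff_integrable[OF u] U_lim U_bound
  show "(\<lambda>n. gauss_pairing n U b)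
      \<longlonglongrightarrow> of_real ((2 * pi)\<^sup>2) * (l2_inner u b)"
    using fourier_limit_pairing_tendsto[OF hyps] by simp
  show "integrable lborel (\<lambda>\<xi>. of_real (gauss (\<xi> /\<^sub>R real (Suc n))) * (cnj (U \<xi>) * fourier b \<xi>))"
    by (rule fourier_limit_integrable[OF hyps]) simp
qed

text \<open>Pairing \<open>u\<close> with its own restriction to a ball makes the inner product the square integral over that ball.\<close>

lemma zero_of_cutoff_fourier_tendsto_zero:
  fixes u :: "real ^ 2 \<Rightarrow> complex"
  assumes u: "square_integrable u"
    and lim: "\<And>\<xi>. (\<lambda>n. cut_fourier n u \<xi>) \<longlonglongrightarrow> 0"
    and bound: "\<And>n \<xi>. cmod (cut_fourier n u \<xi>) \<le> K * (1 + (norm \<xi>)\<^sup>2)\<^sup>2"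
  shows "AE x in lborel. u x = 0"
proof -
  note [measurable] = square_integrableD(1)[OF u]
  have "AE x in lborel. norm x \<le> real N \<longrightarrow> u x = 0" for N
  proof -
    define b where "b x = indicat_real (cball 0 (real N)) x *\<^sub>R u x" for x
    have ind: "square_integrable (\<lambda>x. complex_of_real (indicat_real (cball (0 :: real ^ 2) (real N)) x))"
    proof -
      have "(\<lambda>x. (cmod (complex_of_real (indicat_real (cball (0 :: real ^ 2) (real N)) x)))\<^sup>2) = indicat_real (cball 0 (real N))"
        by (auto simp: indicator_def fun_eq_iff)
      moreover have "integrable lborel (indicat_real (cball (0 :: real ^ 2) (real N)))"
        using emeasure_lborel_cball_finite[of "0 :: real ^ 2" "real N"] by (intro integrable_real_indicator) auto
      ultimately show ?thesis
        by (auto simp: square_integrable_def)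
    qed
    have b1: "integrable lborel b"
      using square_integrable_mult_integrable[OF ind u] by (simp add: b_def[abs_def] scaleR_conv_of_real)
    have [measurable]: "b \<in> borel_measurable borel"
      unfolding b_def[abs_def]
      by (intro borel_measurable_scaleR borel_measurable_indicator square_integrableD(1)[OF u]) auto
    have b: "square_integrable b"
      unfolding square_integrable_def
    proof
      show "integrable lborel (\<lambda>x. (cmod (b x))\<^sup>2)"
        by (rule Bochner_Integration.integrable_bound[OF square_integrableD(2)[OF u]])
          (measurable, auto simp: b_def indicator_def)
    qed measurable
    have "(\<lambda>n. 0) \<longlonglongrightarrow> of_real ((2 * pi)\<^sup>2) * (l2_inner u b)"
      using cutoff_pairing(1)[OF u b b1 lim bound] by simp
    then have "of_real ((2 * pi)\<^sup>2) * (l2_inner u b) = 0"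
      by (rule LIMSEQ_unique[OF _ tendsto_const])
    then have z: "(l2_inner u b) = 0"
      by simp
    have "(\<lambda>x. cnj (u x) * b x) = (\<lambda>x. complex_of_real ((cmod (b x))\<^sup>2))"
    proof
      show "cnj (u x) * b x = complex_of_real ((cmod (b x))\<^sup>2)" for x
        using complex_norm_square[of "u x"] by (simp add: b_def indicator_def mult.commute)
    qed
    with z have "complex_of_real (square_integral b) = 0"
      by (simp del: of_real_power)
    then have "(square_integral b) = 0"
      by (simp only: of_real_eq_0_iff)
    then have "AE x in lborel. (cmod (b x))\<^sup>2 = 0"
      using integral_nonneg_eq_0_iff_AE[OF square_integrableD(2)[OF b]] by simp
    then show ?thesis
      by eventually_elim (auto simp: b_def)
  qed
  then have "AE x in lborel. \<forall>N. norm x \<le> real N \<longrightarrow> u x = 0"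
    unfolding AE_all_countable by blast
  then show ?thesis
    by eventually_elim (meson real_arch_simple)
qed

text \<open>With \<open>v = W u\<close> and \<open>f = - \<i> W v\<close> this is \<open>\<i> \<langle>u, f\<rangle> = \<langle>u, W v\<rangle> = \<langle>W u, v\<rangle> = |v|\<^sup>2\<close>.\<close>

lemma hermitian_energy_identity:
  fixes u v :: "2 \<Rightarrow> complex" and w :: "2 \<Rightarrow> 2 \<Rightarrow> complex"
  assumes herm: "\<And>i j. w j i = cnj (w i j)" and v: "\<And>i. v i = w i 1 * u 1 + w i 2 * u 2"
  shows "\<i> * (cnj (u 1) * (- \<i> * (w 1 1 * v 1 + w 1 2 * v 2)) + cnj (u 2) * (- \<i> * (w 2 1 * v 1 + w 2 2 * v 2)))
    = of_real ((cmod (v 1))\<^sup>2 + (cmod (v 2))\<^sup>2)"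
proof -
  have "\<i> * (y * (- \<i> * z) + y' * (- \<i> * z')) = y * z + y' * z'" for y z y' z'
    by (simp add: algebra_simps)
  then have "\<i> * (cnj (u 1) * (- \<i> * (w 1 1 * v 1 + w 1 2 * v 2)) + cnj (u 2) * (- \<i> * (w 2 1 * v 1 + w 2 2 * v 2)))
      = cnj (u 1) * (w 1 1 * v 1 + w 1 2 * v 2) + cnj (u 2) * (w 2 1 * v 1 + w 2 2 * v 2)" .
  also have "\<dots> = v 1 * cnj (v 1) + v 2 * cnj (v 2)"
  proof -
    have "cnj (w i j) = w j i" for i j
      by (rule herm[symmetric])
    then have "cnj (v i) = w 1 i * cnj (u 1) + w 2 i * cnj (u 2)" for i
      by (simp only: v complex_cnj_add complex_cnj_mult)
    then show ?thesis by (simp add: algebra_simps)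
  qed
  also have "\<dots> = of_real ((cmod (v 1))\<^sup>2 + (cmod (v 2))\<^sup>2)"
    by (simp only: of_real_add complex_norm_square)
  finally show ?thesis .
qed

text \<open>Let \<open>N\<close> be the square norm of \<open>v = W u\<close>. The energy identity expresses \<open>N\<close> as \<open>\<i> \<langle>u, f\<rangle>\<close>, and on the Fourier side, with
\<open>(a, b)\<close> the transform of \<open>u\<close>, the same quantity is \<open>(2 \<pi>)\<^sup>-\<^sup>2\<close> times the integral of \<open>Im k (|a|\<^sup>2 + |b|\<^sup>2)\<close> by dissipation. As
\<open>f = - \<i> W v\<close>, the Cauchy--Schwarz inequality bounds the transforms of \<open>f\<close> pointwise by \<open>A i * N\<close>. The integrated bound on
the resolvent symbol then gives \<open>4 \<pi>\<^sup>2 N \<le> \<pi>\<^sup>2 N (A 1 Re ((k + m) / \<mu>) + A 2 Re ((k - m) / \<mu>))\<close>, and it remains to divide by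
\<open>N\<close>, which is not 0 because otherwise the source \<open>f\<close> and with it \<open>u\<close> would vanish.\<close>

lemma Birman_Schwinger_bound:
  fixes u v f :: "2 \<Rightarrow> real ^ 2 \<Rightarrow> complex" and w :: "2 \<Rightarrow> 2 \<Rightarrow> real ^ 2 \<Rightarrow> complex"
    and k \<mu> :: complex and m :: real
  defines "A \<equiv> \<lambda>i. (square_integral (w i 1)) + (square_integral (w i 2))"
  assumes \<mu>: "\<mu>\<^sup>2 = k\<^sup>2 - (of_real m)\<^sup>2" and Im\<mu>: "0 < Im \<mu>"
    and u: "\<And>j. square_integrable (u j)" and w: "\<And>i j. square_integrable (w i j)"
    and v: "\<And>i. square_integrable (v i)" and f: "\<And>i. square_integrable (f i)"
    and v_eq: "\<And>i x. v i x = w i 1 x * u 1 x + w i 2 x * u 2 x"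
    and f_eq: "\<And>i x. f i x = - \<i> * (w i 1 x * v 1 x + w i 2 x * v 2 x)"
    and herm: "AE x in lborel. \<forall>i j. w j i x = cnj (w i j x)"
    and lim1: "\<And>\<xi>. (\<lambda>n. cut_fourier n (u 1) \<xi>)
      \<longlonglongrightarrow> resolvent1 k m \<mu> \<xi> (fourier (f 1) \<xi>) (fourier (f 2) \<xi>)"
    and lim2: "\<And>\<xi>. (\<lambda>n. cut_fourier n (u 2) \<xi>)
      \<longlonglongrightarrow> resolvent2 k m \<mu> \<xi> (fourier (f 1) \<xi>) (fourier (f 2) \<xi>)"
    and bound: "\<And>j n \<xi>. cmod (cut_fourier n (u j) \<xi>) \<le> K * (1 + (norm \<xi>)\<^sup>2)\<^sup>2"
    and nz: "\<not> (AE x in lborel. u 1 x = 0 \<and> u 2 x = 0)"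
  shows "4 \<le> A 1 * Re ((k + of_real m) / \<mu>) + A 2 * Re ((k - of_real m) / \<mu>)"
proof -
  define N where "N = (square_integral (v 1)) + (square_integral (v 2))"
  define a where "a \<xi> = resolvent1 k m \<mu> \<xi> (fourier (f 1) \<xi>) (fourier (f 2) \<xi>)" for \<xi>
  define b where "b \<xi> = resolvent2 k m \<mu> \<xi> (fourier (f 1) \<xi>) (fourier (f 2) \<xi>)" for \<xi>
  define Q where "Q \<xi> = (cmod (a \<xi>))\<^sup>2 + (cmod (b \<xi>))\<^sup>2" for \<xi>
  have N0: "0 \<le> N" and A0: "0 \<le> A i" for i
    by (auto simp: N_def A_def)
  have wv: "integrable lborel (\<lambda>x. w i j x * v j x)" for i j
    by (rule square_integrable_mult_integrable[OF w v])
  have f_fun: "f i = (\<lambda>x. - \<i> * (w i 1 x * v 1 x + w i 2 x * v 2 x))" for i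
    by (simp add: fun_eq_iff f_eq)
  have f1: "integrable lborel (f i)" for i
    unfolding f_fun by (intro integrable_mult_right Bochner_Integration.integrable_add wv)
  have fhat: "(cmod (fourier (f i) \<xi>))\<^sup>2 \<le> A i * N" for i \<xi>
  proof -
    have "fourier (f i) \<xi> = (\<integral>x. - \<i> * (cis (- (\<xi> \<bullet> x)) * (w i 1 x * v 1 x) + cis (- (\<xi> \<bullet> x)) * (w i 2 x * v 2 x)) \<partial>lborel)"
      unfolding fourier_def f_fun by (simp only: distrib_left mult.left_commute)
    also have "\<dots> = - \<i> * (fourier (\<lambda>x. w i 1 x * v 1 x) \<xi> + fourier (\<lambda>x. w i 2 x * v 2 x) \<xi>)"
      unfolding fourier_def
      by (subst integral_mult_right_zero, subst Bochner_Integration.integral_add)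
        (auto intro!: integrable_fourier_kernel(2) wv)
    finally have "cmod (fourier (f i) \<xi>) \<le> cmod (fourier (\<lambda>x. w i 1 x * v 1 x) \<xi>) + cmod (fourier (\<lambda>x. w i 2 x * v 2 x) \<xi>)"
      by (simp add: norm_mult norm_triangle_ineq)
    then have "(cmod (fourier (f i) \<xi>))\<^sup>2 \<le> (cmod (fourier (\<lambda>x. w i 1 x * v 1 x) \<xi>) + cmod (fourier (\<lambda>x. w i 2 x * v 2 x) \<xi>))\<^sup>2"
      by (intro power_mono) auto
    also have "\<dots> \<le> A i * N"
      unfolding A_def N_def by (rule sq_add_le) (auto intro: fourier_product_bound w v)
    finally show ?thesis .
  qed
  have pair1: "(\<lambda>n. gauss_pairing n a (f 1))
      \<longlonglongrightarrow> of_real ((2 * pi)\<^sup>2) * (l2_inner (u 1) (f 1))"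
    and int1: "integrable lborel (\<lambda>\<xi>. of_real (gauss (\<xi> /\<^sub>R real (Suc n))) * (cnj (a \<xi>) * fourier (f 1) \<xi>))" for n
    unfolding a_def by (rule cutoff_pairing[OF u f f1 lim1 bound])+
  have pair2: "(\<lambda>n. gauss_pairing n b (f 2))
      \<longlonglongrightarrow> of_real ((2 * pi)\<^sup>2) * (l2_inner (u 2) (f 2))"
    and int2: "integrable lborel (\<lambda>\<xi>. of_real (gauss (\<xi> /\<^sub>R real (Suc n))) * (cnj (b \<xi>) * fourier (f 2) \<xi>))" for n
    unfolding b_def by (rule cutoff_pairing[OF u f f1 lim2 bound])+
  have energy: "\<i> * ((l2_inner (u 1) (f 1)) + (l2_inner (u 2) (f 2))) = of_real N"
  proof -
    have "(l2_inner (u 1) (f 1)) + (l2_inner (u 2) (f 2))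
        = (\<integral>x. cnj (u 1 x) * f 1 x + cnj (u 2 x) * f 2 x \<partial>lborel)"
      by (intro Bochner_Integration.integral_add[symmetric] square_integrable_product(1) u f)
    also have "\<i> * \<dots> = (\<integral>x. \<i> * (cnj (u 1 x) * f 1 x + cnj (u 2 x) * f 2 x) \<partial>lborel)"
      by simp
    also have "\<dots> = (\<integral>x. of_real ((cmod (v 1 x))\<^sup>2 + (cmod (v 2 x))\<^sup>2) \<partial>lborel)"
    proof (rule integral_cong_AE)
      have [measurable]: "f i \<in> borel_measurable borel" "v i \<in> borel_measurable borel"
        "u i \<in> borel_measurable borel" for i
        by (auto intro: square_integrableD(1) u f v)
      show "(\<lambda>x. \<i> * (cnj (u 1 x) * f 1 x + cnj (u 2 x) * f 2 x)) \<in> borel_measurable lborel"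
        "(\<lambda>x. complex_of_real ((cmod (v 1 x))\<^sup>2 + (cmod (v 2 x))\<^sup>2)) \<in> borel_measurable lborel"
        by measurable
      show "AE x in lborel. \<i> * (cnj (u 1 x) * f 1 x + cnj (u 2 x) * f 2 x) = of_real ((cmod (v 1 x))\<^sup>2 + (cmod (v 2 x))\<^sup>2)"
        using herm
      proof eventually_elim
        case (elim x)
        show ?case
          unfolding f_eq
          by (rule hermitian_energy_identity[where w="\<lambda>i j. w i j x" and v="\<lambda>i. v i x" and u="\<lambda>i. u i x"])
            (use elim v_eq in blast)+
      qed
    qed
    also have "\<dots> = of_real N"
      unfolding N_def by (simp add: square_integrableD(2)[OF v] del: of_real_add of_real_power)
    finally show ?thesis .
  qed
  \<comment> \<open>Gaussian sums of the dissipated energy; their limit is \<open>4 \<pi>\<^sup>2 N\<close>.\<close>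
  define R where "R n = (\<integral>\<xi>. gauss (\<xi> /\<^sub>R real (Suc n)) * (Im k * Q \<xi>) \<partial>lborel)" for n
  have diss: "Re (\<i> * (of_real g * (cnj (a \<xi>) * fourier (f 1) \<xi>) + of_real g * (cnj (b \<xi>) * fourier (f 2) \<xi>)))
      = g * (Im k * Q \<xi>)" for g \<xi>
  proof -
    have "Re (\<i> * (cnj (a \<xi>) * fourier (f 1) \<xi> + cnj (b \<xi>) * fourier (f 2) \<xi>)) = Im k * Q \<xi>"
      unfolding a_def b_def Q_def by (rule resolvent_dissipation[OF \<mu> Im\<mu>])
    moreover have "\<i> * (of_real g * (cnj (a \<xi>) * fourier (f 1) \<xi>) + of_real g * (cnj (b \<xi>) * fourier (f 2) \<xi>))
        = of_real g * (\<i> * (cnj (a \<xi>) * fourier (f 1) \<xi> + cnj (b \<xi>) * fourier (f 2) \<xi>))"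
      by (simp only: distrib_left mult.left_commute)
    moreover have "Re (of_real g * z) = g * Re z" for z
      by simp
    ultimately show ?thesis
      by (simp only:)
  qed
  let ?I = "\<lambda>n \<xi>. \<i> * (of_real (gauss (\<xi> /\<^sub>R real (Suc n))) * (cnj (a \<xi>) * fourier (f 1) \<xi>)
      + of_real (gauss (\<xi> /\<^sub>R real (Suc n))) * (cnj (b \<xi>) * fourier (f 2) \<xi>))"
  have I_int: "integrable lborel (?I n)" for n
    by (intro integrable_mult_right Bochner_Integration.integrable_add int1 int2)
  have Q_int: "integrable lborel (\<lambda>\<xi>. gauss (\<xi> /\<^sub>R real (Suc n)) * (Im k * Q \<xi>))" for n
    using integrable_Re[OF I_int[of n]] unfolding diss .
  have R_eq: "R n = Re (\<i> * ((gauss_pairing n a (f 1))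
      + (gauss_pairing n b (f 2))))" for n
  proof -
    have "R n = (\<integral>\<xi>. Re (?I n \<xi>) \<partial>lborel)"
      unfolding R_def diss ..
    also have "\<dots> = Re (\<integral>\<xi>. ?I n \<xi> \<partial>lborel)"
      by (rule integral_Re[OF I_int])
    also have "(\<integral>\<xi>. ?I n \<xi> \<partial>lborel) = \<i> * ((gauss_pairing n a (f 1))
      + (gauss_pairing n b (f 2)))"
      by (subst integral_mult_right_zero, subst Bochner_Integration.integral_add[OF int1 int2]) (rule refl)
    finally show ?thesis .
  qed
  have R_lim: "R \<longlonglongrightarrow> (2 * pi)\<^sup>2 * N"
  proof -
    have "R \<longlonglongrightarrow> Re (\<i> * (of_real ((2 * pi)\<^sup>2) * (l2_inner (u 1) (f 1))
        + of_real ((2 * pi)\<^sup>2) * (l2_inner (u 2) (f 2))))"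
      unfolding R_eq[abs_def] by (intro tendsto_Re tendsto_mult tendsto_const tendsto_add pair1 pair2)
    also have "\<i> * (of_real ((2 * pi)\<^sup>2) * (l2_inner (u 1) (f 1))
        + of_real ((2 * pi)\<^sup>2) * (l2_inner (u 2) (f 2)))
      = of_real ((2 * pi)\<^sup>2) * (\<i> * ((l2_inner (u 1) (f 1)) + (l2_inner (u 2) (f 2))))"
      by (simp only: distrib_left mult.left_commute)
    also have "\<dots> = of_real ((2 * pi)\<^sup>2 * N)"
      unfolding energy by simp
    finally show ?thesis by simp
  qed
  have N_pos: "0 < N"
  proof (rule ccontr)
    assume "\<not> 0 < N"
    then have "N = 0" using N0 by simp
    have fourier0: "fourier (f i) \<xi> = 0" for i \<xi>
      using fhat[of i \<xi>] \<open>N = 0\<close> by simp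
    then have "resolvent1 k m \<mu> \<xi> (fourier (f 1) \<xi>) (fourier (f 2) \<xi>) = 0"
      "resolvent2 k m \<mu> \<xi> (fourier (f 1) \<xi>) (fourier (f 2) \<xi>) = 0" for \<xi>
      by (simp_all add: resolvent1_def resolvent2_def)
    then have "AE x in lborel. u 1 x = 0" "AE x in lborel. u 2 x = 0"
      using zero_of_cutoff_fourier_tendsto_zero[OF u _ bound] lim1 lim2 by simp_all
    then show False using nz by simp
  qed
  \<comment> \<open>Every \<open>R n\<close> is \<open>Im k\<close> times a nonnegative number, and the limit of these sums is positive.\<close>
  have k_pos: "0 < Im k"
  proof (rule ccontr)
    assume "\<not> 0 < Im k"
    have "R n \<le> 0" for n
    proof -
      have "0 \<le> (\<integral>\<xi>. gauss (\<xi> /\<^sub>R real (Suc n)) * (- Im k * Q \<xi>) \<partial>lborel)"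
        using \<open>\<not> 0 < Im k\<close>
        by (intro integral_nonneg_AE AE_I2 mult_nonneg_nonneg less_imp_le[OF gauss_pos]) (auto simp: Q_def)
      also have "\<dots> = - R n"
        by (simp add: R_def)
      finally show ?thesis by simp
    qed
    then have "(2 * pi)\<^sup>2 * N \<le> 0"
      by (intro LIMSEQ_le_const2[OF R_lim]) auto
    with N_pos show False
      by (simp add: mult_le_0_iff)
  qed
  define g where "g p \<xi> = Im k * ((cmod p)\<^sup>2 + ((norm \<xi>)\<^sup>2)\<^sup>2) / (cmod (of_real (((norm \<xi>)\<^sup>2)\<^sup>2) - \<mu>\<^sup>2))\<^sup>2" for p :: complex and \<xi> :: "real ^ 2"
  have g0: "0 \<le> g p \<xi>" for p \<xi>
    using k_pos by (simp add: g_def)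
  have g_meas [measurable]: "g p \<in> borel_measurable borel" for p
    unfolding g_def[abs_def] by measurable
  \<comment> \<open>Replacing \<open>m\<close> by \<open>- m\<close> exchanges the two factors of \<open>\<mu>\<^sup>2 = (k + m) (k - m)\<close>.\<close>
  have G: "(\<integral>\<^sup>+ \<xi>. ennreal (g (k + of_real m) \<xi>) \<partial>lborel) = ennreal (pi\<^sup>2 / 2 * Re ((k + of_real m) / \<mu>))"
    "(\<integral>\<^sup>+ \<xi>. ennreal (g (k - of_real m) \<xi>) \<partial>lborel) = ennreal (pi\<^sup>2 / 2 * Re ((k - of_real m) / \<mu>))"
    unfolding g_def using resolvent_plane_integral[OF \<mu> refl Im\<mu>] resolvent_plane_integral[of \<mu> k "- m" "k - of_real m"] \<mu> Im\<mu> k_pos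
    by simp_all
  have Q_le: "Im k * Q \<xi> \<le> 2 * N * A 1 * g (k + of_real m) \<xi> + 2 * N * A 2 * g (k - of_real m) \<xi>" for \<xi>
  proof -
    have "Q \<xi> \<le> 2 * ((((cmod (k + of_real m))\<^sup>2 + ((norm \<xi>)\<^sup>2)\<^sup>2) / (cmod (symbol_det \<mu> \<xi>))\<^sup>2) * (cmod (fourier (f 1) \<xi>))\<^sup>2
      + (((cmod (k - of_real m))\<^sup>2 + ((norm \<xi>)\<^sup>2)\<^sup>2) / (cmod (symbol_det \<mu> \<xi>))\<^sup>2) * (cmod (fourier (f 2) \<xi>))\<^sup>2)"
      unfolding Q_def a_def b_def by (rule resolvent_norm_bound[OF \<mu> Im\<mu>])
    also have "\<dots> \<le> 2 * ((((cmod (k + of_real m))\<^sup>2 + ((norm \<xi>)\<^sup>2)\<^sup>2) / (cmod (symbol_det \<mu> \<xi>))\<^sup>2) * (A 1 * N)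
      + (((cmod (k - of_real m))\<^sup>2 + ((norm \<xi>)\<^sup>2)\<^sup>2) / (cmod (symbol_det \<mu> \<xi>))\<^sup>2) * (A 2 * N))"
      by (intro mult_left_mono add_mono fhat) auto
    finally have "Im k * Q \<xi> \<le> Im k * (2 * ((((cmod (k + of_real m))\<^sup>2 + ((norm \<xi>)\<^sup>2)\<^sup>2) / (cmod (symbol_det \<mu> \<xi>))\<^sup>2) * (A 1 * N)
      + (((cmod (k - of_real m))\<^sup>2 + ((norm \<xi>)\<^sup>2)\<^sup>2) / (cmod (symbol_det \<mu> \<xi>))\<^sup>2) * (A 2 * N)))"
      using k_pos by (intro mult_left_mono) auto
    also have "\<dots> = 2 * N * A 1 * g (k + of_real m) \<xi> + 2 * N * A 2 * g (k - of_real m) \<xi>"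
      unfolding g_def symbol_det_def by (simp add: distrib_left mult_ac)
    finally show ?thesis .
  qed
  have Re0: "0 \<le> Re ((k + of_real m) / \<mu>)" "0 \<le> Re ((k - of_real m) / \<mu>)"
    using resolvent_line_integral(2)[OF \<mu> refl Im\<mu>] resolvent_line_integral(2)[of \<mu> k "- m" "k - of_real m"] \<mu> Im\<mu> k_pos
    by simp_all
  have R_le: "R n \<le> pi\<^sup>2 * N * (A 1 * Re ((k + of_real m) / \<mu>) + A 2 * Re ((k - of_real m) / \<mu>))" for n
  proof -
    have Q0: "0 \<le> Im k * Q \<xi>" for \<xi>
      using k_pos by (simp add: Q_def)
    have "ennreal (R n) = (\<integral>\<^sup>+ \<xi>. ennreal (gauss (\<xi> /\<^sub>R real (Suc n)) * (Im k * Q \<xi>)) \<partial>lborel)"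
      unfolding R_def
      by (rule nn_integral_eq_integral[symmetric, OF Q_int])
        (intro AE_I2 mult_nonneg_nonneg less_imp_le[OF gauss_pos] Q0)
    also have "\<dots> \<le> (\<integral>\<^sup>+ \<xi>. ennreal (2 * N * A 1) * ennreal (g (k + of_real m) \<xi>)
        + ennreal (2 * N * A 2) * ennreal (g (k - of_real m) \<xi>) \<partial>lborel)"
    proof (rule nn_integral_mono)
      fix \<xi> :: "real ^ 2"
      have "gauss (\<xi> /\<^sub>R real (Suc n)) * (Im k * Q \<xi>) \<le> 1 * (Im k * Q \<xi>)"
        by (intro mult_right_mono gauss_le_1 Q0)
      also have "\<dots> \<le> 2 * N * A 1 * g (k + of_real m) \<xi> + 2 * N * A 2 * g (k - of_real m) \<xi>"
        using Q_le[of \<xi>] by simp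
      finally have "ennreal (gauss (\<xi> /\<^sub>R real (Suc n)) * (Im k * Q \<xi>))
          \<le> ennreal (2 * N * A 1 * g (k + of_real m) \<xi> + 2 * N * A 2 * g (k - of_real m) \<xi>)"
        by (rule ennreal_leI)
      then show "ennreal (gauss (\<xi> /\<^sub>R real (Suc n)) * (Im k * Q \<xi>))
          \<le> ennreal (2 * N * A 1) * ennreal (g (k + of_real m) \<xi>) + ennreal (2 * N * A 2) * ennreal (g (k - of_real m) \<xi>)"
        using N0 A0 g0 by (simp only: ennreal_plus ennreal_mult mult_nonneg_nonneg zero_le_numeral)
    qed
    also have "\<dots> = ennreal (2 * N * A 1) * ennreal (pi\<^sup>2 / 2 * Re ((k + of_real m) / \<mu>))
        + ennreal (2 * N * A 2) * ennreal (pi\<^sup>2 / 2 * Re ((k - of_real m) / \<mu>))"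
      unfolding G[symmetric] by (subst nn_integral_add) (auto simp: nn_integral_cmult)
    also have "\<dots> = ennreal (2 * N * A 1 * (pi\<^sup>2 / 2 * Re ((k + of_real m) / \<mu>)) + 2 * N * A 2 * (pi\<^sup>2 / 2 * Re ((k - of_real m) / \<mu>)))"
    proof -
      have "0 \<le> pi\<^sup>2 / 2 * Re ((k + of_real m) / \<mu>)" "0 \<le> pi\<^sup>2 / 2 * Re ((k - of_real m) / \<mu>)"
        "0 \<le> 2 * N * A 1" "0 \<le> 2 * N * A 2"
        using Re0 N0 A0 by (auto intro!: mult_nonneg_nonneg)
      then show ?thesis
        by (simp only: ennreal_plus ennreal_mult mult_nonneg_nonneg)
    qed
    finally have "R n \<le> 2 * N * A 1 * (pi\<^sup>2 / 2 * Re ((k + of_real m) / \<mu>)) + 2 * N * A 2 * (pi\<^sup>2 / 2 * Re ((k - of_real m) / \<mu>))"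
      by (rule ennreal_le_iff[THEN iffD1, rotated]) (use Re0 N0 A0 in \<open>auto intro!: add_nonneg_nonneg mult_nonneg_nonneg\<close>)
    then show ?thesis
      by (simp add: distrib_left mult_ac)
  qed
  then have "(2 * pi)\<^sup>2 * N \<le> pi\<^sup>2 * N * (A 1 * Re ((k + of_real m) / \<mu>) + A 2 * Re ((k - of_real m) / \<mu>))"
    by (intro LIMSEQ_le_const2[OF R_lim]) (use R_le in blast)
  then have "(pi\<^sup>2 * N) * 4 \<le> (pi\<^sup>2 * N) * (A 1 * Re ((k + of_real m) / \<mu>) + A 2 * Re ((k - of_real m) / \<mu>))"
    by (simp add: power_mult_distrib mult_ac)
  then show ?thesis
    using N_pos by (simp only: mult_le_cancel_left_pos mult_pos_pos zero_less_power pi_gt_zero)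
qed

section \<open>From the weak eigenvalue equation to the Fourier side\<close>

lemma square_integrable_borel_version:
  fixes g :: "real ^ 2 \<Rightarrow> complex"
  assumes g: "g \<in> L2"
  shows "\<exists>g'. square_integrable g' \<and> (AE x in lebesgue. g x = g' x)"
proof -
  have gm [measurable]: "g \<in> borel_measurable lebesgue"
    by (rule L2_measurable[OF g])
  have parts: "(\<lambda>x. Re (g x)) \<in> borel_measurable lebesgue" "(\<lambda>x. Im (g x)) \<in> borel_measurable lebesgue"
    by measurable
  obtain r where r: "r \<in> borel_measurable lborel" "AE x in lborel. Re (g x) = r x"
    using completion_ex_borel_measurable_real[OF parts(1)] by blast
  obtain i where i: "i \<in> borel_measurable lborel" "AE x in lborel. Im (g x) = i x"
    using completion_ex_borel_measurable_real[OF parts(2)] by blast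
  define g' where "g' x = Complex (r x) (i x)" for x
  have [measurable]: "r \<in> borel_measurable borel" "i \<in> borel_measurable borel"
    using r i by simp_all
  have g'_eq: "g' = (\<lambda>x. of_real (r x) + \<i> * of_real (i x))"
    by (simp add: g'_def fun_eq_iff Complex_eq)
  have g'm [measurable]: "g' \<in> borel_measurable borel"
    unfolding g'_eq by measurable
  have ae: "AE x in lebesgue. g x = g' x"
    by (rule AE_completion) (use r(2) i(2) in eventually_elim, simp add: g'_def complex_eq_iff)
  have "integrable lebesgue (\<lambda>x. (cmod (g' x))\<^sup>2)"
  proof (rule integrable_cong_AE_imp[OF L2_integrable_norm_sq[OF g]])
    have "(\<lambda>x. (cmod (g' x))\<^sup>2) \<in> borel_measurable lborel"
      by measurable
    then show "(\<lambda>x. (cmod (g' x))\<^sup>2) \<in> borel_measurable lebesgue"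
      by (rule measurable_completion)
    show "AE x in lebesgue. (cmod (g x))\<^sup>2 = (cmod (g' x))\<^sup>2"
      using ae by eventually_elim simp
  qed
  moreover have "(\<lambda>x. (cmod (g' x))\<^sup>2) \<in> borel_measurable lborel"
    by measurable
  ultimately have "integrable lborel (\<lambda>x. (cmod (g' x))\<^sup>2)"
    by (simp only: integrable_completion)
  then have "square_integrable g'"
    by (simp add: square_integrable_def)
  with ae show ?thesis by blast
qed

lemma cutoff_transform_eq_fourier:
  assumes g: "g \<in> borel_measurable lebesgue" and g': "g' \<in> borel_measurable borel"
    and ae: "AE x in lebesgue. g x = g' x"
  shows "(\<integral>x. of_real (cutoff n x) * cis (- (\<xi> \<bullet> x)) * g x \<partial>lebesgue) = cut_fourier n g' \<xi>"
proof -
  have [measurable]: "(\<lambda>x. complex_of_real (cutoff n x) * cis (- (\<xi> \<bullet> x))) \<in> borel_measurable borel"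
    by (intro borel_measurable_continuous_onI continuous_intros continuous_on_cutoff)
  have c: "(\<lambda>x. complex_of_real (cutoff n x) * cis (- (\<xi> \<bullet> x))) \<in> borel_measurable lebesgue"
    by (rule measurable_completion) simp
  have m: "(\<lambda>x. of_real (cutoff n x) * cis (- (\<xi> \<bullet> x)) * g' x) \<in> borel_measurable lborel"
    using g' by measurable
  have "(\<integral>x. of_real (cutoff n x) * cis (- (\<xi> \<bullet> x)) * g x \<partial>lebesgue)
      = (\<integral>x. of_real (cutoff n x) * cis (- (\<xi> \<bullet> x)) * g' x \<partial>lebesgue)"
  proof (rule integral_cong_AE)
    show "(\<lambda>x. of_real (cutoff n x) * cis (- (\<xi> \<bullet> x)) * g x) \<in> borel_measurable lebesgue"
      by (rule borel_measurable_times[OF c g])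
    show "(\<lambda>x. of_real (cutoff n x) * cis (- (\<xi> \<bullet> x)) * g' x) \<in> borel_measurable lebesgue"
      by (rule measurable_completion[OF m])
    show "AE x in lebesgue. of_real (cutoff n x) * cis (- (\<xi> \<bullet> x)) * g x = of_real (cutoff n x) * cis (- (\<xi> \<bullet> x)) * g' x"
      using ae by eventually_elim simp
  qed
  also have "\<dots> = (\<integral>x. of_real (cutoff n x) * cis (- (\<xi> \<bullet> x)) * g' x \<partial>lborel)"
    by (rule integral_completion[OF m])
  finally show ?thesis
    by (simp add: fourier_def mult_ac)
qed

lemma fourier_lincomb:
  assumes "integrable lborel f" "integrable lborel g"
  shows "fourier (\<lambda>x. f x + c * g x) \<xi> = fourier f \<xi> + c * fourier g \<xi>"
proof -
  have "fourier (\<lambda>x. f x + c * g x) \<xi> = (\<integral>x. cis (- (\<xi> \<bullet> x)) * f x + c * (cis (- (\<xi> \<bullet> x)) * g x) \<partial>lborel)"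
    unfolding fourier_def by (simp only: distrib_left mult.left_commute)
  also have "\<dots> = fourier f \<xi> + c * fourier g \<xi>"
    unfolding fourier_def
    by (subst Bochner_Integration.integral_add)
      (auto intro!: integrable_fourier_kernel(2) integrable_mult_right assms)
  finally show ?thesis .
qed

text \<open>Testing both components of the eigenvalue equation with truncated waves gives, for every frequency, a
two by two linear system for the truncated transforms of \<open>u\<close>, with the commutator terms as an additional
source. Cramer's rule solves it, and the solution converges together with its source.\<close>

lemma eigenfunction_fourier_limit:
  fixes U :: "real ^ 2 \<Rightarrow> complex ^ 2" and u f :: "2 \<Rightarrow> real ^ 2 \<Rightarrow> complex"
  assumes \<mu>: "\<mu>\<^sup>2 = k\<^sup>2 - (of_real m)\<^sup>2" and Im\<mu>: "0 < Im \<mu>"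
    and U: "U \<in> sobolev 2" and u: "\<And>j. square_integrable (u j)" and Uu: "\<And>j. AE x in lebesgue. U x $ j = u j x"
    and f: "\<And>j. square_integrable (f j)" and f1: "\<And>j. integrable lborel (f j)"
    and eq1: "AE x in lebesgue. 4 * d_zbar (d_zbar (\<lambda>y. U y $ 2)) x = f 1 x + (k - of_real m) * u 1 x"
    and eq2: "AE x in lebesgue. 4 * d_z (d_z (\<lambda>y. U y $ 1)) x = f 2 x + (k + of_real m) * u 2 x"
  obtains K where
    "\<And>\<xi>. (\<lambda>n. cut_fourier n (u 1) \<xi>)
      \<longlonglongrightarrow> resolvent1 k m \<mu> \<xi> (fourier (f 1) \<xi>) (fourier (f 2) \<xi>)"
    "\<And>\<xi>. (\<lambda>n. cut_fourier n (u 2) \<xi>)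
      \<longlonglongrightarrow> resolvent2 k m \<mu> \<xi> (fourier (f 1) \<xi>) (fourier (f 2) \<xi>)"
    "\<And>j n \<xi>. cmod (cut_fourier n (u j) \<xi>) \<le> K * (1 + (norm \<xi>)\<^sup>2)\<^sup>2"
proof -
  define hu where "hu j n \<xi> = cut_fourier n (u j) \<xi>" for j n \<xi>
  define hf where "hf j n \<xi> = cut_fourier n (f j) \<xi>" for j n \<xi>
  note sob = sobolev_component[OF U]
  have CR_meas: "(\<lambda>x. 4 * weak_CR s (weak_CR s (\<lambda>y. U y $ j)) x) \<in> borel_measurable lebesgue" for s j
    using L2_measurable[OF weak_CR_twice(1)[OF sob]] by measurable
  have U_meas: "(\<lambda>y. U y $ j) \<in> borel_measurable lebesgue" for j
    using sob[of j] by (auto simp: sobolev_def L2_measurable)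
  note u_meas = square_integrableD(1)[OF u] and f_meas = square_integrableD(1)[OF f]
  have split: "fourier (\<lambda>x. of_real (cutoff n x) * (f i x + c * u j x)) \<xi> = hf i n \<xi> + c * hu j n \<xi>" for i j c n \<xi>
    unfolding hf_def hu_def fourier_lincomb[OF cutoff_integrable[OF f] cutoff_integrable[OF u], symmetric]
    by (simp only: distrib_left mult.left_commute)
  have lincomb_meas: "(\<lambda>x. f i x + c * u j x) \<in> borel_measurable borel" for i j c
    using u_meas f_meas by measurable
  have lhs: "(\<integral>x. of_real (cutoff n x) * cis (- (\<xi> \<bullet> x)) * (4 * weak_CR s (weak_CR s (\<lambda>y. U y $ j)) x) \<partial>lebesgue)
      = hf i n \<xi> + c * hu i n \<xi>"
    if "AE x in lebesgue. 4 * weak_CR s (weak_CR s (\<lambda>y. U y $ j)) x = f i x + c * u i x" for i j s c n \<xi>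
    by (subst cutoff_transform_eq_fourier[OF CR_meas lincomb_meas that]) (rule split)
  have rhs: "(\<integral>x. of_real (cutoff n x) * cis (- (\<xi> \<bullet> x)) * U x $ j \<partial>lebesgue) = hu j n \<xi>" for j n \<xi>
    unfolding hu_def by (rule cutoff_transform_eq_fourier[OF U_meas u_meas Uu])
  obtain E2 K2 where W2: "\<And>n \<xi>. hf 1 n \<xi> + (k - of_real m) * hu 1 n \<xi>
        = (- \<i> * (of_real (\<xi> $ 1) + (- \<i>) * of_real (\<xi> $ 2)))\<^sup>2 * hu 2 n \<xi> + E2 n \<xi>"
      "\<And>n \<xi>. cmod (E2 n \<xi>) \<le> K2 * (1 + (norm \<xi>)\<^sup>2)" "\<And>\<xi>. (\<lambda>n. E2 n \<xi>) \<longlonglongrightarrow> 0"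
    using wave_transform[OF sob[of 2], of "- \<i>"]
    unfolding rhs lhs[OF eq1[unfolded d_zbar_eq_weak_CR]] by auto
  obtain E1 K1 where W1: "\<And>n \<xi>. hf 2 n \<xi> + (k + of_real m) * hu 2 n \<xi>
        = (- \<i> * (of_real (\<xi> $ 1) + \<i> * of_real (\<xi> $ 2)))\<^sup>2 * hu 1 n \<xi> + E1 n \<xi>"
      "\<And>n \<xi>. cmod (E1 n \<xi>) \<le> K1 * (1 + (norm \<xi>)\<^sup>2)" "\<And>\<xi>. (\<lambda>n. E1 n \<xi>) \<longlonglongrightarrow> 0"
    using wave_transform[OF sob[of 1], of \<i>]
    unfolding rhs lhs[OF eq2[unfolded d_z_eq_weak_CR]] by auto
  obtain Kf where Kf: "\<And>j n \<xi>. cmod (hf j n \<xi>) \<le> Kf j"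
    unfolding hf_def using cutoff_fourier_tendsto(2)[OF f1] by metis
  have hu_eq: "hu 1 n \<xi> = resolvent1 k m \<mu> \<xi> (hf 1 n \<xi> - E2 n \<xi>) (hf 2 n \<xi> - E1 n \<xi>)"
    "hu 2 n \<xi> = resolvent2 k m \<mu> \<xi> (hf 1 n \<xi> - E2 n \<xi>) (hf 2 n \<xi> - E1 n \<xi>)" for n \<xi>
  proof -
    have s: "(- \<i> * z)\<^sup>2 = - (z\<^sup>2)" for z
      by (simp add: power_mult_distrib)
    have z: "of_real (\<xi> $ 1) + (- \<i>) * of_real (\<xi> $ 2) = cnj (frequency \<xi>)"
      "of_real (\<xi> $ 1) + \<i> * of_real (\<xi> $ 2) = frequency \<xi>"
      by (simp_all add: frequency_def)
    have F: "hf 1 n \<xi> - E2 n \<xi> = (of_real m - k) * hu 1 n \<xi> - (cnj (frequency \<xi>))\<^sup>2 * hu 2 n \<xi>"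
      using W2(1)[of n \<xi>] unfolding z s by (simp add: algebra_simps)
    have G: "hf 2 n \<xi> - E1 n \<xi> = - (frequency \<xi>)\<^sup>2 * hu 1 n \<xi> - (of_real m + k) * hu 2 n \<xi>"
      using W1(1)[of n \<xi>] unfolding z s by (simp add: algebra_simps)
    show "hu 1 n \<xi> = resolvent1 k m \<mu> \<xi> (hf 1 n \<xi> - E2 n \<xi>) (hf 2 n \<xi> - E1 n \<xi>)"
      "hu 2 n \<xi> = resolvent2 k m \<mu> \<xi> (hf 1 n \<xi> - E2 n \<xi>) (hf 2 n \<xi> - E1 n \<xi>)"
      using resolvent_unique[OF \<mu> Im\<mu> F G] by auto
  qed
  define A where "A = \<bar>Kf 1\<bar> + \<bar>Kf 2\<bar> + \<bar>K1\<bar> + \<bar>K2\<bar>"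
  have growth: "cmod (h - e) \<le> A * (1 + (norm \<xi>)\<^sup>2)"
    if "cmod h \<le> a" "cmod e \<le> b * (1 + (norm \<xi>)\<^sup>2)" "\<bar>a\<bar> + \<bar>b\<bar> \<le> A" for h e a b and \<xi> :: "real ^ 2"
  proof -
    have "cmod (h - e) \<le> a + b * (1 + (norm \<xi>)\<^sup>2)"
      using norm_triangle_ineq4[of h e] that by linarith
    also have "\<dots> \<le> \<bar>a\<bar> * (1 + (norm \<xi>)\<^sup>2) + \<bar>b\<bar> * (1 + (norm \<xi>)\<^sup>2)"
    proof (rule add_mono)
      show "a \<le> \<bar>a\<bar> * (1 + (norm \<xi>)\<^sup>2)"
        using mult_left_mono[of 1 "1 + (norm \<xi>)\<^sup>2" "\<bar>a\<bar>"] abs_ge_self[of a] by simp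
      show "b * (1 + (norm \<xi>)\<^sup>2) \<le> \<bar>b\<bar> * (1 + (norm \<xi>)\<^sup>2)"
        by (intro mult_right_mono) auto
    qed
    also have "\<dots> \<le> A * (1 + (norm \<xi>)\<^sup>2)"
      unfolding distrib_right[symmetric] using that(3) by (intro mult_right_mono) auto
    finally show ?thesis .
  qed
  have FA: "cmod (hf 1 n \<xi> - E2 n \<xi>) \<le> A * (1 + (norm \<xi>)\<^sup>2)" and GA: "cmod (hf 2 n \<xi> - E1 n \<xi>) \<le> A * (1 + (norm \<xi>)\<^sup>2)" for n \<xi>
    by (rule growth[OF Kf W2(2)], simp add: A_def) (rule growth[OF Kf W1(2)], simp add: A_def)
  have lim: "(\<lambda>n. hf 1 n \<xi> - E2 n \<xi>) \<longlonglongrightarrow> fourier (f 1) \<xi>" "(\<lambda>n. hf 2 n \<xi> - E1 n \<xi>) \<longlonglongrightarrow> fourier (f 2) \<xi>" for \<xi>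
    using tendsto_diff[OF cutoff_fourier_tendsto(1)[OF f1[of 1]] W2(3)[of \<xi>]]
      tendsto_diff[OF cutoff_fourier_tendsto(1)[OF f1[of 2]] W1(3)[of \<xi>]] by (simp_all add: hf_def)
  show thesis
  proof (rule that)
    show "(\<lambda>n. cut_fourier n (u 1) \<xi>) \<longlonglongrightarrow> resolvent1 k m \<mu> \<xi> (fourier (f 1) \<xi>) (fourier (f 2) \<xi>)" for \<xi>
      unfolding hu_def[symmetric] hu_eq by (rule resolvent_tendsto(1)[OF \<mu> Im\<mu> lim])
    show "(\<lambda>n. cut_fourier n (u 2) \<xi>) \<longlonglongrightarrow> resolvent2 k m \<mu> \<xi> (fourier (f 1) \<xi>) (fourier (f 2) \<xi>)" for \<xi>
      unfolding hu_def[symmetric] hu_eq by (rule resolvent_tendsto(2)[OF \<mu> Im\<mu> lim])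
    show "cmod (cut_fourier n (u j) \<xi>)
        \<le> 2 * (cmod k + \<bar>m\<bar> + 1) * A / (Im \<mu>)\<^sup>2 * (1 + (norm \<xi>)\<^sup>2)\<^sup>2" for j n \<xi>
      using exhaust_2[of j] resolvent_growth[OF \<mu> Im\<mu> FA[of n \<xi>] GA[of n \<xi>]]
      unfolding hu_def[symmetric] by (auto simp: hu_eq)
  qed
qed

section \<open>The bound for eigenvalues\<close>

text \<open>The functions \<open>w\<close> and \<open>u\<close> are Borel representatives of the entries of \<open>W\<close> and of the eigenfunction. That
\<open>v = W u\<close> is square-integrable follows from the energy identity, as \<open>u\<close> and \<open>V u\<close> are; this and the
integrability of \<open>|W|\<^sup>2\<close> make \<open>f\<close> integrable.\<close>

lemma eigenvalue_bound_finite: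
  fixes W V :: "real ^ 2 \<Rightarrow> complex ^ 2 ^ 2"
  assumes W: "W \<in> borel_measurable lebesgue" and herm: "\<And>x. hermitian (W x)"
    and V: "\<And>x. V x = map_matrix (\<lambda>w. \<i> * w) (W x ** W x)"
    and VU: "\<And>u. u \<in> sobolev 2 \<Longrightarrow> (\<lambda>x. V x *v u x) \<in> L2"
    and k: "is_eigenvalue (sobolev 2) (D_pert m V) k"
    and Im\<mu>: "0 < Im \<mu>" and \<mu>: "\<mu>\<^sup>2 = k\<^sup>2 - (of_real m)\<^sup>2"
    and fin: "(\<integral>\<^sup>+ x. ennreal (\<Sum>i\<in>UNIV. \<Sum>j\<in>UNIV. (cmod (W x $ i $ j))\<^sup>2) \<partial>lebesgue) < \<infinity>"
  shows "\<exists>T\<ge>0. (\<integral>\<^sup>+ x. ennreal (\<Sum>i\<in>UNIV. \<Sum>j\<in>UNIV. (cmod (W x $ i $ j))\<^sup>2) \<partial>lebesgue) = ennreal T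
    \<and> 4 \<le> (cmod ((k + of_real m) / \<mu> - 1) + cmod ((k - of_real m) / \<mu> - 1) + 1) * T"
proof -
  let ?S = "\<lambda>x. \<Sum>i\<in>UNIV. \<Sum>j\<in>UNIV. (cmod (W x $ i $ j))\<^sup>2"
  have W_meas: "(\<lambda>x. W x $ i $ j) \<in> borel_measurable lebesgue" for i j
  proof -
    have "(\<lambda>A :: complex ^ 2 ^ 2. A $ i $ j) \<in> borel_measurable borel"
      by (intro borel_measurable_continuous_onI continuous_intros)
    then show ?thesis
      by (rule measurable_compose[OF W])
  qed
  have S_meas: "?S \<in> borel_measurable lebesgue"
    using W_meas by measurable
  have S0: "0 \<le> ?S x" for x
    by (intro sum_nonneg) auto
  have S_int: "integrable lebesgue ?S"
    using fin by (intro integrableI_nonneg S_meas AE_I2 S0) auto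
  have W_L2: "(\<lambda>x. W x $ i $ j) \<in> L2" for i j
  proof -
    have "(cmod (W x $ i $ j))\<^sup>2 \<le> ?S x" for x
    proof -
      have "(cmod (W x $ i $ j))\<^sup>2 \<le> (\<Sum>j\<in>UNIV. (cmod (W x $ i $ j))\<^sup>2)"
        by (rule member_le_sum) auto
      also have "\<dots> \<le> ?S x"
        by (rule member_le_sum[where f="\<lambda>i. \<Sum>j\<in>UNIV. (cmod (W x $ i $ j))\<^sup>2"]) (auto intro: sum_nonneg)
      finally show ?thesis .
    qed
    then have "integrable lebesgue (\<lambda>x. (cmod (W x $ i $ j))\<^sup>2)"
      by (intro Bochner_Integration.integrable_bound[OF S_int])
        (use W_meas[of i j] in \<open>measurable\<close>, intro AE_I2, simp only: real_norm_def abs_power2 abs_of_nonneg[OF S0])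
    then show ?thesis
      by (simp add: L2_def W_meas)
  qed
  obtain U where U: "U \<in> sobolev 2" and U_nz: "\<not> (AE x in lebesgue. U x = 0)"
    and U_eq: "AE x in lebesgue. D_pert m V U x = k *s U x"
    using k by (auto simp: is_eigenvalue_def)
  have U_L2: "U \<in> L2" and VU_L2: "(\<lambda>x. V x *v U x) \<in> L2"
    using U VU by (auto simp: sobolev_def)
  define w where "w i j = (SOME g. square_integrable g \<and> (AE x in lebesgue. W x $ i $ j = g x))" for i j
  have w: "square_integrable (w i j)" and Ww: "AE x in lebesgue. W x $ i $ j = w i j x" for i j
    using someI_ex[OF square_integrable_borel_version[OF W_L2[of i j]]] by (simp_all add: w_def)
  define u where "u j = (SOME g. square_integrable g \<and> (AE x in lebesgue. U x $ j = g x))" for j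
  have u: "square_integrable (u j)" and Uu: "AE x in lebesgue. U x $ j = u j x" for j
    using someI_ex[OF square_integrable_borel_version[OF vec_component_L2[OF U_L2, of j]]] by (simp_all add: u_def)
  have Ww_all: "AE x in lebesgue. \<forall>i j. W x $ i $ j = w i j x"
    using Ww by (simp add: AE_all_countable)
  have Uu_all: "AE x in lebesgue. \<forall>j. U x $ j = u j x"
    using Uu by (simp add: AE_all_countable)
  define v where "v i x = w i 1 x * u 1 x + w i 2 x * u 2 x" for i x
  define f where "f i x = - \<i> * (w i 1 x * v 1 x + w i 2 x * v 2 x)" for i x
  note [measurable] = square_integrableD(1)[OF u] square_integrableD(1)[OF w]
  have v_meas [measurable]: "v i \<in> borel_measurable borel" for i
    unfolding v_def[abs_def] by measurable
  have f_meas [measurable]: "f i \<in> borel_measurable borel" for i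
    unfolding f_def[abs_def] by measurable
  have f_VU: "AE x in lebesgue. \<forall>i. f i x = - (V x *v U x) $ i"
    using Ww_all Uu_all
  proof eventually_elim
    case (elim x)
    show ?case
      using elim by (simp add: f_def v_def V matrix_vector_entry_2 matrix_mult_entry_2 map_matrix_def algebra_simps)
  qed
  have f: "square_integrable (f i)" for i
  proof -
    have "integrable lebesgue (\<lambda>x. (cmod (f i x))\<^sup>2)"
    proof (rule integrable_cong_AE_imp[OF L2_integrable_norm_sq[OF vec_component_L2[OF VU_L2, of i]]])
      have "(\<lambda>x. (cmod (f i x))\<^sup>2) \<in> borel_measurable lborel"
        by measurable
      then show "(\<lambda>x. (cmod (f i x))\<^sup>2) \<in> borel_measurable lebesgue"
        by (rule measurable_completion)
      show "AE x in lebesgue. (cmod ((V x *v U x) $ i))\<^sup>2 = (cmod (f i x))\<^sup>2"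
        using f_VU by eventually_elim simp
    qed
    moreover have "(\<lambda>x. (cmod (f i x))\<^sup>2) \<in> borel_measurable lborel"
      by measurable
    ultimately have "integrable lborel (\<lambda>x. (cmod (f i x))\<^sup>2)"
      by (simp only: integrable_completion)
    then show ?thesis
      by (simp add: square_integrable_def)
  qed
  have herm_w: "AE x in lborel. \<forall>i j. w j i x = cnj (w i j x)"
    using Ww_all unfolding AE_completion_iff
  proof eventually_elim
    case (elim x)
    then show ?case
      using hermitian_entry[OF herm[of x]] by metis
  qed
  have v: "square_integrable (v i)" for i
  proof -
    have int: "integrable lborel (\<lambda>x. \<i> * (cnj (u 1 x) * f 1 x + cnj (u 2 x) * f 2 x))"
      by (intro integrable_mult_right Bochner_Integration.integrable_add square_integrable_product(1) u f)
    have "integrable lborel (\<lambda>x. (cmod (v i x))\<^sup>2)"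
    proof (rule Bochner_Integration.integrable_bound[OF int])
      show "AE x in lborel. norm ((cmod (v i x))\<^sup>2) \<le> norm (\<i> * (cnj (u 1 x) * f 1 x + cnj (u 2 x) * f 2 x))"
        using herm_w
      proof eventually_elim
        case (elim x)
        have "\<i> * (cnj (u 1 x) * f 1 x + cnj (u 2 x) * f 2 x) = of_real ((cmod (v 1 x))\<^sup>2 + (cmod (v 2 x))\<^sup>2)"
          unfolding f_def
          by (rule hermitian_energy_identity[where w="\<lambda>i j. w i j x" and v="\<lambda>i. v i x" and u="\<lambda>i. u i x"])
            (use elim v_def in blast)+
        then have "norm (\<i> * (cnj (u 1 x) * f 1 x + cnj (u 2 x) * f 2 x)) = (cmod (v 1 x))\<^sup>2 + (cmod (v 2 x))\<^sup>2"
          by (simp only: norm_of_real) simp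
        then show ?case
          using exhaust_2[of i] by auto
      qed
    qed measurable
    then show ?thesis
      by (simp add: square_integrable_def)
  qed
  have f1: "integrable lborel (f i)" for i
    unfolding f_def[abs_def]
    by (intro integrable_mult_right Bochner_Integration.integrable_add square_integrable_mult_integrable w v)
  have eq1: "AE x in lebesgue. 4 * d_zbar (d_zbar (\<lambda>y. U y $ 2)) x = f 1 x + (k - of_real m) * u 1 x"
    using U_eq f_VU Uu_all
  proof eventually_elim
    case (elim x)
    have "of_real m * U x $ 1 + 4 * d_zbar (d_zbar (\<lambda>y. U y $ 2)) x + (V x *v U x) $ 1 = k * U x $ 1"
      using arg_cong[OF elim(1), of "\<lambda>y. y $ 1"] by (simp add: D_pert_def D_free_def)
    with elim show ?case by (simp add: algebra_simps)
  qed
  have eq2: "AE x in lebesgue. 4 * d_z (d_z (\<lambda>y. U y $ 1)) x = f 2 x + (k + of_real m) * u 2 x"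
    using U_eq f_VU Uu_all
  proof eventually_elim
    case (elim x)
    have "4 * d_z (d_z (\<lambda>y. U y $ 1)) x - of_real m * U x $ 2 + (V x *v U x) $ 2 = k * U x $ 2"
      using arg_cong[OF elim(1), of "\<lambda>y. y $ 2"] by (simp add: D_pert_def D_free_def)
    with elim show ?case by (simp add: algebra_simps)
  qed
  have nz: "\<not> (AE x in lborel. u 1 x = 0 \<and> u 2 x = 0)"
  proof
    assume "AE x in lborel. u 1 x = 0 \<and> u 2 x = 0"
    then have "AE x in lebesgue. u 1 x = 0 \<and> u 2 x = 0"
      by (rule AE_completion)
    then have "AE x in lebesgue. U x = 0"
      using Uu_all by eventually_elim (simp add: vec_eq_iff forall_2)
    with U_nz show False by simp
  qed
  define A where "A i = (square_integral (w i 1)) + (square_integral (w i 2))" for i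
  have A0: "0 \<le> A i" for i
    by (simp add: A_def)
  obtain K where K:
    "\<And>\<xi>. (\<lambda>n. cut_fourier n (u 1) \<xi>)
      \<longlonglongrightarrow> resolvent1 k m \<mu> \<xi> (fourier (f 1) \<xi>) (fourier (f 2) \<xi>)"
    "\<And>\<xi>. (\<lambda>n. cut_fourier n (u 2) \<xi>)
      \<longlonglongrightarrow> resolvent2 k m \<mu> \<xi> (fourier (f 1) \<xi>) (fourier (f 2) \<xi>)"
    "\<And>j n \<xi>. cmod (cut_fourier n (u j) \<xi>) \<le> K * (1 + (norm \<xi>)\<^sup>2)\<^sup>2"
    by (rule eigenfunction_fourier_limit[OF \<mu> Im\<mu> U u Uu f f1 eq1 eq2]) (rule that)
  have "4 \<le> A 1 * Re ((k + of_real m) / \<mu>) + A 2 * Re ((k - of_real m) / \<mu>)"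
    unfolding A_def by (rule Birman_Schwinger_bound[OF \<mu> Im\<mu> u w v f v_def f_def herm_w K nz])
  also have "\<dots> \<le> A 1 * (cmod ((k + of_real m) / \<mu> - 1) + cmod ((k - of_real m) / \<mu> - 1) + 1)
      + A 2 * (cmod ((k + of_real m) / \<mu> - 1) + cmod ((k - of_real m) / \<mu> - 1) + 1)"
  proof -
    have "Re z \<le> cmod (z - 1) + 1" for z
      using complex_Re_le_cmod[of "z - 1"] by simp
    then have "Re ((k + of_real m) / \<mu>) \<le> cmod ((k + of_real m) / \<mu> - 1) + cmod ((k - of_real m) / \<mu> - 1) + 1"
      "Re ((k - of_real m) / \<mu>) \<le> cmod ((k + of_real m) / \<mu> - 1) + cmod ((k - of_real m) / \<mu> - 1) + 1"
      by (smt (verit) norm_ge_zero)+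
    then show ?thesis
      by (intro add_mono mult_left_mono A0)
  qed
  also have "\<dots> = (cmod ((k + of_real m) / \<mu> - 1) + cmod ((k - of_real m) / \<mu> - 1) + 1) * (A 1 + A 2)"
    by (simp only: distrib_right[symmetric] mult.commute)
  finally have bound: "4 \<le> (cmod ((k + of_real m) / \<mu> - 1) + cmod ((k - of_real m) / \<mu> - 1) + 1) * (A 1 + A 2)" .
  have "(\<integral>\<^sup>+ x. ennreal (?S x) \<partial>lebesgue) = (\<integral>\<^sup>+ x. ennreal (\<Sum>i\<in>UNIV. \<Sum>j\<in>UNIV. (cmod (w i j x))\<^sup>2) \<partial>lebesgue)"
    by (rule nn_integral_cong_AE) (use Ww_all in eventually_elim, simp)
  also have "\<dots> = (\<integral>\<^sup>+ x. ennreal (\<Sum>i\<in>UNIV. \<Sum>j\<in>UNIV. (cmod (w i j x))\<^sup>2) \<partial>lborel)"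
    by (rule nn_integral_completion)
  also have "\<dots> = ennreal (\<integral>x. (\<Sum>i\<in>UNIV. \<Sum>j\<in>UNIV. (cmod (w i j x))\<^sup>2) \<partial>lborel)"
    by (rule nn_integral_eq_integral)
      (intro Bochner_Integration.integrable_sum square_integrableD(2) w, intro AE_I2 sum_nonneg zero_le_power2)
  also have "(\<integral>x. (\<Sum>i\<in>UNIV. \<Sum>j\<in>UNIV. (cmod (w i j x))\<^sup>2) \<partial>lborel) = A 1 + A 2"
    by (simp add: sum_2 A_def square_integrableD(2)[OF w])
  finally show ?thesis
    using bound A0 by (intro exI[of _ "A 1 + A 2"]) simp
qed

theorem theorem3p1:
  "\<exists>C::real. 0 \<le> C \<and>
    (\<forall>(m::real) (W :: real ^ 2 \<Rightarrow> complex ^ 2 ^ 2) (V :: real ^ 2 \<Rightarrow> complex ^ 2 ^ 2)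
       (k::complex) (\<mu>::complex).
      0 \<le> m \<longrightarrow>
      W \<in> borel_measurable lebesgue \<longrightarrow>
      (\<forall>x. hermitian (W x)) \<longrightarrow>
      (\<forall>x. V x = map_matrix (\<lambda>w. \<i> * w) (W x ** W x)) \<longrightarrow>
      (\<forall>u\<in>sobolev 2. (\<lambda>x. V x *v u x) \<in> L2) \<longrightarrow>
      k \<notin> spectrum (sobolev 2) (D_free m) \<longrightarrow>
      is_eigenvalue (sobolev 2) (D_pert m V) k \<longrightarrow>
      0 < Im \<mu> \<longrightarrow>
      \<mu>\<^sup>2 = k\<^sup>2 - (of_real m)\<^sup>2 \<longrightarrow>
      ennreal ((C * (cmod ((k + of_real m) / \<mu> - 1) + cmod ((k - of_real m) / \<mu> - 1)) + 1) * (1 / 4))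
        * (\<integral>\<^sup>+ x. ennreal (Re (trace (matrix_abs (V x)))) \<partial>lebesgue) \<ge> 1)"
proof (intro exI[of _ 1] conjI allI impI)
  fix m :: real and W V :: "real ^ 2 \<Rightarrow> complex ^ 2 ^ 2" and k \<mu> :: complex
  assume W: "W \<in> borel_measurable lebesgue" and herm: "\<forall>x. hermitian (W x)"
    and V: "\<forall>x. V x = map_matrix (\<lambda>w. \<i> * w) (W x ** W x)"
    and VU: "\<forall>u\<in>sobolev 2. (\<lambda>x. V x *v u x) \<in> L2"
    and k: "is_eigenvalue (sobolev 2) (D_pert m V) k"
    and Im\<mu>: "0 < Im \<mu>" and \<mu>: "\<mu>\<^sup>2 = k\<^sup>2 - (of_real m)\<^sup>2"
  let ?c = "(1 * (cmod ((k + of_real m) / \<mu> - 1) + cmod ((k - of_real m) / \<mu> - 1)) + 1) * (1 / 4)"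
  let ?I = "\<integral>\<^sup>+ x. ennreal (\<Sum>i\<in>UNIV. \<Sum>j\<in>UNIV. (cmod (W x $ i $ j))\<^sup>2) \<partial>lebesgue"
  have tr: "Re (trace (matrix_abs (V x))) = (\<Sum>i\<in>UNIV. \<Sum>j\<in>UNIV. (cmod (W x $ i $ j))\<^sup>2)" for x
    using V herm by (simp only: matrix_abs_i_square trace_square_hermitian_2)
  have c: "0 < ?c"
    by (simp add: add_nonneg_pos)
  have "1 \<le> ennreal ?c * ?I"
  proof (cases "?I = \<infinity>")
    case True
    then show ?thesis
      using c by (simp add: ennreal_mult_top)
  next
    case False
    then have "?I < \<infinity>"
      by (simp add: less_top)
    then obtain T where "0 \<le> T" "?I = ennreal T"
      and T: "4 \<le> (cmod ((k + of_real m) / \<mu> - 1) + cmod ((k - of_real m) / \<mu> - 1) + 1) * T"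
      using eigenvalue_bound_finite[OF W _ _ _ k Im\<mu> \<mu>] herm V VU by blast
    then have "ennreal ?c * ?I = ennreal (?c * T)"
      using c by (simp only: ennreal_mult less_imp_le)
    moreover have "1 \<le> ?c * T"
      using T by simp
    ultimately show ?thesis
      by (metis ennreal_1 ennreal_leI)
  qed
  then show "1 \<le> ennreal ?c * (\<integral>\<^sup>+ x. ennreal (Re (trace (matrix_abs (V x)))) \<partial>lebesgue)"
    unfolding tr .
qed simp

end
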